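(* Let $H_0:\mathbb{R}\to\mathbb{R}$ be of class $C^1$ with derivative $H_0'$ strictly increasing and locally Lipschitz (Lipschitz on every $[-P,P]$), and such that for every $N>0$ there is $P>0$ with $H_0(p)>N|p|$ whenever $|p|>P$. Let $U:\mathbb{R}^2\to\mathbb{R}$, $(t,x)\mapsto U(t,x)$, be of class $C^1$ with $\partial U/\partial x$ Lipschitz and $U(t+1,x)=U(t,x+1)=U(t,x)$ for all $(t,x)$. Let $a\in\mathbb{R}$, let $H(a)$ be the number defined in the context, and let $s^a:\mathbb{R}^2\to\mathbb{R}$ be a continuous function, 1-periodic in each of $t$ and $x$, such that $S^a(t,x)=ax-H(a)t+s^a(t,x)$ is a viscosity solution of $$\frac{\partial S}{\partial t}+H_0\left(\frac{\partial S}{\partial x}\right)+U(t,x)=0 .$$ Let $\omega(a)$ be the corresponding rotation number (defined in the context). If $\omega(a)$ is irrational, then $s^a$ is unique up to an additive constant: for every continuous function $\tilde s:\mathbb{R}^2\to\mathbb{R}$, 1-periodic in each of $t$ and $x$, such that $ax-H(a)t+\tilde s(t,x)$ is a viscosity solution of the same equation, the difference $\tilde s-s^a$ is constant on $\mathbb{R}^2$.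
   Context: Value function. $L_0(v)=\max_{p\in\mathbb{R}}(pv-H_0(p))$ is the Legendre transform of $H_0$ (a $C^1$ function with $L_0'(H_0'(p))=p$). For $s<t$ and $x,y\in\mathbb{R}$, $L(s,y;t,x)$ is the infimum of $\int_s^t[L_0(\xi'(\tau))-U(\tau,\xi(\tau))]\,d\tau$ over all absolutely continuous $\xi:[s,t]\to\mathbb{R}$ with $\xi(s)=y$, $\xi(t)=x$ and Lebesgue integrable integrand. Viscosity solution (Crandall--Lions): a continuous $S$ such that for every $C^1$ function $\varphi$, $\partial_t\varphi+H_0(\partial_x\varphi)+U\le0$ at every local maximum point of $S-\varphi$, and $\ge0$ at every local minimum point of $S-\varphi$. The paper works with viscosity solutions through the Lax--Oleinik formula: for initial data $S_0(x)=ax+s_0(x)$ with $s_0$ continuous 1-periodic, the viscosity solution of the Cauchy problem for $t>0$ is $S(t,x)=\inf_{y\in\mathbb{R}}(S_0(y)+L(0,y;t,x))$. The number $H(a)$: $H(a)=\lim_{n\to\infty}H_n(a)$ (the limit exists), where $H_n(a)=\max_{(y,x)\in\mathbb{R}^2}\left(-\frac1nL(0,y;n,x)+a\frac{x-y}{n}\right)$, $n=1,2,\dots$. Rotation number. Put $L_a(y,x)=L(0,y;1,x)+a(y-x)+H(a)$ and, with abuse of notation, $s^a(x)=s^a(0,x)$, which satisfies $s^a(x)=\min_{y\in\mathbb{R}}(s^a(y)+L_a(y,x))$ for all $x$. Define the many-valued map $Y^a(x)=\{y\in\mathbb{R}: s^a(y)+L_a(y,x)=s^a(x)\}$ (the set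 of minimizers), and for $X\subset\mathbb{R}$ let $Y^a(X)=\bigcup_{x\in X}Y^a(x)$. Let $M_0=\mathbb{R}$, $M_n=Y^a(M_{n-1})$ for $n\ge1$, and $M^a=\bigcap_{n\ge0}M_n$ (the invariant set). The set $M^a$ is nonempty and $Y^a$ restricts to a single-valued bijection of $M^a$ onto itself. For $x\in M^a$ let $x_k=(Y^a|_{M^a})^{-k}(x)$, $k\in\mathbb{Z}$; the limit $\lim_{k\to\pm\infty}(x_k-x_0)/k$ exists and does not depend on $x\in M^a$. This limit is the rotation number $\omega(a)$ corresponding to $s^a$. *)

theory Defs
  imports "HOL-Analysis.Analysis"
begin

definition C1_on_plane :: "(real \<times> real \<Rightarrow> real) \<Rightarrow> bool" where
  "C1_on_plane f \<longleftrightarrow>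
     (\<exists>f'. (\<forall>z. (f has_derivative blinfun_apply (f' z)) (at z)) \<and> continuous_on UNIV f')"

definition partial_t :: "(real \<times> real \<Rightarrow> real) \<Rightarrow> real \<times> real \<Rightarrow> real" where
  "partial_t f z = deriv (\<lambda>\<tau>. f (\<tau>, snd z)) (fst z)"

definition partial_x :: "(real \<times> real \<Rightarrow> real) \<Rightarrow> real \<times> real \<Rightarrow> real" where
  "partial_x f z = deriv (\<lambda>\<xi>. f (fst z, \<xi>)) (snd z)"

definition periodic_1_1 :: "(real \<times> real \<Rightarrow> real) \<Rightarrow> bool" where
  "periodic_1_1 f \<longleftrightarrow> (\<forall>t x. f (t + 1, x) = f (t, x) \<and> f (t, x + 1) = f (t, x))"

definition viscosity_solution ::
    "(real \<Rightarrow> real) \<Rightarrow> (real \<times> real \<Rightarrow> real) \<Rightarrow> (real \<times> real \<Rightarrow> real) \<Rightarrow> bool" where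
  "viscosity_solution H0 U S \<longleftrightarrow>
     continuous_on UNIV S \<and>
     (\<forall>\<phi>. C1_on_plane \<phi> \<longrightarrow>
        (\<forall>z. (\<forall>\<^sub>F w in nhds z. S w - \<phi> w \<le> S z - \<phi> z) \<longrightarrow>
             partial_t \<phi> z + H0 (partial_x \<phi> z) + U z \<le> 0) \<and>
        (\<forall>z. (\<forall>\<^sub>F w in nhds z. S w - \<phi> w \<ge> S z - \<phi> z) \<longrightarrow>
             partial_t \<phi> z + H0 (partial_x \<phi> z) + U z \<ge> 0))"

text \<open>The maximum, the infimum and the maximum in \<open>legendre\<close>, \<open>min_action\<close> and \<open>Hn\<close> are
  rendered by the real-valued \<open>SUP\<close> and \<open>INF\<close>; for a superlinear \<open>H0\<close> of class \<open>C\<^sup>1\<close> with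
  strictly increasing derivative and a periodic \<open>C\<^sup>1\<close> potential \<open>U\<close> all the families are
  nonempty and bounded on the relevant side, and the two maxima are attained.\<close>

definition legendre :: "(real \<Rightarrow> real) \<Rightarrow> real \<Rightarrow> real" where
  "legendre H0 v = (SUP p. p * v - H0 p)"

definition abs_continuous_on :: "real \<Rightarrow> real \<Rightarrow> (real \<Rightarrow> real) \<Rightarrow> bool" where
  "abs_continuous_on s t \<xi> \<longleftrightarrow>
     (\<forall>\<epsilon>>0. \<exists>\<delta>>0. \<forall>D. finite D \<longrightarrow>
        (\<forall>(u, v)\<in>D. s \<le> u \<and> u \<le> v \<and> v \<le> t) \<longrightarrow>
        disjoint_family_on (\<lambda>(u, v). {u<..<v}) D \<longrightarrow>
        (\<Sum>(u, v)\<in>D. v - u) < \<delta> \<longrightarrow>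
        (\<Sum>(u, v)\<in>D. \<bar>\<xi> v - \<xi> u\<bar>) < \<epsilon>)"

text \<open>An absolutely continuous \<open>\<xi>\<close> is differentiable only almost everywhere; the unspecified
  values of \<open>deriv \<xi>\<close> on the exceptional Lebesgue null set affect neither the integrability nor
  the integral. Values of \<open>\<xi>\<close> outside \<open>[s, t]\<close> play no role.\<close>

definition lagrangian ::
    "(real \<Rightarrow> real) \<Rightarrow> (real \<times> real \<Rightarrow> real) \<Rightarrow> (real \<Rightarrow> real) \<Rightarrow> real \<Rightarrow> real" where
  "lagrangian H0 U \<xi> \<tau> = legendre H0 (deriv \<xi> \<tau>) - U (\<tau>, \<xi> \<tau>)"

definition admissible_curves ::
    "(real \<Rightarrow> real) \<Rightarrow> (real \<times> real \<Rightarrow> real) \<Rightarrow> real \<Rightarrow> real \<Rightarrow> real \<Rightarrow> real \<Rightarrow> (real \<Rightarrow> real) set" where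
  "admissible_curves H0 U s y t x =
     {\<xi>. abs_continuous_on s t \<xi> \<and> \<xi> s = y \<and> \<xi> t = x \<and>
         set_integrable lebesgue {s..t} (lagrangian H0 U \<xi>)}"

definition min_action ::
    "(real \<Rightarrow> real) \<Rightarrow> (real \<times> real \<Rightarrow> real) \<Rightarrow> real \<Rightarrow> real \<Rightarrow> real \<Rightarrow> real \<Rightarrow> real" where
  "min_action H0 U s y t x =
     (INF \<xi>\<in>admissible_curves H0 U s y t x.
        set_lebesgue_integral lebesgue {s..t} (lagrangian H0 U \<xi>))"

definition Hn :: "(real \<Rightarrow> real) \<Rightarrow> (real \<times> real \<Rightarrow> real) \<Rightarrow> real \<Rightarrow> nat \<Rightarrow> real" where
  "Hn H0 U a n =
     (SUP (y, x)\<in>UNIV. - (1 / real n) * min_action H0 U 0 y (real n) x + a * ((x - y) / real n))"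

definition Hlim :: "(real \<Rightarrow> real) \<Rightarrow> (real \<times> real \<Rightarrow> real) \<Rightarrow> real \<Rightarrow> real" where
  "Hlim H0 U a = lim (Hn H0 U a)"

definition La :: "(real \<Rightarrow> real) \<Rightarrow> (real \<times> real \<Rightarrow> real) \<Rightarrow> real \<Rightarrow> real \<Rightarrow> real \<Rightarrow> real" where
  "La H0 U a y x = min_action H0 U 0 y 1 x + a * (y - x) + Hlim H0 U a"

definition Ya ::
    "(real \<Rightarrow> real) \<Rightarrow> (real \<times> real \<Rightarrow> real) \<Rightarrow> real \<Rightarrow> (real \<times> real \<Rightarrow> real) \<Rightarrow> real \<Rightarrow> real set" where
  "Ya H0 U a s x = {y. s (0, y) + La H0 U a y x = s (0, x)}"

primrec Mn ::
    "(real \<Rightarrow> real) \<Rightarrow> (real \<times> real \<Rightarrow> real) \<Rightarrow> real \<Rightarrow> (real \<times> real \<Rightarrow> real) \<Rightarrow> nat \<Rightarrow> real set" where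
  "Mn H0 U a s 0 = UNIV"
| "Mn H0 U a s (Suc n) = (\<Union>x\<in>Mn H0 U a s n. Ya H0 U a s x)"

definition Ma ::
    "(real \<Rightarrow> real) \<Rightarrow> (real \<times> real \<Rightarrow> real) \<Rightarrow> real \<Rightarrow> (real \<times> real \<Rightarrow> real) \<Rightarrow> real set" where
  "Ma H0 U a s = (\<Inter>n. Mn H0 U a s n)"

text \<open>On \<open>Ma\<close> the map \<open>Ya\<close> is single-valued and bijective; \<open>the_elem\<close> extracts the single value,
  and \<open>orbit\<close> gives \<open>x\<^sub>k = (Ya restricted to Ma)\<^sup>-\<^sup>k x\<close>.\<close>

definition Ya_map ::
    "(real \<Rightarrow> real) \<Rightarrow> (real \<times> real \<Rightarrow> real) \<Rightarrow> real \<Rightarrow> (real \<times> real \<Rightarrow> real) \<Rightarrow> real \<Rightarrow> real" where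
  "Ya_map H0 U a s x = the_elem (Ya H0 U a s x)"

definition orbit ::
    "(real \<Rightarrow> real) \<Rightarrow> (real \<times> real \<Rightarrow> real) \<Rightarrow> real \<Rightarrow> (real \<times> real \<Rightarrow> real) \<Rightarrow> real \<Rightarrow> int \<Rightarrow> real" where
  "orbit H0 U a s x k =
     (if k \<ge> 0 then (inv_into (Ma H0 U a s) (Ya_map H0 U a s) ^^ nat k) x
      else (Ya_map H0 U a s ^^ nat (- k)) x)"

definition rotation_number ::
    "(real \<Rightarrow> real) \<Rightarrow> (real \<times> real \<Rightarrow> real) \<Rightarrow> real \<Rightarrow> (real \<times> real \<Rightarrow> real) \<Rightarrow> real" where
  "rotation_number H0 U a s =
     (THE \<omega>. \<forall>x\<in>Ma H0 U a s.
        ((\<lambda>k. (orbit H0 U a s x k - orbit H0 U a s x 0) / of_int k) \<longlongrightarrow> \<omega>) at_top \<and>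
        ((\<lambda>k. (orbit H0 U a s x k - orbit H0 U a s x 0) / of_int k) \<longlongrightarrow> \<omega>) at_bot)"

end

theory Submission
  imports Defs
begin

text \<open>
  Write \<open>L(y, x)\<close> for the minimal action over unit time. A viscosity solution is
  calibrated by \<open>L\<close>: testing it along segments shows that it is dominated by the
  action, and comparing it with the infimum of the costs of polygonal curves, by doubling of
  variables, shows that the minimum in the Lax--Oleinik formula is attained. So both \<open>s =
  s\<^sup>a(0, \<cdot>)\<close> and \<open>s' = s~(0, \<cdot>)\<close> are fixed points of the
  Lax--Oleinik operator of \<open>L\<close>.

  Minimal chains of the time-discretized action with \<open>n\<close> steps satisfy a symplectic
  Euler scheme for the Hamiltonian flow, with momenta bounded independently of \<open>n\<close>. At
  an optimal intermediate point the momenta on both sides agree in the limit, and Gronwall's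
  inequality for the scheme, which needs only that the derivatives of \<open>H0\<close> and
  \<open>U\<close> are Lipschitz, shows that minimizing orbits do not branch. Together with the
  crossing inequality for \<open>L\<close> this makes minimizing orbits ordered.

  If the rotation number is irrational, a calibrated orbit \<open>x\<^sub>k\<close> of
  \<open>s\<close> is ordered modulo 1 like the orbit of an irrational rotation. The difference
  \<open>s' - s\<close> does not increase along it, and the limit points for \<open>k \<rightarrow>
  \<infinity>\<close> and \<open>k \<rightarrow> -\<infinity>\<close> are the same, so \<open>s' -
  s\<close> has a constant value \<open>c\<close> on the orbit, which is then calibrated for
  \<open>s'\<close> as well. Every backward minimizing orbit of \<open>s\<close> or
  \<open>s'\<close> runs through pairwise disjoint gaps of the closure of the orbit modulo 1, whose
  lengths are summable, so it approaches the orbit. For \<open>s\<close> this yields \<open>s' - s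
  \<le> c\<close> and for \<open>s'\<close> it yields \<open>s' - s \<ge> c\<close>.
\<close>

section \<open>Absolutely continuous functions\<close>

text \<open>No minimizing curve of the continuous action is ever constructed. Periodicity, crossing,
  Lipschitz bounds and non-branching are all obtained from \<open>mcost n\<close>, with constants
  independent of \<open>n\<close>, and reach \<open>min_action\<close> through
  \<open>mcost_limit\<close>. Non-branching is an exact statement that holds only approximately at
  finite \<open>n\<close>, so it is kept quantitative: momenta agree up to \<open>e\<close> for
  large \<open>n\<close>, and the Gronwall factor does not depend on \<open>n\<close>. The price is
  \<open>mcost_limit\<close> itself. Sampling an arbitrary admissible curve uses Jensen's inequality
  with the true increments, hence the fundamental theorem of calculus for absolutely continuous
  functions; the first section derives it from Vitali's covering theorem. The dynamical argument
  sees only the unit-time kernel, through the locale \<open>twist_kernel\<close>. It makes the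
  difference of two solutions constant at time 0; comparison and periodicity carry this to all
  times. Polygonal curves suit the viscosity side because their value function is a subsolution by
  mere concatenation of segments.\<close>

lemma division_sum_telescope:
  fixes \<phi> :: "real \<Rightarrow> real"
  assumes "D division_of {u..v}" "u \<le> v"
  shows "(\<Sum>k\<in>D. \<phi> (Sup k) - \<phi> (Inf k)) = \<phi> v - \<phi> u"
proof -
  \<comment> \<open>Tagging every piece by its left endpoint makes the telescoping identity for
    tagged divisions applicable.\<close>
  let ?p = "(\<lambda>k. (Inf k, k)) ` D"
  note D = division_ofD[OF assms(1)]
  have k: "Inf k \<in> k" if k: "k \<in> D" for k
  proof -
    obtain c d where cd: "k = cbox c d" using D(4)[OF k] by blast
    with D(3)[OF k] have "c \<le> d" by auto
    then show ?thesis using cd by simp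
  qed
  have "?p tagged_division_of {u..v}"
  proof (rule tagged_division_ofI)
    show "finite ?p" using D(1) by simp
    show "\<Union>{K. \<exists>x. (x, K) \<in> ?p} = {u..v}"
      using D(6) by (auto simp: image_iff)
    show "interior K1 \<inter> interior K2 = {}"
      if "(x1, K1) \<in> ?p" "(x2, K2) \<in> ?p" "(x1, K1) \<noteq> (x2, K2)" for x1 x2 K1 K2
    proof -
      have "K1 \<in> D" "K2 \<in> D" "K1 \<noteq> K2" using that by auto
      then show ?thesis by (rule D(5))
    qed
  qed (use D(2,4) k in auto)
  then have "(\<Sum>(x, K)\<in>?p. \<phi> (Sup K) - \<phi> (Inf K)) = \<phi> v - \<phi> u"
    using additive_tagged_division_1[OF assms(2)] by blast
  moreover have "(\<Sum>(x, K)\<in>?p. \<phi> (Sup K) - \<phi> (Inf K)) = (\<Sum>k\<in>D. \<phi> (Sup k) - \<phi> (Inf k))"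
    by (subst sum.reindex) (auto simp: inj_on_def)
  ultimately show ?thesis by simp
qed

text \<open>Bridges two encodings of non-overlapping intervals: finite sets of endpoint pairs in the
  definition, divisions with disjoint interiors in integration theory.\<close>

lemma abs_continuous_on_division:
  assumes "abs_continuous_on a b f" "0 < \<epsilon>"
  obtains \<delta> where "0 < \<delta>" "\<And>D S. D division_of S \<Longrightarrow> S \<subseteq> {a..b} \<Longrightarrow>
      (\<Sum>k\<in>D. Sup k - Inf k) < \<delta> \<Longrightarrow> (\<Sum>k\<in>D. \<bar>f (Sup k) - f (Inf k)\<bar>) < \<epsilon>"
proof -
  obtain \<delta> where \<delta>: "0 < \<delta>" and AC: "\<And>D. finite D \<Longrightarrow>
        (\<forall>(u, v)\<in>D. a \<le> u \<and> u \<le> v \<and> v \<le> b) \<Longrightarrow>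
        disjoint_family_on (\<lambda>(u, v). {u<..<v}) D \<Longrightarrow>
        (\<Sum>(u, v)\<in>D. v - u) < \<delta> \<Longrightarrow> (\<Sum>(u, v)\<in>D. \<bar>f v - f u\<bar>) < \<epsilon>"
    using assms unfolding abs_continuous_on_def by meson
  show thesis
  proof (rule that[OF \<delta>])
    fix D S assume DS: "D division_of S" "S \<subseteq> {a..b}" "(\<Sum>k\<in>D. Sup k - Inf k) < \<delta>"
    note D = division_ofD[OF DS(1)]
    have k: "\<exists>c d. k = {c..d} \<and> c \<le> d \<and> a \<le> c \<and> d \<le> b" if k: "k \<in> D" for k
    proof -
      obtain c d where cd: "k = cbox c d" using D(4)[OF k] by blast
      with D(3)[OF k] have "c \<le> d" by auto
      moreover have "{c..d} \<subseteq> {a..b}" using order_trans[OF D(2)[OF k] DS(2)] cd by simp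
      ultimately have "a \<le> c" "d \<le> b" by simp_all
      then show ?thesis using cd \<open>c \<le> d\<close> by (intro exI[of _ c] exI[of _ d]) simp
    qed
    let ?D = "(\<lambda>k. (Inf k, Sup k)) ` D"
    have inj: "inj_on (\<lambda>k. (Inf k, Sup k)) D"
    proof (rule inj_onI)
      fix x y assume "x \<in> D" "y \<in> D" "(Inf x, Sup x) = (Inf y, Sup y)"
      then show "x = y" using k[of x] k[of y] by auto
    qed
    have "(\<Sum>(u, v)\<in>?D. \<bar>f v - f u\<bar>) < \<epsilon>"
    proof (rule AC)
      show "finite ?D" using D(1) by simp
      show "\<forall>(u, v)\<in>?D. a \<le> u \<and> u \<le> v \<and> v \<le> b" using k by fastforce
      show "disjoint_family_on (\<lambda>(u, v). {u<..<v}) ?D"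
      proof -
        have "{Inf k<..<Sup k} \<inter> {Inf l<..<Sup l} = {}" if "k \<in> D" "l \<in> D" "k \<noteq> l" for k l
        proof -
          have "interior k = {Inf k<..<Sup k}" "interior l = {Inf l<..<Sup l}"
            using k[OF that(1)] k[OF that(2)] by auto
          then show ?thesis using D(5)[OF that] by simp
        qed
        then show ?thesis unfolding disjoint_family_on_def by auto
      qed
      show "(\<Sum>(u, v)\<in>?D. v - u) < \<delta>"
        using DS(3) by (subst sum.reindex[OF inj]) simp
    qed
    then show "(\<Sum>k\<in>D. \<bar>f (Sup k) - f (Inf k)\<bar>) < \<epsilon>"
      by (subst (asm) sum.reindex[OF inj]) simp
  qed
qed

lemma abs_continuous_on_imp_continuous_on:
  assumes "abs_continuous_on a b f"
  shows "continuous_on {a..b} f"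
  unfolding continuous_on_iff
proof (intro ballI allI impI)
  fix x and e :: real assume x: "x \<in> {a..b}" and e: "0 < e"
  obtain \<delta> where \<delta>: "0 < \<delta>" and AC: "\<And>D S. D division_of S \<Longrightarrow> S \<subseteq> {a..b} \<Longrightarrow>
      (\<Sum>k\<in>D. Sup k - Inf k) < \<delta> \<Longrightarrow> (\<Sum>k\<in>D. \<bar>f (Sup k) - f (Inf k)\<bar>) < e"
    using abs_continuous_on_division[OF assms e] by metis
  have *: "\<bar>f v - f u\<bar> < e" if "u \<in> {a..b}" "v \<in> {a..b}" "u \<le> v" "v - u < \<delta>" for u v
    using AC[of "{{u..v}}" "{u..v}"] that
    by (auto simp: division_of_def)
  show "\<exists>d>0. \<forall>x'\<in>{a..b}. dist x' x < d \<longrightarrow> dist (f x') (f x) < e"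
  proof (intro exI[of _ \<delta>] conjI ballI impI \<delta>)
    fix y assume y: "y \<in> {a..b}" "dist y x < \<delta>"
    show "dist (f y) (f x) < e"
      using *[of x y] *[of y x] x y by (cases "x \<le> y") (auto simp: dist_real_def abs_minus_commute)
  qed
qed

text \<open>The intervals of slope above \<open>r\<close> inside \<open>Q\<close> form a Vitali
  cover of \<open>E\<close>. Vitali's theorem extracts a countable disjoint subfamily covering
  \<open>E\<close> up to a null set, and continuity of measure leaves a finite one. Applied to
  \<open>- f\<close>, it covers by intervals of small slope.\<close>

lemma steep_intervals_cover:
  fixes f :: "real \<Rightarrow> real"
  assumes E: "E \<in> sets lebesgue" and Q: "open Q" "E \<subseteq> Q" and ab: "Q \<subseteq> {a..b}"
    and steep: "\<And>x e. x \<in> E \<Longrightarrow> 0 < e \<Longrightarrow>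
       \<exists>u v. u < x \<and> x < v \<and> v - u < e \<and> r * (v - u) < f v - f u"
    and \<epsilon>: "0 < \<epsilon>"
  obtains D where "finite D" "D division_of \<Union>D" "\<Union>D \<subseteq> Q" "measure lebesgue (E - \<Union>D) < \<epsilon>"
    "\<And>k. k \<in> D \<Longrightarrow> \<exists>u v. u < v \<and> k = {u..v} \<and> r * (v - u) < f v - f u"
    "pairwise disjnt D"
proof -
  \<comment> \<open>Intervals are coded by centre and radius, the form in which the covering theorem
    for balls takes them. A covered point need not be the centre of its interval.\<close>
  define K where "K = {(c, \<rho>). 0 < \<rho> \<and> {c - \<rho>..c + \<rho>} \<subseteq> Q \<and> r * (2 * \<rho>) < f (c + \<rho>) - f (c - \<rho>)}"
  obtain C where C: "countable C" "C \<subseteq> K"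
     "pairwise (\<lambda>i j. disjnt (cball (fst i) (snd i)) (cball (fst j) (snd j))) C"
     "negligible (E - (\<Union>i\<in>C. cball (fst i) (snd i)))"
  proof (rule Vitali_covering_theorem_cballs[of K snd E fst])
    show "0 < snd i" if "i \<in> K" for i using that by (auto simp: K_def)
    fix x d :: real assume x: "x \<in> E" "0 < d"
    then obtain e where e: "0 < e" "ball x e \<subseteq> Q" using Q open_contains_ball by blast
    obtain u v where uv: "u < x" "x < v" "v - u < min d e" "r * (v - u) < f v - f u"
      using steep[OF x(1), of "min d e"] x(2) e(1) by auto
    let ?i = "((u + v) / 2, (v - u) / 2)"
    have eq: "(u + v) / 2 + (v - u) / 2 = v" "(u + v) / 2 - (v - u) / 2 = u"
      "2 * ((v - u) / 2) = v - u"
      by (auto simp: field_simps)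
    have "{u..v} \<subseteq> ball x e" using uv by (auto simp: dist_real_def)
    then have "?i \<in> K" unfolding K_def mem_Collect_eq case_prod_conv eq using uv e by auto
    moreover have "x \<in> cball (fst ?i) (snd ?i)"
      unfolding cball_eq_atLeastAtMost fst_conv snd_conv eq using uv by auto
    moreover have "snd ?i < d" using uv x(2) by auto
    ultimately show "\<exists>i. i \<in> K \<and> x \<in> cball (fst i) (snd i) \<and> snd i < d" by blast
  qed auto
  define I where "I i = cball (fst i) (snd i)" for i :: "real \<times> real"
  have pos: "0 < snd i" if "i \<in> C" for i using that C(2) by (auto simp: K_def)
  have IQ: "I i \<subseteq> Q" if "i \<in> C" for i
    using subsetD[OF C(2) that] by (cases i) (simp add: K_def I_def cball_eq_atLeastAtMost)
  have Im: "I i \<in> lmeasurable" for i unfolding I_def by simp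
  have Qm: "Q \<in> lmeasurable"
    using ab Q(1) by (meson bounded_closed_interval bounded_subset lmeasurable_open)
  have UCm: "\<Union>(I ` C) \<in> sets lebesgue"
    using C(1) Im by (intro sets.countable_Union) (auto simp: fmeasurable_def)
  obtain D where D: "D \<subseteq> I ` C" "finite D" "measure lebesgue (\<Union>(I ` C)) - \<epsilon> < measure lebesgue (\<Union>D)"
  proof (rule measure_countable_Union_approachable[of "I ` C" \<epsilon> "measure lebesgue Q"])
    fix D' assume "D' \<subseteq> I ` C" "finite D'"
    moreover from this have "\<Union>D' \<subseteq> Q" using IQ by blast
    ultimately show "measure lebesgue (\<Union>D') \<le> measure lebesgue Q"
      using Im by (intro measure_mono_fmeasurable Qm sets.finite_Union) (auto simp: fmeasurable_def)
  qed (use C(1) \<epsilon> Im in auto)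
  have UDm: "\<Union>D \<in> sets lebesgue"
    using D(1,2) Im by (intro sets.finite_Union) (auto simp: fmeasurable_def)
  have UC: "\<Union>(I ` C) \<in> lmeasurable"
    using UCm IQ by (intro fmeasurableI2[OF Qm]) auto
  have disj: "pairwise disjnt D"
  proof -
    have "pairwise disjnt (I ` C)"
      unfolding pairwise_def
    proof (intro ballI impI)
      fix x y assume "x \<in> I ` C" "y \<in> I ` C" "x \<noteq> y"
      then obtain i j where "i \<in> C" "j \<in> C" "x = I i" "y = I j" "i \<noteq> j" by auto
      then show "disjnt x y" using pairwiseD[OF C(3)] by (simp add: I_def)
    qed
    then show ?thesis using D(1) pairwise_subset by blast
  qed
  show thesis
  proof (rule that[of D])
    show "finite D" by fact
    show "pairwise disjnt D" by fact
    show "\<Union>D \<subseteq> Q" using D(1) IQ by blast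
    show kk: "\<exists>u v. u < v \<and> k = {u..v} \<and> r * (v - u) < f v - f u" if k: "k \<in> D" for k
    proof -
      obtain i where i: "i \<in> C" "k = I i" using k D(1) by auto
      obtain c \<rho> where [simp]: "i = (c, \<rho>)" by (cases i)
      have "0 < \<rho>" "r * (2 * \<rho>) < f (c + \<rho>) - f (c - \<rho>)" using i C(2) by (auto simp: K_def)
      moreover have "(c + \<rho>) - (c - \<rho>) = 2 * \<rho>" by simp
      ultimately show ?thesis
        using i by (intro exI[of _ "c - \<rho>"] exI[of _ "c + \<rho>"]) (simp add: I_def cball_eq_atLeastAtMost)
    qed
    show "D division_of \<Union>D"
    proof (rule division_ofI)
      show "interior k \<inter> interior l = {}" if "k \<in> D" "l \<in> D" "k \<noteq> l" for k l
      proof -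
        have "k \<inter> l = {}" using pairwiseD[OF disj that] by (simp add: disjnt_def)
        then show ?thesis using interior_subset[of k] interior_subset[of l] by blast
      qed
      fix K assume K: "K \<in> D"
      obtain u v where uv: "u < v" "K = {u..v}" using kk[OF K] by blast
      show "K \<noteq> {}" using uv by simp
      show "\<exists>a b. K = cbox a b" using uv by (metis box_real(2))
      show "K \<subseteq> \<Union>D" using K by blast
    qed (use D(2) in auto)
    have "measure lebesgue (E - \<Union>D) \<le> measure lebesgue ((E - \<Union>(I ` C)) \<union> (\<Union>(I ` C) - \<Union>D))"
    proof (rule measure_mono_fmeasurable)
      show "E - \<Union>(I ` C) \<union> (\<Union>(I ` C) - \<Union>D) \<in> lmeasurable"
        using negligible_imp_measurable[OF C(4)] UC UDm unfolding I_def[symmetric]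
        by (simp add: fmeasurable.Un fmeasurable_Diff)
    qed (use E UDm in auto)
    also have "\<dots> = measure lebesgue (\<Union>(I ` C) - \<Union>D)"
    proof (rule measure_negligible_symdiff)
      show "\<Union>(I ` C) - \<Union>D \<in> lmeasurable" using UC UDm by (intro fmeasurable_Diff)
      show "negligible ((\<Union>(I ` C) - \<Union>D - (E - \<Union>(I ` C) \<union> (\<Union>(I ` C) - \<Union>D)) \<union>
             (E - \<Union>(I ` C) \<union> (\<Union>(I ` C) - \<Union>D) - (\<Union>(I ` C) - \<Union>D))))"
        using C(4) by (rule negligible_subset) (auto simp: I_def)
    qed
    also have "\<dots> = measure lebesgue (\<Union>(I ` C)) - measure lebesgue (\<Union>D)"
      using D(1) UC UDm by (intro measurable_measure_Diff) auto
    also have "\<dots> < \<epsilon>" using D(3) by simp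
    finally show "measure lebesgue (E - \<Union>D) < \<epsilon>" .
  qed
qed

lemma measure_Union_intervals:
  assumes "finite D" "pairwise disjnt D" "\<And>k. k \<in> D \<Longrightarrow> \<exists>u v. u < v \<and> k = {u..v::real}"
  shows "measure lebesgue (\<Union>D) = (\<Sum>k\<in>D. Sup k - Inf k)"
proof -
  have "measure lebesgue (\<Union>D) = sum (measure lebesgue) D"
    using assms by (intro measure_Union') fastforce+
  also have "\<dots> = (\<Sum>k\<in>D. Sup k - Inf k)"
    using assms(3) by (intro sum.cong) fastforce+
  finally show ?thesis .
qed

lemma fmeasurable_outer_open:
  fixes S :: "real set"
  assumes S: "S \<in> lmeasurable" and e: "0 < e"
  obtains T where "open T" "S \<subseteq> T" "T \<in> lmeasurable" "measure lebesgue T < measure lebesgue S + e"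
proof -
  obtain T where T: "open T" "S \<subseteq> T" "T - S \<in> lmeasurable" "emeasure lebesgue (T - S) < ennreal e"
    using sets_lebesgue_outer_open[OF fmeasurableD[OF S] e] by blast
  have eq: "T = S \<union> (T - S)" using T(2) by blast
  have "T \<in> lmeasurable" by (subst eq) (intro fmeasurable.Un S T(3))
  moreover have "measure lebesgue T \<le> measure lebesgue S + measure lebesgue (T - S)"
    using measure_Un_le[OF fmeasurableD[OF S] fmeasurableD[OF T(3)]] eq by simp
  moreover have "measure lebesgue (T - S) < e"
    using T(3,4) by (simp add: emeasure_eq_measure2 ennreal_less_iff)
  ultimately show thesis using that[OF T(1,2)] by simp
qed

text \<open>If \<open>f\<close> has slopes below \<open>p\<close> and above \<open>q\<close> at all points of \<open>E\<close>, nested covers of \<open>E\<close> by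
  intervals of the two kinds differ by gaps of small total length, on which absolute continuity
  bounds the variation of \<open>f\<close>.\<close>
lemma negligible_oscillating_slopes:
  fixes f :: "real \<Rightarrow> real"
  assumes AC: "abs_continuous_on a b f" and E: "E \<in> sets lebesgue" "E \<subseteq> {a<..<b}" and pq: "p < q"
    and hi: "\<And>x e. x \<in> E \<Longrightarrow> 0 < e \<Longrightarrow>
       \<exists>u v. u < x \<and> x < v \<and> v - u < e \<and> q * (v - u) < f v - f u"
    and lo: "\<And>x e. x \<in> E \<Longrightarrow> 0 < e \<Longrightarrow>
       \<exists>u v. u < x \<and> x < v \<and> v - u < e \<and> f v - f u < p * (v - u)"
  shows "negligible E"
proof -
  have Em: "E \<in> lmeasurable"
  proof (rule bounded_set_imp_lmeasurable[OF _ E(1)])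
    show "bounded E" by (rule bounded_subset[OF bounded_closed_interval[of a b]]) (use E(2) in auto)
  qed
  define m where "m = measure lebesgue E"
  have key: "(q - p) * m \<le> (1 + 3 * \<bar>p\<bar> + 2 * (q - p)) * e" if e: "0 < e" for e
  proof -
    obtain \<delta> where \<delta>: "0 < \<delta>" and ACd: "\<And>D S. D division_of S \<Longrightarrow> S \<subseteq> {a..b} \<Longrightarrow>
      (\<Sum>k\<in>D. Sup k - Inf k) < \<delta> \<Longrightarrow> (\<Sum>k\<in>D. \<bar>f (Sup k) - f (Inf k)\<bar>) < e"
      using abs_continuous_on_division[OF AC e] by metis
    \<comment> \<open>The first family will have length below \<open>m + \<epsilon>\<close> and the
      nested one at least \<open>m - 2 * \<epsilon>\<close>, so the gaps measure at most
      \<open>3 * \<epsilon>\<close>; this has to stay below \<open>\<delta>\<close>.\<close>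
    define \<epsilon> where "\<epsilon> = min e (\<delta> / 4)"
    have \<epsilon>: "0 < \<epsilon>" "\<epsilon> \<le> e" "3 * \<epsilon> < \<delta>" using e \<delta> by (auto simp: \<epsilon>_def)
    obtain T where T: "open T" "E \<subseteq> T" "T \<in> lmeasurable" "measure lebesgue T < m + \<epsilon>"
      using fmeasurable_outer_open[OF Em \<epsilon>(1)] unfolding m_def by blast
    define Q where "Q = T \<inter> {a<..<b}"
    have Q: "open Q" "E \<subseteq> Q" "Q \<subseteq> {a..b}" "Q \<in> lmeasurable"
      unfolding Q_def using T E(2) by (auto intro!: fmeasurable.Int)
    have Qlt: "measure lebesgue Q < m + \<epsilon>"
    proof -
      have "measure lebesgue Q \<le> measure lebesgue T"
        using T Q by (intro measure_mono_fmeasurable) (auto simp: Q_def)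
      then show ?thesis using T(4) by simp
    qed
    obtain D1 where D1: "finite D1" "D1 division_of \<Union>D1" "\<Union>D1 \<subseteq> Q" "measure lebesgue (E - \<Union>D1) < \<epsilon>"
      "\<And>k. k \<in> D1 \<Longrightarrow> \<exists>u v. u < v \<and> k = {u..v} \<and> - p * (v - u) < - f v - (- f u)"
      "pairwise disjnt D1"
    proof (rule steep_intervals_cover[OF E(1) Q(1,2,3) _ \<epsilon>(1), of "- p" "\<lambda>x. - f x"])
      fix x e :: real assume "x \<in> E" "0 < e"
      then show "\<exists>u v. u < x \<and> x < v \<and> v - u < e \<and> - p * (v - u) < - f v - - f u"
        using lo by fastforce
    qed auto
    \<comment> \<open>The second cover is taken inside the interiors of the first. Only finitely
      many endpoints are lost, a null set.\<close>
    define Q2 where "Q2 = \<Union>(interior ` D1)"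
    have Q2: "open Q2" "Q2 \<subseteq> \<Union>D1" unfolding Q2_def using interior_subset by auto
    obtain D2 where D2: "finite D2" "D2 division_of \<Union>D2" "\<Union>D2 \<subseteq> Q2"
      "measure lebesgue (E \<inter> Q2 - \<Union>D2) < \<epsilon>"
      "\<And>k. k \<in> D2 \<Longrightarrow> \<exists>u v. u < v \<and> k = {u..v} \<and> q * (v - u) < f v - f u"
      "pairwise disjnt D2"
    proof (rule steep_intervals_cover[of "E \<inter> Q2" Q2 a b q f \<epsilon>])
      show "E \<inter> Q2 \<in> sets lebesgue" using E(1) Q2(1) by auto
      show "Q2 \<subseteq> {a..b}" using Q2 D1(3) Q(3) by blast
    qed (use Q2 hi \<epsilon> in auto)
    have iv1: "\<exists>u v. u < v \<and> k = {u..v}" if "k \<in> D1" for k using D1(5)[OF that] by blast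
    have iv2: "\<exists>u v. u < v \<and> k = {u..v}" if "k \<in> D2" for k using D2(5)[OF that] by blast
    note len1 = measure_Union_intervals[OF D1(1,6) iv1]
    note len2 = measure_Union_intervals[OF D2(1,6) iv2]
    have UD1: "\<Union>D1 \<in> lmeasurable" and UD2: "\<Union>D2 \<in> lmeasurable"
      using D1(1,2) D2(1,2) lmeasurable_division by blast+
    have L1: "(\<Sum>k\<in>D1. Sup k - Inf k) < m + \<epsilon>"
    proof -
      have "measure lebesgue (\<Union>D1) \<le> measure lebesgue Q"
        using UD1 Q D1(3) by (intro measure_mono_fmeasurable) (auto dest: fmeasurableD)
      then show ?thesis using len1 Qlt by simp
    qed
    have L2: "m - 2 * \<epsilon> \<le> (\<Sum>k\<in>D2. Sup k - Inf k)"
    proof -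
      have neg: "negligible (\<Union>D1 - Q2)"
      proof -
        have "\<Union>D1 - Q2 \<subseteq> \<Union>(frontier ` D1)"
          using closure_subset by (fastforce simp: Q2_def frontier_def)
        moreover have "negligible (\<Union>(frontier ` D1))"
        proof (rule negligible_Union)
          fix t assume "t \<in> frontier ` D1"
          then obtain k where "k \<in> D1" "t = frontier k" by auto
          then show "negligible t" using iv1[of k] negligible_convex_frontier[of k] by auto
        qed (use D1(1) in auto)
        ultimately show ?thesis using negligible_subset by blast
      qed
      have sets: "E - \<Union>D1 \<in> lmeasurable" "E \<inter> Q2 - \<Union>D2 \<in> lmeasurable"
        using Em UD1 UD2 Q2(1) by (auto intro!: fmeasurable_Diff fmeasurable_Int_fmeasurable dest: fmeasurableD)
      have negm: "\<Union>D1 - Q2 \<in> lmeasurable" using neg by (rule negligible_imp_measurable)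
      have "m \<le> measure lebesgue ((E - \<Union>D1) \<union> (\<Union>D1 - Q2) \<union> (E \<inter> Q2 - \<Union>D2) \<union> \<Union>D2)"
        unfolding m_def using Em sets negm UD2 Q2
        by (intro measure_mono_fmeasurable fmeasurable.Un) (auto dest: fmeasurableD)
      also have "\<dots> \<le> measure lebesgue ((E - \<Union>D1) \<union> (\<Union>D1 - Q2) \<union> (E \<inter> Q2 - \<Union>D2)) + measure lebesgue (\<Union>D2)"
        using sets negm UD2 by (intro measure_Un_le fmeasurableD fmeasurable.Un) auto
      also have "measure lebesgue ((E - \<Union>D1) \<union> (\<Union>D1 - Q2) \<union> (E \<inter> Q2 - \<Union>D2))
         \<le> measure lebesgue ((E - \<Union>D1) \<union> (\<Union>D1 - Q2)) + measure lebesgue (E \<inter> Q2 - \<Union>D2)"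
        using sets negm UD2 by (intro measure_Un_le fmeasurableD fmeasurable.Un) auto
      also have "measure lebesgue ((E - \<Union>D1) \<union> (\<Union>D1 - Q2)) \<le> measure lebesgue (E - \<Union>D1) + measure lebesgue (\<Union>D1 - Q2)"
        using sets negm UD2 by (intro measure_Un_le fmeasurableD fmeasurable.Un) auto
      also have "measure lebesgue (\<Union>D1 - Q2) = 0" using neg by (rule negligible_imp_measure0)
      finally show ?thesis using D1(4) D2(4) len2 by simp
    qed
    define J where "J I = {k \<in> D2. k \<subseteq> I}" for I
    have in1: "\<exists>I\<in>D1. k \<subseteq> I" if k: "k \<in> D2" for k
    proof -
      obtain u v where uv: "u < v" "k = {u..v}" using iv2[OF k] by blast
      have sub: "k \<subseteq> \<Union>(interior ` D1)" using D2(3) k by (auto simp: Q2_def)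
      moreover have "u \<in> k" using uv by simp
      ultimately obtain I where I: "I \<in> D1" "u \<in> interior I" by blast
      let ?B = "\<Union>(interior ` (D1 - {I}))"
      \<comment> \<open>Connectedness of \<open>k\<close> forces it into a single interval of the
        first family.\<close>
      have "interior I \<inter> k = {} \<or> ?B \<inter> k = {}"
      proof (rule connectedD)
        show "connected k" using uv by simp
        show "interior I \<inter> ?B \<inter> k = {}"
        proof -
          have "interior I \<inter> interior I' = {}" if "I' \<in> D1 - {I}" for I'
            using pairwiseD[OF D1(6) I(1), of I'] that interior_subset[of I] interior_subset[of I']
            by (auto simp: disjnt_def)
          then show ?thesis by blast
        qed
        show "k \<subseteq> interior I \<union> ?B" using sub by auto
      qed auto
      then have "k \<subseteq> interior I" using I uv sub by auto
      then show ?thesis using I(1) interior_subset by blast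
    qed
    \<comment> \<open>Within each \<open>I\<close> the nested intervals are completed to a division
      of \<open>I\<close>; the added pieces are the gaps, collected in \<open>G\<close>.\<close>
    have "\<forall>I\<in>D1. \<exists>q. J I \<subseteq> q \<and> q division_of I"
    proof
      fix I assume I: "I \<in> D1"
      obtain u v where uv: "u < v" "I = {u..v}" using iv1[OF I] by blast
      have "J I division_of \<Union>(J I)"
        using D2(2) by (rule division_of_subset) (auto simp: J_def)
      moreover have "\<Union>(J I) \<subseteq> cbox u v" using uv by (auto simp: J_def)
      ultimately show "\<exists>q. J I \<subseteq> q \<and> q division_of I"
        using partial_division_extend_interval[of "J I" u v] uv by (metis box_real(2))
    qed
    then obtain qq where qq: "\<And>I. I \<in> D1 \<Longrightarrow> J I \<subseteq> qq I" "\<And>I. I \<in> D1 \<Longrightarrow> qq I division_of I"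
      by metis
    define G where "G I = qq I - J I" for I
    have qqfin: "finite (qq I)" if "I \<in> D1" for I using qq(2)[OF that] by auto
    \<comment> \<open>Used twice: with the identity it measures the gaps, with \<open>f\<close> it
      compares the increments over the two families.\<close>
    have split: "(\<Sum>k\<in>D1. \<phi> (Sup k) - \<phi> (Inf k)) =
        (\<Sum>k\<in>D2. \<phi> (Sup k) - \<phi> (Inf k)) + (\<Sum>k\<in>\<Union>(G ` D1). \<phi> (Sup k) - \<phi> (Inf k))" for \<phi> :: "real \<Rightarrow> real"
    proof -
      let ?d = "\<lambda>k. \<phi> (Sup k) - \<phi> (Inf k)"
      have one: "?d I = sum ?d (J I) + sum ?d (G I)" if I: "I \<in> D1" for I
      proof -
        obtain u v where uv: "u < v" "I = {u..v}" using iv1[OF I] by blast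
        have "sum ?d (qq I) = ?d I"
          using division_sum_telescope[of "qq I" u v \<phi>] qq(2)[OF I] uv by simp
        moreover have "sum ?d (qq I) = sum ?d (qq I - J I) + sum ?d (J I)"
          using sum.subset_diff[OF qq(1)[OF I] qqfin[OF I]] by blast
        ultimately show ?thesis by (simp add: G_def)
      qed
      have dj: "I \<inter> I' = {}" if "I \<in> D1" "I' \<in> D1" "I \<noteq> I'" for I I'
        using D1(6) that by (auto simp: pairwise_def disjnt_def)
      have "sum ?d (\<Union>(J ` D1)) = (\<Sum>I\<in>D1. sum ?d (J I))"
      proof (rule sum.UNION_disjoint)
        show "\<forall>i\<in>D1. \<forall>j\<in>D1. i \<noteq> j \<longrightarrow> J i \<inter> J j = {}"
        proof (intro ballI impI)
          fix i j assume ij: "i \<in> D1" "j \<in> D1" "i \<noteq> j"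
          have "k \<noteq> {}" if "k \<in> D2" for k using iv2[OF that] by auto
          then show "J i \<inter> J j = {}" using dj[OF ij] unfolding J_def by blast
        qed
      qed (use D1(1) D2(1) in \<open>auto simp: J_def\<close>)
      moreover have "\<Union>(J ` D1) = D2" using in1 by (auto simp: J_def)
      moreover have "sum ?d (\<Union>(G ` D1)) = (\<Sum>I\<in>D1. sum ?d (G I))"
      proof (rule sum.UNION_disjoint)
        show "\<forall>i\<in>D1. \<forall>j\<in>D1. i \<noteq> j \<longrightarrow> G i \<inter> G j = {}"
        proof (intro ballI impI)
          fix i j assume ij: "i \<in> D1" "j \<in> D1" "i \<noteq> j"
          have "k \<noteq> {} \<and> k \<subseteq> I" if "k \<in> G I" "I \<in> D1" for k I
            using division_ofD(2,3)[OF qq(2)[OF that(2)]] that(1) by (auto simp: G_def)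
          then show "G i \<inter> G j = {}" using dj[OF ij] ij by blast
        qed
      qed (use D1(1) qqfin in \<open>auto simp: G_def\<close>)
      ultimately show ?thesis using one by (simp add: sum.distrib)
    qed
    have Gdiv: "\<Union>(G ` D1) division_of \<Union>(\<Union>(G ` D1))"
    proof (rule division_ofI)
      have GD: "k \<in> qq I" if "k \<in> G I" for k I using that by (auto simp: G_def)
      show "finite (\<Union>(G ` D1))" using D1(1) qqfin by (auto simp: G_def)
      show "K \<noteq> {}" "\<exists>a b. K = cbox a b" if "K \<in> \<Union>(G ` D1)" for K
        using that GD division_ofD(3,4)[OF qq(2)] by blast+
      fix K1 K2 assume K: "K1 \<in> \<Union>(G ` D1)" "K2 \<in> \<Union>(G ` D1)" "K1 \<noteq> K2"
      then obtain I1 I2 where I: "I1 \<in> D1" "K1 \<in> qq I1" "I2 \<in> D1" "K2 \<in> qq I2" using GD by blast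
      show "interior K1 \<inter> interior K2 = {}"
      proof (cases "I1 = I2")
        case True
        then show ?thesis using division_ofD(5)[OF qq(2)] I K(3) by blast
      next
        case False
        then have "I1 \<inter> I2 = {}" using D1(6) I by (auto simp: pairwise_def disjnt_def)
        moreover have "K1 \<subseteq> I1" "K2 \<subseteq> I2" using division_ofD(2)[OF qq(2)] I by auto
        ultimately show ?thesis using interior_subset[of K1] interior_subset[of K2] by blast
      qed
    qed auto
    have Gsub: "\<Union>(\<Union>(G ` D1)) \<subseteq> {a..b}"
    proof -
      have "k \<subseteq> {a..b}" if "k \<in> G I" "I \<in> D1" for k I
        using division_ofD(2)[OF qq(2)[OF that(2)], of k] that D1(3) Q(3) by (auto simp: G_def)
      then show ?thesis by blast
    qed
    define l1 l2 where "l1 = (\<Sum>k\<in>D1. Sup k - Inf k)" and "l2 = (\<Sum>k\<in>D2. Sup k - Inf k)"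
    have gl: "l1 - l2 \<le> 3 * \<epsilon>" using L1 L2 by (simp add: l1_def l2_def)
    have gl0: "0 \<le> l1 - l2"
    proof -
      have "0 \<le> Sup k - Inf k" if kG: "k \<in> \<Union>(G ` D1)" for k
      proof -
        obtain c d where "k = cbox c d" using division_ofD(4)[OF Gdiv kG] by blast
        then show ?thesis using division_ofD(3)[OF Gdiv kG] by auto
      qed
      then have "0 \<le> (\<Sum>k\<in>\<Union>(G ` D1). Sup k - Inf k)" by (rule sum_nonneg)
      then show ?thesis using split[of "\<lambda>x. x"] by (simp add: l1_def l2_def)
    qed
    have "(\<Sum>k\<in>\<Union>(G ` D1). \<bar>f (Sup k) - f (Inf k)\<bar>) < e"
      using split[of "\<lambda>x. x"] gl \<epsilon>(3) by (intro ACd[OF Gdiv Gsub]) (simp add: l1_def l2_def)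
    then have "\<bar>\<Sum>k\<in>\<Union>(G ` D1). f (Sup k) - f (Inf k)\<bar> < e"
      by (rule order_le_less_trans[OF sum_abs])
    moreover have "(\<Sum>k\<in>D1. f (Sup k) - f (Inf k)) \<le> p * l1"
      unfolding l1_def sum_distrib_left
    proof (rule sum_mono)
      fix k assume "k \<in> D1"
      then show "f (Sup k) - f (Inf k) \<le> p * (Sup k - Inf k)" using D1(5)[of k] by auto
    qed
    moreover have "q * l2 \<le> (\<Sum>k\<in>D2. f (Sup k) - f (Inf k))"
      unfolding l2_def sum_distrib_left
    proof (rule sum_mono)
      fix k assume "k \<in> D2"
      then show "q * (Sup k - Inf k) \<le> f (Sup k) - f (Inf k)" using D2(5)[of k] by auto
    qed
    ultimately have "q * l2 \<le> p * l1 + e" using split[of f] by linarith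
    moreover have "p * (l1 - l2) \<le> \<bar>p\<bar> * (3 * e)"
    proof -
      have "p * (l1 - l2) \<le> \<bar>p\<bar> * (l1 - l2)" using gl0 by (intro mult_right_mono) auto
      also have "\<dots> \<le> \<bar>p\<bar> * (3 * e)" using gl \<epsilon>(2) by (intro mult_left_mono) auto
      finally show ?thesis .
    qed
    ultimately have "(q - p) * l2 \<le> (1 + 3 * \<bar>p\<bar>) * e" by (simp add: algebra_simps)
    moreover have "(q - p) * (m - 2 * e) \<le> (q - p) * l2"
      using L2 \<epsilon>(2) pq by (intro mult_left_mono) (auto simp: l2_def)
    ultimately show ?thesis by (simp add: algebra_simps)
  qed
  have "m \<le> 0"
  proof (rule ccontr)
    assume "\<not> m \<le> 0"
    then have pos: "0 < (q - p) * m" using pq by simp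
    define c where "c = 1 + 3 * \<bar>p\<bar> + 2 * (q - p)"
    have c: "0 < c" using pq by (simp add: c_def)
    have "0 < (q - p) * m / (2 * c)" using pos c by (intro divide_pos_pos) auto
    from key[OF this] have "(q - p) * m \<le> c * ((q - p) * m / (2 * c))" unfolding c_def .
    also have "\<dots> = (q - p) * m / 2" using c by simp
    finally show False using pos by linarith
  qed
  then have "measure lebesgue E = 0" unfolding m_def by (simp add: measure_le_0_iff)
  then show ?thesis using Em by (simp add: negligible_iff_measure0)
qed

text \<open>Disjoint intervals of slope above \<open>N\<close> with total length below
  \<open>\<delta>\<close> have total increment below 1, hence total length below
  \<open>1 / N\<close>. So the set has measure zero inside every window shorter than
  \<open>\<delta>\<close>.\<close>

lemma negligible_infinite_slope:
  fixes f :: "real \<Rightarrow> real"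
  assumes AC: "abs_continuous_on a b f" and E: "E \<in> sets lebesgue" "E \<subseteq> {a<..<b}"
    and hi: "\<And>N x e. x \<in> E \<Longrightarrow> 0 < e \<Longrightarrow>
       \<exists>u v. u < x \<and> x < v \<and> v - u < e \<and> real N * (v - u) < f v - f u"
  shows "negligible E"
proof -
  obtain \<delta> where \<delta>: "0 < \<delta>" and ACd: "\<And>D S. D division_of S \<Longrightarrow> S \<subseteq> {a..b} \<Longrightarrow>
    (\<Sum>k\<in>D. Sup k - Inf k) < \<delta> \<Longrightarrow> (\<Sum>k\<in>D. \<bar>f (Sup k) - f (Inf k)\<bar>) < 1"
    using abs_continuous_on_division[OF AC zero_less_one] by metis
  have local: "negligible (E \<inter> {c<..<c + \<delta> / 2})" for c
  proof -
    define E' where "E' = E \<inter> {c<..<c + \<delta> / 2}"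
    define Q where "Q = {a<..<b} \<inter> {c<..<c + \<delta> / 2}"
    have E': "E' \<in> sets lebesgue" "E' \<subseteq> Q" using E by (auto simp: E'_def Q_def)
    have Q: "open Q" "Q \<subseteq> {a..b}" by (auto simp: Q_def)
    have Qm: "Q \<in> lmeasurable" unfolding Q_def by (auto intro!: fmeasurable.Int)
    have E'm: "E' \<in> lmeasurable" by (rule fmeasurableI2[OF Qm E'(2,1)])
    have "measure lebesgue E' \<le> 2 / real N" if N: "0 < N" for N
    proof -
      obtain D where D: "finite D" "D division_of \<Union>D" "\<Union>D \<subseteq> Q" "measure lebesgue (E' - \<Union>D) < 1 / real N"
        "\<And>k. k \<in> D \<Longrightarrow> \<exists>u v. u < v \<and> k = {u..v} \<and> real N * (v - u) < f v - f u" "pairwise disjnt D"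
      proof (rule steep_intervals_cover[OF E'(1) Q(1) E'(2) Q(2), of "real N" f "1 / real N"])
        fix x e :: real assume "x \<in> E'" "0 < e"
        then have "x \<in> E" by (simp add: E'_def)
        then show "\<exists>u v. u < x \<and> x < v \<and> v - u < e \<and> real N * (v - u) < f v - f u"
          using \<open>0 < e\<close> by (rule hi)
      qed (use N in simp_all)
      have UD: "\<Union>D \<in> lmeasurable" using D(2) lmeasurable_division by blast
      have "\<exists>u v. u < v \<and> k = {u..v}" if "k \<in> D" for k using D(5)[OF that] by blast
      note len = measure_Union_intervals[OF D(1,6) this]
      have "measure lebesgue (\<Union>D) \<le> measure lebesgue {c..c + \<delta> / 2}"
        using UD D(3) by (intro measure_mono_fmeasurable) (auto simp: Q_def dest: fmeasurableD)
      then have "(\<Sum>k\<in>D. Sup k - Inf k) < \<delta>" using len \<delta> by simp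
      then have "(\<Sum>k\<in>D. \<bar>f (Sup k) - f (Inf k)\<bar>) < 1"
        using ACd[OF D(2)] D(3) Q(2) by blast
      moreover have "real N * (\<Sum>k\<in>D. Sup k - Inf k) \<le> (\<Sum>k\<in>D. \<bar>f (Sup k) - f (Inf k)\<bar>)"
        unfolding sum_distrib_left
      proof (rule sum_mono)
        fix k assume "k \<in> D"
        then show "real N * (Sup k - Inf k) \<le> \<bar>f (Sup k) - f (Inf k)\<bar>" using D(5)[of k] by auto
      qed
      ultimately have "measure lebesgue (\<Union>D) < 1 / real N" using len N by (simp add: field_simps)
      moreover have "measure lebesgue E' \<le> measure lebesgue ((E' - \<Union>D) \<union> \<Union>D)"
        using E'm UD by (intro measure_mono_fmeasurable) (auto intro!: fmeasurable.Un fmeasurable_Diff dest: fmeasurableD)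
      moreover have "\<dots> \<le> measure lebesgue (E' - \<Union>D) + measure lebesgue (\<Union>D)"
        using E'm UD by (intro measure_Un_le) (auto dest: fmeasurableD)
      ultimately have "measure lebesgue E' \<le> 1 / real N + 1 / real N" using D(4) by linarith
      then show ?thesis by simp
    qed
    note bd = this
    have "measure lebesgue E' \<le> 0"
    proof (rule ccontr)
      assume "\<not> measure lebesgue E' \<le> 0"
      then obtain N where "N > 0" "2 / real N < measure lebesgue E'"
        using real_arch_inverse[of "measure lebesgue E' / 2"] by (auto simp: field_simps)
      then show False using bd[of N] by simp
    qed
    then have "measure lebesgue E' = 0" by (simp add: measure_le_0_iff)
    then show ?thesis using E'm unfolding E'_def[symmetric] by (simp add: negligible_iff_measure0)
  qed
  \<comment> \<open>Open windows of length \<open>\<delta> / 2\<close> spaced by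
    \<open>\<delta> / 4\<close> overlap, so they cover the line.\<close>
  have "E \<subseteq> (\<Union>j::int. E \<inter> {of_int j * (\<delta> / 4)<..<of_int j * (\<delta> / 4) + \<delta> / 2})"
  proof
    fix x assume "x \<in> E"
    define X where "X = x / (\<delta> / 4)"
    define j where "j = \<lfloor>X\<rfloor> - 1"
    have x: "x = X * (\<delta> / 4)" using \<delta> by (simp add: X_def)
    have "of_int j + 1 \<le> X" "X < of_int j + 2" unfolding j_def by linarith+
    then have "(of_int j + 1) * (\<delta> / 4) \<le> x" "x < (of_int j + 2) * (\<delta> / 4)"
      unfolding x using \<delta> by (auto intro!: mult_right_mono mult_strict_right_mono)
    then have "x \<in> {of_int j * (\<delta> / 4)<..<of_int j * (\<delta> / 4) + \<delta> / 2}"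
      using \<delta> by (auto simp: algebra_simps)
    then show "x \<in> (\<Union>j::int. E \<inter> {of_int j * (\<delta> / 4)<..<of_int j * (\<delta> / 4) + \<delta> / 2})"
      using \<open>x \<in> E\<close> by blast
  qed
  moreover have "negligible (\<Union>j::int. E \<inter> {of_int j * (\<delta> / 4)<..<of_int j * (\<delta> / 4) + \<delta> / 2})"
    by (rule negligible_countable_Union) (auto intro: local)
  ultimately show ?thesis using negligible_subset by blast
qed

text \<open>A difference quotient has \<open>x\<close> as an endpoint of its interval, whereas the
  covering argument needs \<open>x\<close> inside. Continuity at \<open>x\<close> allows moving that
  endpoint slightly beyond \<open>x\<close> without losing the strict slope inequality.\<close>

lemma frequently_slope_interior:
  fixes f :: "real \<Rightarrow> real"
  assumes cont: "isCont f x" and fr: "\<exists>\<^sub>F h in at 0. r < (f (x + h) - f x) / h" and e: "0 < e"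
  shows "\<exists>u v. u < x \<and> x < v \<and> v - u < e \<and> r * (v - u) < f v - f u"
proof -
  have "\<forall>\<^sub>F h in at (0::real). \<bar>h\<bar> < e / 2 \<and> h \<noteq> 0"
    using e by (auto simp: eventually_at dist_real_def intro!: exI[of _ "e / 2"])
  from frequently_eventually_conj[OF fr this]
  obtain h where h: "r < (f (x + h) - f x) / h" "\<bar>h\<bar> < e / 2" "h \<noteq> 0"
    using frequently_ex by fastforce
  show ?thesis
  proof (cases "0 < h")
    case True
    have "((\<lambda>u. f (x + h) - f u - r * (x + h - u)) \<longlongrightarrow> f (x + h) - f x - r * (x + h - x)) (at_left x)"
      using cont by (intro tendsto_intros) (auto simp: isCont_def intro: tendsto_mono[OF at_le])
    moreover have "0 < f (x + h) - f x - r * (x + h - x)" using h(1) True by (simp add: field_simps)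
    ultimately have "\<forall>\<^sub>F u in at_left x. 0 < f (x + h) - f u - r * (x + h - u)"
      using order_tendstoD(1) by blast
    moreover have "\<forall>\<^sub>F u in at_left x. u \<in> {x - e / 2<..<x}"
      using e by (intro eventually_at_left_real) auto
    ultimately obtain u where "0 < f (x + h) - f u - r * (x + h - u)" "u \<in> {x - e / 2<..<x}"
      using eventually_happens[OF eventually_conj] trivial_limit_at_left_real by blast
    then show ?thesis using True h by (intro exI[of _ u] exI[of _ "x + h"]) auto
  next
    case False
    then have "h < 0" using h by auto
    have "((\<lambda>v. f v - f (x + h) - r * (v - (x + h))) \<longlongrightarrow> f x - f (x + h) - r * (x - (x + h))) (at_right x)"
      using cont by (intro tendsto_intros) (auto simp: isCont_def intro: tendsto_mono[OF at_le])
    moreover have "0 < f x - f (x + h) - r * (x - (x + h))" using h(1) \<open>h < 0\<close> by (simp add: field_simps)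
    ultimately have "\<forall>\<^sub>F v in at_right x. 0 < f v - f (x + h) - r * (v - (x + h))"
      using order_tendstoD(1) by blast
    moreover have "\<forall>\<^sub>F v in at_right x. v \<in> {x<..<x + e / 2}"
      using e by (intro eventually_at_right_real) auto
    ultimately obtain v where "0 < f v - f (x + h) - r * (v - (x + h))" "v \<in> {x<..<x + e / 2}"
      using eventually_happens[OF eventually_conj] trivial_limit_at_right_real by blast
    then show ?thesis using \<open>h < 0\<close> h by (intro exI[of _ "x + h"] exI[of _ v]) auto
  qed
qed

lemma abs_continuous_on_minus:
  "abs_continuous_on a b f \<Longrightarrow> abs_continuous_on a b (\<lambda>x. - f x)"
  unfolding abs_continuous_on_def by (simp add: abs_minus_commute)

text \<open>At an interior point without derivative, either the lower and upper limits of the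
  difference quotients are separated by two rationals, or the quotients tend to plus or minus
  infinity. The first case gives countably many sets of oscillating slopes, the others are sets of
  infinite slope of \<open>f\<close> and \<open>- f\<close>.\<close>

theorem abs_continuous_on_differentiable_ae:
  assumes AC: "abs_continuous_on a b f"
  shows "negligible {x \<in> {a..b}. \<not> f field_differentiable at x}"
proof -
  define H :: "(real \<Rightarrow> real) \<Rightarrow> real \<Rightarrow> real set" where
    "H g r = {x \<in> {a<..<b}. \<forall>e>0. \<exists>u v. u < x \<and> x < v \<and> v - u < e \<and> r * (v - u) < g v - g u}" for g r
  \<comment> \<open>Measurability holds because \<open>H g r\<close> is a countable intersection of
    open sets, whatever \<open>g\<close> is.\<close>
  have Hm: "H g r \<in> sets lebesgue" for g r
  proof -
    define G where "G n = \<Union>{{u<..<v} | u v. v - u < 1 / real (Suc n) \<and> r * (v - u) < g v - g u}" for n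
    have "open (G n)" for n unfolding G_def by (rule open_Union) auto
    then have "{a<..<b} \<inter> (\<Inter>n. G n) \<in> sets borel" by auto
    moreover have "H g r = {a<..<b} \<inter> (\<Inter>n. G n)"
    proof (intro set_eqI iffI)
      fix x assume x: "x \<in> H g r"
      have "x \<in> G n" for n
      proof -
        have "0 < 1 / real (Suc n)" by simp
        then obtain u v where "u < x" "x < v" "v - u < 1 / real (Suc n)" "r * (v - u) < g v - g u"
          using x unfolding H_def by blast
        then show ?thesis unfolding G_def by (intro UnionI[of "{u<..<v}"]) auto
      qed
      then show "x \<in> {a<..<b} \<inter> (\<Inter>n. G n)" using x by (auto simp: H_def)
    next
      fix x assume x: "x \<in> {a<..<b} \<inter> (\<Inter>n. G n)"
      have "\<exists>u v. u < x \<and> x < v \<and> v - u < e \<and> r * (v - u) < g v - g u" if e: "0 < e" for e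
      proof -
        obtain n where n: "1 / real (Suc n) < e" using nat_approx_posE[OF e] by blast
        have "x \<in> G n" using x by blast
        then obtain u v where "v - u < 1 / real (Suc n)" "r * (v - u) < g v - g u" "x \<in> {u<..<v}"
          unfolding G_def by blast
        then show ?thesis using n by (intro exI[of _ u] exI[of _ v]) auto
      qed
      then show "x \<in> H g r" using x by (auto simp: H_def)
    qed
    ultimately show ?thesis by (auto intro: sets_completionI_sets)
  qed
  let ?m = "\<lambda>x. - f x"
  let ?A = "\<Union>(p, q)\<in>{(p, q). p \<in> \<rat> \<and> q \<in> \<rat> \<and> p < q}. H f q \<inter> H ?m (- p)"
  let ?I = "\<Inter>n. H f (real n)" and ?J = "\<Inter>n. H ?m (real n)"
  have "negligible ?A"
  proof (rule negligible_countable_Union)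
    have "countable ((\<rat> \<times> \<rat>) :: (real \<times> real) set)" by (simp add: countable_rat)
    then have "countable {(p, q). p \<in> (\<rat> :: real set) \<and> q \<in> \<rat> \<and> p < q}"
      by (rule countable_subset[rotated]) auto
    then show "countable ((\<lambda>(p, q). H f q \<inter> H ?m (- p)) ` {(p, q). p \<in> \<rat> \<and> q \<in> \<rat> \<and> p < q})"
      by (rule countable_image)
    fix S assume "S \<in> (\<lambda>(p, q). H f q \<inter> H ?m (- p)) ` {(p, q). p \<in> \<rat> \<and> q \<in> \<rat> \<and> p < q}"
    then obtain p q where pq: "p < q" and S: "S = H f q \<inter> H ?m (- p)" by auto
    show "negligible S"
    proof (rule negligible_oscillating_slopes[OF AC _ _ pq])
      show "S \<in> sets lebesgue" unfolding S using Hm by blast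
      show "S \<subseteq> {a<..<b}" by (auto simp: S H_def)
      fix x e :: real assume x: "x \<in> S" "0 < e"
      then show "\<exists>u v. u < x \<and> x < v \<and> v - u < e \<and> q * (v - u) < f v - f u"
        by (auto simp: S H_def)
      have "\<exists>u v. u < x \<and> x < v \<and> v - u < e \<and> - p * (v - u) < ?m v - ?m u"
        using x by (auto simp: S H_def)
      then show "\<exists>u v. u < x \<and> x < v \<and> v - u < e \<and> f v - f u < p * (v - u)" by fastforce
    qed
  qed
  moreover have "negligible ?I"
  proof (rule negligible_infinite_slope[OF AC])
    show "?I \<in> sets lebesgue" using Hm by (intro sets.countable_INT) auto
  qed (auto simp: H_def)
  moreover have "negligible ?J"
  proof (rule negligible_infinite_slope[OF abs_continuous_on_minus[OF AC]])
    show "?J \<in> sets lebesgue" using Hm by (intro sets.countable_INT) auto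
  qed (auto simp: H_def)
  moreover have "{x \<in> {a..b}. \<not> f field_differentiable at x} \<subseteq> ?A \<union> ?I \<union> ?J \<union> {a, b}"
  proof (rule subsetI, rule ccontr)
    fix x assume xab: "x \<in> {x \<in> {a..b}. \<not> f field_differentiable at x}" and nx: "x \<notin> ?A \<union> ?I \<union> ?J \<union> {a, b}"
    from nx have nA: "x \<notin> ?A" and nI: "x \<notin> ?I" and nJ: "x \<notin> ?J" by blast+
    from xab nx have x: "x \<in> {a<..<b}" and nd: "\<not> f field_differentiable at x"
      by (simp_all add: less_le)
    have cont: "isCont f x"
      using abs_continuous_on_imp_continuous_on[OF AC] x
      by (metis continuous_on_interior interior_atLeastAtMost_real)
    have HI: "x \<in> H g r" if "isCont g x" "\<exists>\<^sub>F h in at 0. r < (g (x + h) - g x) / h" for g r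
      using frequently_slope_interior[OF that] x by (auto simp: H_def)
    let ?s = "\<lambda>h. ereal ((f (x + h) - f x) / h)"
    let ?l = "Liminf (at 0) ?s" and ?L = "Limsup (at 0) ?s"
    have nt: "at (0::real) \<noteq> bot" by simp
    have up: "x \<in> H f r" if "ereal r < ?L" for r
    proof (rule HI[OF cont])
      show "\<exists>\<^sub>F h in at 0. r < (f (x + h) - f x) / h"
      proof (rule ccontr)
        assume "\<not> (\<exists>\<^sub>F h in at 0. r < (f (x + h) - f x) / h)"
        then have "\<forall>\<^sub>F h in at 0. ?s h \<le> ereal r" by (simp add: not_frequently not_less)
        then have "?L \<le> ereal r" by (rule Limsup_bounded)
        then show False using that by simp
      qed
    qed
    have dn: "x \<in> H ?m (- r)" if "?l < ereal r" for r
    proof (rule HI)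
      show "isCont ?m x" using cont by simp
      show "\<exists>\<^sub>F h in at 0. - r < (?m (x + h) - ?m x) / h"
      proof (rule ccontr)
        assume "\<not> (\<exists>\<^sub>F h in at 0. - r < (?m (x + h) - ?m x) / h)"
        then have "\<forall>\<^sub>F h in at 0. (?m (x + h) - ?m x) / h \<le> - r" by (simp add: not_frequently not_less)
        then have "\<forall>\<^sub>F h in at 0. ereal r \<le> ?s h"
          by (rule eventually_mono) (simp add: diff_divide_distrib minus_divide_left)
        then have "ereal r \<le> ?l" by (rule Liminf_bounded)
        then show False using that by simp
      qed
    qed
    show False
    proof (cases "?l = ?L")
      case True
      have lim: "(?s \<longlongrightarrow> ?L) (at 0)" using True by (intro Liminf_eq_Limsup) auto
      show False
      proof (cases ?L)
        case (real D)
        then have "((\<lambda>h. (f (x + h) - f x) / h) \<longlongrightarrow> D) (at 0)" using lim by simp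
        then have "(f has_field_derivative D) (at x)" by (simp add: DERIV_def)
        then show False using nd field_differentiable_def by blast
      next
        case PInf
        then have "x \<in> H f (real n)" for n by (intro up) auto
        then show False using nI by blast
      next
        case MInf
        then have "?l = - \<infinity>" using True by simp
        then have "x \<in> H ?m (- (- real n))" for n by (intro dn) auto
        then show False using nJ by auto
      qed
    next
      case False
      then have lt: "?l < ?L" using Liminf_le_Limsup[OF nt, of ?s] by simp
      obtain z where z: "?l < ereal z" "ereal z < ?L" using ereal_dense2[OF lt] by blast
      obtain w where w: "ereal z < ereal w" "ereal w < ?L" using ereal_dense2[OF z(2)] by blast
      obtain p where p: "p \<in> \<rat>" "z < p" "p < w" using Rats_dense_in_real[of z w] w by auto
      obtain q where q: "q \<in> \<rat>" "p < q" "q < w" using Rats_dense_in_real[of p w] p by auto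
      have "x \<in> H f q" using q(3) w(2) by (intro up) (meson ereal_less(2) less_ereal.simps(1) less_trans)
      moreover have "x \<in> H ?m (- p)" using p(2) z(1) by (intro dn) (meson less_ereal.simps(1) less_trans)
      ultimately show False using nA p q by blast
    qed
  qed
  moreover have "negligible {a, b}" by simp
  ultimately show ?thesis by (meson negligible_Un negligible_subset)
qed

lemma abs_continuous_on_subinterval:
  "abs_continuous_on a b f \<Longrightarrow> a \<le> u \<Longrightarrow> v \<le> b \<Longrightarrow> abs_continuous_on u v f"
  unfolding abs_continuous_on_def
  by (elim all_forward imp_forward ex_forward conj_forward) (auto intro: order_trans)

text \<open>Gauge argument. Off the null set \<open>N\<close> the gauge is a ball on which
  \<open>f\<close> is nearly affine, so each increment is close to derivative times length. On
  \<open>N\<close> it is an open set \<open>V\<close> of measure below \<open>\<delta>\<close>,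
  where absolute continuity makes the increments small in total.\<close>

theorem abs_continuous_on_has_integral_deriv:
  assumes AC: "abs_continuous_on a b f" and ab: "a \<le> b"
  shows "(deriv f has_integral f b - f a) {a..b}"
proof -
  define N where "N = {x \<in> {a..b}. \<not> f field_differentiable at x}"
  have N: "negligible N" unfolding N_def by (rule abs_continuous_on_differentiable_ae[OF AC])
  \<comment> \<open>With value 0 on \<open>N\<close>, tags in \<open>N\<close> contribute nothing to
    the Riemann sum, and only the increments of \<open>f\<close> remain to be bounded there.\<close>
  define g where "g x = (if x \<in> N then 0 else deriv f x)" for x
  have "(g has_integral f b - f a) {a..b}"
    unfolding has_integral_real
  proof (intro allI impI)
    fix e :: real assume e: "0 < e"
    define c where "c = e / (2 * (b - a + 1))"
    have c: "0 < c" using e ab by (auto simp: c_def)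
    obtain \<delta> where \<delta>: "0 < \<delta>" and ACd: "\<And>D S. D division_of S \<Longrightarrow> S \<subseteq> {a..b} \<Longrightarrow>
      (\<Sum>k\<in>D. Sup k - Inf k) < \<delta> \<Longrightarrow> (\<Sum>k\<in>D. \<bar>f (Sup k) - f (Inf k)\<bar>) < e / 2"
      using abs_continuous_on_division[OF AC half_gt_zero[OF e]] by metis
    obtain V where V: "open V" "N \<subseteq> V" "V \<in> lmeasurable" "measure lebesgue V < \<delta>"
      using fmeasurable_outer_open[OF negligible_imp_measurable[OF N] \<delta>]
      unfolding negligible_imp_measure0[OF N] by auto
    have "\<exists>d>0. \<forall>y. \<bar>y - x\<bar> < d \<longrightarrow> \<bar>f y - f x - deriv f x * (y - x)\<bar> \<le> c * \<bar>y - x\<bar>"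
      if "x \<in> {a..b} - N" for x
    proof -
      have "(f has_derivative (\<lambda>h. deriv f x * h)) (at x)"
        using that DERIV_deriv_iff_field_differentiable has_field_derivative_def by (fastforce simp: N_def)
      then have "\<exists>d>0. \<forall>y. norm (y - x) < d \<longrightarrow> norm (f y - f x - deriv f x * (y - x)) \<le> c * norm (y - x)"
        using c unfolding has_derivative_at_alt by blast
      then show ?thesis by simp
    qed
    then obtain d where d: "\<And>x. x \<in> {a..b} - N \<Longrightarrow> 0 < d x"
      "\<And>x y. x \<in> {a..b} - N \<Longrightarrow> \<bar>y - x\<bar> < d x \<Longrightarrow> \<bar>f y - f x - deriv f x * (y - x)\<bar> \<le> c * \<bar>y - x\<bar>"
      by metis
    define \<gamma> where "\<gamma> x = (if x \<in> N then V else if x \<in> {a..b} then ball x (d x) else UNIV)" for x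
    show "\<exists>\<gamma>. gauge \<gamma> \<and> (\<forall>\<D>. \<D> tagged_division_of {a..b} \<and> \<gamma> fine \<D> \<longrightarrow>
            norm ((\<Sum>(x, k)\<in>\<D>. measure lborel k *\<^sub>R g x) - (f b - f a)) < e)"
    proof (intro exI[of _ \<gamma>] conjI allI impI)
      show "gauge \<gamma>" unfolding gauge_def \<gamma>_def using V d(1) by auto
      fix p assume "p tagged_division_of {a..b} \<and> \<gamma> fine p"
      then have p: "p tagged_division_of {a..b}" and fine: "\<gamma> fine p" by auto
      note pD = tagged_division_ofD[OF p]
      have iv: "\<exists>u v. k = {u..v} \<and> u \<le> x \<and> x \<le> v \<and> a \<le> u \<and> v \<le> b" if xk: "(x, k) \<in> p" for x k
      proof -
        obtain u v where "k = cbox u v" using pD(4)[OF xk] by blast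
        then show ?thesis using pD(2,3)[OF xk] by (intro exI[of _ u] exI[of _ v]) auto
      qed
      define r where "r = {xk \<in> p. fst xk \<in> N}"
      have rp: "r \<subseteq> p" "finite r" using pD(1) by (auto simp: r_def)
      have tele: "(\<Sum>(x, k)\<in>p. f (Sup k) - f (Inf k)) = f b - f a"
        using additive_tagged_division_1[OF ab p] .
      have "(\<Sum>(x, k)\<in>p. measure lborel k *\<^sub>R g x) - (f b - f a)
          = (\<Sum>(x, k)\<in>p. measure lborel k * g x - (f (Sup k) - f (Inf k)))"
        unfolding tele[symmetric] by (simp add: sum_subtractf[symmetric] case_prod_beta)
      also have "\<dots> = (\<Sum>(x, k)\<in>p - r. measure lborel k * g x - (f (Sup k) - f (Inf k)))
          + (\<Sum>(x, k)\<in>r. measure lborel k * g x - (f (Sup k) - f (Inf k)))"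
        using sum.subset_diff[OF rp(1) pD(1)] by blast
      finally have eq: "(\<Sum>(x, k)\<in>p. measure lborel k *\<^sub>R g x) - (f b - f a) = \<dots>" .
      have "\<bar>\<Sum>(x, k)\<in>p - r. measure lborel k * g x - (f (Sup k) - f (Inf k))\<bar> \<le> (\<Sum>(x, k)\<in>p - r. c * (Sup k - Inf k))"
      proof (rule order_trans[OF sum_abs], rule sum_mono, clarify)
        fix x k assume xk: "(x, k) \<in> p" "(x, k) \<notin> r"
        then obtain u v where uv: "k = {u..v}" "u \<le> x" "x \<le> v" "a \<le> u" "v \<le> b" using iv by blast
        have x: "x \<in> {a..b} - N" using uv xk by (auto simp: r_def)
        have "\<gamma> x = ball x (d x)" using x by (simp add: \<gamma>_def)
        moreover have "k \<subseteq> \<gamma> x" using fine xk(1) unfolding fine_def by blast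
        ultimately have "k \<subseteq> ball x (d x)" by simp
        moreover have "u \<in> k" "v \<in> k" using uv by auto
        ultimately have "u \<in> ball x (d x)" "v \<in> ball x (d x)" by blast+
        then have "\<bar>u - x\<bar> < d x" "\<bar>v - x\<bar> < d x" by (simp_all add: dist_real_def abs_minus_commute)
        then have "\<bar>f u - f x - deriv f x * (u - x)\<bar> \<le> c * \<bar>u - x\<bar>" "\<bar>f v - f x - deriv f x * (v - x)\<bar> \<le> c * \<bar>v - x\<bar>"
          using d(2)[OF x] by auto
        moreover have "c * \<bar>u - x\<bar> + c * \<bar>v - x\<bar> = c * (v - u)" using uv by (simp add: algebra_simps)
        moreover have "measure lborel k * g x = deriv f x * (v - x) - deriv f x * (u - x)"
          using uv x by (simp add: g_def algebra_simps)
        ultimately show "\<bar>measure lborel k * g x - (f (Sup k) - f (Inf k))\<bar> \<le> c * (Sup k - Inf k)" using uv by simp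
      qed
      also have "\<dots> \<le> (\<Sum>(x, k)\<in>p. c * (Sup k - Inf k))"
      proof (rule sum_mono2)
        show "0 \<le> (case xk of (x, k) \<Rightarrow> c * (Sup k - Inf k))" if "xk \<in> p - (p - r)" for xk
          using that iv c by (cases xk) fastforce
      qed (use pD(1) in auto)
      also have "\<dots> = c * (b - a)"
        using additive_tagged_division_1[OF ab p, of "\<lambda>x. c * x"] by (simp add: right_diff_distrib)
      also have "\<dots> \<le> e / 2" using e ab by (simp add: c_def field_simps)
      finally have one: "\<bar>\<Sum>(x, k)\<in>p - r. measure lborel k * g x - (f (Sup k) - f (Inf k))\<bar> \<le> e / 2" .
      have rt: "r tagged_partial_division_of {a..b}"
        using p rp by (meson tagged_division_of_def tagged_partial_division_subset)
      have rD: "r tagged_division_of \<Union>(snd ` r)" using tagged_partial_division_of_Union_self[OF rt] .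
      have div: "snd ` r division_of \<Union>(snd ` r)" by (rule partial_division_of_tagged_division[OF rt])
      have "(\<Sum>k\<in>snd ` r. Sup k - Inf k) = sum (measure lebesgue) (snd ` r)"
      proof (rule sum.cong)
        fix k assume "k \<in> snd ` r"
        then obtain x where "(x, k) \<in> p" using rp by auto
        then show "Sup k - Inf k = measure lebesgue k" using iv by fastforce
      qed simp
      also have "\<dots> = measure lebesgue (\<Union>(snd ` r))" using content_division[OF div] by simp
      also have "\<dots> \<le> measure lebesgue V"
      proof (rule measure_mono_fmeasurable[OF _ _ V(3)])
        show "\<Union>(snd ` r) \<subseteq> V" using fine unfolding fine_def \<gamma>_def r_def by fastforce
        show "\<Union>(snd ` r) \<in> sets lebesgue" using lmeasurable_division[OF div] by (rule fmeasurableD)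
      qed
      finally have "(\<Sum>k\<in>snd ` r. Sup k - Inf k) < \<delta>" using V(4) by simp
      then have "(\<Sum>k\<in>snd ` r. \<bar>f (Sup k) - f (Inf k)\<bar>) < e / 2"
      proof (intro ACd[OF div])
        show "\<Union>(snd ` r) \<subseteq> {a..b}" using tagged_partial_division_ofD(3)[OF rt] by fastforce
      qed
      moreover have "(\<Sum>(x, k)\<in>r. \<bar>f (Sup k) - f (Inf k)\<bar>) = (\<Sum>k\<in>snd ` r. \<bar>f (Sup k) - f (Inf k)\<bar>)"
      proof -
        \<comment> \<open>The value on the empty set is fixed to 0 because the transfer lemma asks
          for 0 on every \<open>cbox\<close> whose open box is empty, and that includes the empty
          one.\<close>
        let ?d = "\<lambda>k. if k = {} then 0 else \<bar>f (Sup k) - f (Inf k)\<bar>"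
        have ne: "k \<noteq> {}" if "(x, k) \<in> r" for x k using that rp(1) pD(2) by blast
        have "(\<Sum>(x, k)\<in>r. ?d k) = sum ?d (snd ` r)"
        proof (rule sum.over_tagged_division_lemma[OF rD])
          fix u v :: real assume "box u v = {}"
          then have "v \<le> u" by simp
          then show "?d (cbox u v) = 0" by (cases "u = v") auto
        qed
        moreover have "(\<Sum>(x, k)\<in>r. ?d k) = (\<Sum>(x, k)\<in>r. \<bar>f (Sup k) - f (Inf k)\<bar>)"
          by (rule sum.cong) (use ne in auto)
        moreover have "sum ?d (snd ` r) = (\<Sum>k\<in>snd ` r. \<bar>f (Sup k) - f (Inf k)\<bar>)"
          by (rule sum.cong) (use ne in auto)
        ultimately show ?thesis by simp
      qed
      moreover have "\<bar>\<Sum>(x, k)\<in>r. measure lborel k * g x - (f (Sup k) - f (Inf k))\<bar> \<le> (\<Sum>(x, k)\<in>r. \<bar>f (Sup k) - f (Inf k)\<bar>)"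
      proof (rule order_trans[OF sum_abs], rule sum_mono, clarify)
        fix x k assume "(x, k) \<in> r"
        then have "g x = 0" by (simp add: r_def g_def)
        then show "\<bar>measure lborel k * g x - (f (Sup k) - f (Inf k))\<bar> \<le> \<bar>f (Sup k) - f (Inf k)\<bar>" by simp
      qed
      ultimately show "norm ((\<Sum>(x, k)\<in>p. measure lborel k *\<^sub>R g x) - (f b - f a)) < e"
        using one unfolding eq real_norm_def by linarith
    qed
  qed
  then show ?thesis
    by (rule has_integral_spike[OF N, rotated]) (auto simp: g_def)
qed

section \<open>Weak KAM functions of a twist kernel\<close>

text \<open>Translation number of Poincare. Quasi-additivity makes the intervals of radius
  \<open>1 / n\<close> around \<open>a n / n\<close> meet pairwise; \<open>w\<close> is the supremum
  of their left ends, with error 1 for positive indices. Passing to \<open>- k\<close> costs one for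
  \<open>a 0\<close> and one for the defect, hence 3.\<close>

lemma quasi_additive_slope:
  fixes a :: "int \<Rightarrow> real"
  assumes qa: "\<And>k l. \<bar>a (k + l) - a k - a l\<bar> \<le> 1"
  obtains w where "\<And>k. \<bar>a k - of_int k * w\<bar> \<le> 3"
proof -
  have mult: "\<bar>a (int m * k) - real m * a k\<bar> \<le> real m" if "1 \<le> m" for m k
    using that
  proof (induction m rule: nat_induct_at_least)
    case base
    then show ?case by simp
  next
    case (Suc m)
    have "int (Suc m) * k = int m * k + k" by (simp add: algebra_simps)
    then show ?case using Suc.IH qa[of "int m * k" k] by (simp add: algebra_simps)
  qed
  have cmp: "a (int n) / real n - 1 / real n \<le> a (int m) / real m + 1 / real m"
    if "1 \<le> n" "1 \<le> m" for n m
  proof -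
    have "real m * a (int n) - real n * a (int m) \<le> real m + real n"
      using mult[of m "int n"] mult[of n "int m"] that by (simp add: mult.commute)
    then have "(a (int n) - 1) * real m \<le> (a (int m) + 1) * real n" by (simp add: algebra_simps)
    then have "(a (int n) - 1) / real n \<le> (a (int m) + 1) / real m"
      using that by (simp add: pos_divide_le_eq pos_le_divide_eq)
    then show ?thesis by (simp add: diff_divide_distrib add_divide_distrib)
  qed
  define A where "A = {a (int n) / real n - 1 / real n | n. 1 \<le> n}"
  define w where "w = Sup A"
  have ne: "A \<noteq> {}" by (auto simp: A_def)
  have bdd: "bdd_above A"
    using cmp[of _ 1] unfolding A_def by (intro bdd_aboveI[of _ "a 1 / 1 + 1 / 1"]) fastforce
  have pos: "\<bar>a (int n) - real n * w\<bar> \<le> 1" if n: "1 \<le> n" for n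
  proof -
    have "a (int n) / real n - 1 / real n \<le> w"
      unfolding w_def by (rule cSup_upper[OF _ bdd]) (use n in \<open>auto simp: A_def\<close>)
    moreover have "w \<le> a (int n) / real n + 1 / real n"
      unfolding w_def by (rule cSup_least[OF ne]) (use cmp[OF _ n] in \<open>auto simp: A_def\<close>)
    ultimately show ?thesis using n by (simp add: field_simps abs_le_iff)
  qed
  have zero: "\<bar>a 0\<bar> \<le> 1" using qa[of 0 0] by simp
  show thesis
  proof (rule that[of w])
    fix k :: int
    show "\<bar>a k - of_int k * w\<bar> \<le> 3"
    proof (cases "k = 0")
      case True
      then show ?thesis using zero by simp
    next
      case False
      have p: "\<bar>a \<bar>k\<bar> - of_int \<bar>k\<bar> * w\<bar> \<le> 1" using pos[of "nat \<bar>k\<bar>"] False by simp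
      show ?thesis
      proof (cases "0 < k")
        case True
        then show ?thesis using p by simp
      next
        case False
        have "\<bar>a 0 - a k - a (- k)\<bar> \<le> 1" using qa[of k "- k"] by simp
        then show ?thesis using p zero False by simp
      qed
    qed
  qed
qed

lemma periodic_int:
  assumes "\<And>x :: real. f (x + 1) = f x"
  shows "f (x + of_int m) = f x"
proof -
  have nat: "f (x + real n) = f x" for n x
  proof (induction n)
    case (Suc n)
    then show ?case using assms[of "x + real n"] by (simp add: add.commute add.left_commute)
  qed simp
  show ?thesis
  proof (cases "0 \<le> m")
    case True
    then show ?thesis using nat[of x "nat m"] by simp
  next
    case False
    then show ?thesis using nat[of "x + of_int m" "nat (- m)"] by simp
  qed
qed

text \<open>The abstract unit-time action of Aubry--Mather theory. \<open>k_cross\<close> is the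
  twist condition in integrated form. \<open>k_back\<close> and \<open>k_forw\<close> say that a
  two-step minimizer is determined by its midpoint and one end; they stand in for the twist map that
  a smooth generating function would define.\<close>

locale twist_kernel =
  fixes k :: "real \<Rightarrow> real \<Rightarrow> real"
  assumes k_shift: "\<And>y x. k (y + 1) (x + 1) = k y x"
    and k_cont: "continuous_on UNIV (\<lambda>(y, x). k y x)"
    and k_coercive: "\<exists>B. \<forall>y x. \<bar>x - y\<bar> - B \<le> k y x"
    and k_cross: "\<And>y1 y2 x1 x2. y2 \<le> y1 \<Longrightarrow> x1 \<le> x2 \<Longrightarrow> k y1 x2 + k y2 x1 \<le> k y1 x1 + k y2 x2"
    and k_back: "\<And>y1 y2 x x'. (\<And>z. k y1 x + k x x' \<le> k y1 z + k z x') \<Longrightarrow>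
                   (\<And>z. k y2 x + k x x' \<le> k y2 z + k z x') \<Longrightarrow> y1 = y2"
    and k_forw: "\<And>y x x1 x2. (\<And>z. k y x + k x x1 \<le> k y z + k z x1) \<Longrightarrow>
                   (\<And>z. k y x + k x x2 \<le> k y z + k z x2) \<Longrightarrow> x1 = x2"
begin

section \<open>Minimizers: uniqueness, crossing, compactness\<close>

definition minimizers :: "(real \<Rightarrow> real) \<Rightarrow> real \<Rightarrow> real set" where
  "minimizers u x = {y. u y + k y x = u x}"

definition weak_kam :: "(real \<Rightarrow> real) \<Rightarrow> bool" where
  "weak_kam u \<longleftrightarrow> continuous_on UNIV u \<and> (\<forall>x. u (x + 1) = u x) \<and>
     (\<forall>y x. u x \<le> u y + k y x) \<and> (\<forall>x. minimizers u x \<noteq> {})"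

definition calibrated :: "(real \<Rightarrow> real) \<Rightarrow> (int \<Rightarrow> real) \<Rightarrow> bool" where
  "calibrated u \<xi> \<longleftrightarrow> (\<forall>j. \<xi> j \<in> minimizers u (\<xi> (j + 1)))"

lemma minimizers_optimal:
  assumes "weak_kam u" "y \<in> minimizers u x" "x \<in> minimizers u x'"
  shows "k y x + k x x' \<le> k y z + k z x'"
proof -
  have "u x' \<le> u z + k z x'" "u z \<le> u y + k y z" using assms(1) by (auto simp: weak_kam_def)
  moreover have "u y + k y x = u x" "u x + k x x' = u x'" using assms(2,3) by (auto simp: minimizers_def)
  ultimately show ?thesis by linarith
qed

text \<open>Uniqueness of the predecessor needs a successor \<open>x'\<close>, which makes
  \<open>x\<close> the midpoint of a two-step minimizer; a shock point may have several
  predecessors. Uniqueness of the successor is unconditional, because every point has some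
  predecessor.\<close>

lemma minimizers_back_unique:
  assumes "weak_kam u" "y1 \<in> minimizers u x" "y2 \<in> minimizers u x" "x \<in> minimizers u x'"
  shows "y1 = y2"
  by (rule k_back[of y1 x x' y2]) (use assms minimizers_optimal in blast)+

lemma minimizers_forw_unique:
  assumes "weak_kam u" "x \<in> minimizers u x1" "x \<in> minimizers u x2"
  shows "x1 = x2"
proof -
  obtain y where "y \<in> minimizers u x" using assms(1) unfolding weak_kam_def by blast
  then show ?thesis by (intro k_forw[of y x x1 x2]) (use assms minimizers_optimal in blast)+
qed

text \<open>Domination bounds the swapped pairs from below and the crossing inequality bounds their
  sum from above by the calibrated values, so both become equalities.\<close>

lemma minimizers_cross:
  assumes "weak_kam u" "x1 \<le> x2" "y2 \<le> y1" "y1 \<in> minimizers u x1" "y2 \<in> minimizers u x2"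
  shows "y1 \<in> minimizers u x2" "y2 \<in> minimizers u x1"
proof -
  have "u x2 \<le> u y1 + k y1 x2" "u x1 \<le> u y2 + k y2 x1" using assms(1) by (auto simp: weak_kam_def)
  moreover have "u y1 + k y1 x1 = u x1" "u y2 + k y2 x2 = u x2" using assms(4,5) by (auto simp: minimizers_def)
  moreover have "k y1 x2 + k y2 x1 \<le> k y1 x1 + k y2 x2" by (rule k_cross[OF assms(3,2)])
  ultimately show "y1 \<in> minimizers u x2" "y2 \<in> minimizers u x1" by (auto simp: minimizers_def)
qed

lemma k_shift_int: "k (y + of_int m) (x + of_int m) = k y x"
  using periodic_int[of "\<lambda>t. k (y + t) (x + t)" 0 m] k_shift by (simp add: add.assoc[symmetric])

lemma weak_kam_periodic: "weak_kam u \<Longrightarrow> u (x + of_int m) = u x"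
  by (rule periodic_int) (simp add: weak_kam_def)

lemma minimizers_shift:
  assumes "weak_kam u"
  shows "y + of_int m \<in> minimizers u (x + of_int m) \<longleftrightarrow> y \<in> minimizers u x"
  using assms by (simp add: minimizers_def k_shift_int weak_kam_periodic)

lemma weak_kam_bounded:
  assumes "weak_kam u"
  obtains C where "\<And>x. \<bar>u x\<bar> \<le> C"
proof -
  have "compact (u ` {0..1})"
    using assms by (intro compact_continuous_image) (auto simp: weak_kam_def intro: continuous_on_subset)
  then obtain C where C: "\<And>x. x \<in> {0..1} \<Longrightarrow> \<bar>u x\<bar> \<le> C"
    unfolding compact_eq_bounded_closed bounded_iff by force
  have "\<bar>u x\<bar> \<le> C" for x
  proof -
    have "u x = u (frac x + of_int \<lfloor>x\<rfloor>)" by (simp add: frac_def)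
    also have "\<dots> = u (frac x)" by (rule weak_kam_periodic[OF assms])
    finally show ?thesis using C[of "frac x"] by (simp add: frac_lt_1 less_imp_le)
  qed
  then show thesis by (rule that)
qed

lemma minimizers_bounded:
  assumes "weak_kam u"
  obtains D where "\<And>x y. y \<in> minimizers u x \<Longrightarrow> \<bar>x - y\<bar> \<le> D"
proof -
  obtain C where C: "\<And>x. \<bar>u x\<bar> \<le> C" using weak_kam_bounded[OF assms] by blast
  obtain B where B: "\<And>y x. \<bar>x - y\<bar> - B \<le> k y x" using k_coercive by blast
  show thesis
  proof (rule that[of "B + 2 * C"])
    fix x y assume "y \<in> minimizers u x"
    then have "u y + k y x = u x" by (simp add: minimizers_def)
    then show "\<bar>x - y\<bar> \<le> B + 2 * C" using C[of x] C[of y] B[of x y] by linarith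
  qed
qed

lemma minimizers_closed_graph:
  assumes "weak_kam u" "Y \<longlonglongrightarrow> y" "X \<longlonglongrightarrow> x" "\<And>n. Y n \<in> minimizers u (X n)"
  shows "y \<in> minimizers u x"
proof -
  have cu: "isCont u z" for z using assms(1) by (auto simp: weak_kam_def continuous_on_eq_continuous_at)
  have "isCont (\<lambda>(y, x). k y x) (y, x)" using k_cont by (auto simp: continuous_on_eq_continuous_at)
  from isCont_tendsto_compose[OF this tendsto_Pair[OF assms(2,3)]]
  have "(\<lambda>n. k (Y n) (X n)) \<longlonglongrightarrow> k y x" by simp
  from tendsto_add[OF isCont_tendsto_compose[OF cu assms(2)] this]
  have "(\<lambda>n. u (Y n) + k (Y n) (X n)) \<longlonglongrightarrow> u y + k y x" .
  moreover have "(\<lambda>n. u (Y n) + k (Y n) (X n)) = (\<lambda>n. u (X n))" using assms(4) by (auto simp: minimizers_def)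
  moreover have "(\<lambda>n. u (X n)) \<longlonglongrightarrow> u x" using isCont_tendsto_compose[OF cu assms(3)] .
  ultimately show ?thesis using LIMSEQ_unique by (auto simp: minimizers_def)
qed

section \<open>The invariant set and its two-sided orbits\<close>

definition iterated :: "(real \<Rightarrow> real) \<Rightarrow> nat \<Rightarrow> real set" where
  "iterated u n = ((\<lambda>X. \<Union>x\<in>X. minimizers u x) ^^ n) UNIV"

definition invariant_set :: "(real \<Rightarrow> real) \<Rightarrow> real set" where
  "invariant_set u = (\<Inter>n. iterated u n)"

lemma iterated_simps:
  "iterated u 0 = UNIV" "iterated u (Suc n) = (\<Union>x\<in>iterated u n. minimizers u x)"
  by (auto simp: iterated_def)

lemma iterated_decreasing: "m \<le> n \<Longrightarrow> iterated u n \<subseteq> iterated u m"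
proof -
  have "iterated u (Suc n) \<subseteq> iterated u n" for n
    by (induction n) (auto simp: iterated_simps)
  then show "m \<le> n \<Longrightarrow> iterated u n \<subseteq> iterated u m" by (rule lift_Suc_antimono_le)
qed

lemma iterated_shift:
  assumes "weak_kam u" "x \<in> iterated u n"
  shows "x + of_int m \<in> iterated u n"
  using assms(2)
proof (induction n arbitrary: x)
  case 0
  then show ?case by (simp add: iterated_simps)
next
  case (Suc n)
  then show ?case using minimizers_shift[OF assms(1), of x m] by (auto simp: iterated_simps)
qed

lemma iterated_nonempty:
  assumes "weak_kam u"
  shows "iterated u n \<noteq> {}"
  by (induction n) (use assms in \<open>auto simp: iterated_simps weak_kam_def\<close>)

text \<open>Preimages \<open>X i\<close> stay within distance \<open>D\<close> of a convergent
  sequence, so a subsequence converges, and the graph of \<open>minimizers u\<close> is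
  closed.\<close>

lemma iterated_closed:
  assumes u: "weak_kam u"
  shows "closed (iterated u n)"
proof (induction n)
  case 0
  then show ?case by (simp add: iterated_simps)
next
  case (Suc n)
  obtain D where D: "\<And>x y. y \<in> minimizers u x \<Longrightarrow> \<bar>x - y\<bar> \<le> D" using minimizers_bounded[OF u] by blast
  show ?case
    unfolding closed_sequential_limits
  proof (intro allI impI, elim conjE)
    fix Y y assume Y: "\<forall>i. Y i \<in> iterated u (Suc n)" "Y \<longlonglongrightarrow> y"
    then have "\<forall>i. \<exists>x. x \<in> iterated u n \<and> Y i \<in> minimizers u x" by (auto simp: iterated_simps)
    then obtain X where X: "\<And>i. X i \<in> iterated u n" "\<And>i. Y i \<in> minimizers u (X i)" by metis
    have "bounded (range Y)" using Y(2) convergent_imp_bounded by blast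
    then obtain B where B: "\<And>i. \<bar>Y i\<bar> \<le> B" by (auto simp: bounded_iff)
    have "\<bar>X i\<bar> \<le> B + D" for i using B[of i] D[OF X(2)[of i]] by linarith
    then have "bounded (range X)" by (auto simp: bounded_iff)
    then obtain x r where r: "strict_mono r" "(X \<circ> r) \<longlonglongrightarrow> x"
      using bounded_imp_convergent_subsequence by blast
    have "x \<in> iterated u n"
      using closed_sequentially[OF Suc _ r(2)] X(1) by auto
    moreover have "y \<in> minimizers u x"
      by (rule minimizers_closed_graph[OF u LIMSEQ_subseq_LIMSEQ[OF Y(2) r(1)] r(2)]) (use X(2) in auto)
    ultimately show "y \<in> iterated u (Suc n)" by (auto simp: iterated_simps)
  qed
qed

text \<open>Nested compact sets after reduction to the unit interval, which is possible since every
  iterate is invariant under integer translations.\<close>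

lemma invariant_set_nonempty:
  assumes u: "weak_kam u"
  shows "invariant_set u \<noteq> {}"
proof -
  have "\<Inter>(range (\<lambda>n. iterated u n \<inter> {0..1})) \<noteq> {}"
  proof (rule compact_nest)
    show "compact (iterated u n \<inter> {0..1})" for n
      using iterated_closed[OF u] by (simp add: closed_Int_compact)
    show "iterated u n \<inter> {0..1} \<noteq> {}" for n
    proof -
      obtain x where "x \<in> iterated u n" using iterated_nonempty[OF u] by blast
      then have "x + of_int (- \<lfloor>x\<rfloor>) \<in> iterated u n" by (rule iterated_shift[OF u])
      moreover have "x + of_int (- \<lfloor>x\<rfloor>) \<in> {0..1}" by simp linarith
      ultimately show ?thesis by blast
    qed
  qed (use iterated_decreasing in blast)
  then show ?thesis by (auto simp: invariant_set_def)
qed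

text \<open>Membership in each iterate provides a successor depending on \<open>n\<close>;
  uniqueness of successors makes it the same point for all \<open>n\<close>.\<close>

lemma invariant_set_succ:
  assumes u: "weak_kam u" and x: "x \<in> invariant_set u"
  obtains x' where "x' \<in> invariant_set u" "x \<in> minimizers u x'"
proof -
  have pre: "\<exists>x'. x' \<in> iterated u n \<and> x \<in> minimizers u x'" for n
    using x by (auto simp: invariant_set_def iterated_simps dest!: spec[of _ "Suc n"])
  obtain x' where x': "x \<in> minimizers u x'" using pre[of 0] by blast
  have "x' \<in> iterated u n" for n
    using pre[of n] minimizers_forw_unique[OF u x'] by blast
  then show thesis using that x' by (auto simp: invariant_set_def)
qed

lemma invariant_set_pred:
  assumes u: "weak_kam u" and x: "x \<in> invariant_set u"
  obtains y where "y \<in> invariant_set u" "minimizers u x = {y}"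
proof -
  obtain x' where x': "x \<in> minimizers u x'" using invariant_set_succ[OF u x] by blast
  obtain y where y: "y \<in> minimizers u x" using u unfolding weak_kam_def by blast
  have "y \<in> iterated u n" for n
  proof -
    have "y \<in> iterated u (Suc n)" using x y by (auto simp: invariant_set_def iterated_simps)
    then show ?thesis using iterated_decreasing[of n "Suc n" u] by auto
  qed
  moreover have "minimizers u x = {y}" using y minimizers_back_unique[OF u _ _ x'] by blast
  ultimately show thesis using that by (auto simp: invariant_set_def)
qed

abbreviation pred_map :: "(real \<Rightarrow> real) \<Rightarrow> real \<Rightarrow> real" where
  "pred_map u x \<equiv> the_elem (minimizers u x)"

lemma pred_map_bij:
  assumes u: "weak_kam u"
  shows "bij_betw (pred_map u) (invariant_set u) (invariant_set u)"
proof (rule bij_betwI')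
  fix x y assume x: "x \<in> invariant_set u" and y: "y \<in> invariant_set u"
  obtain z where "z \<in> invariant_set u" "minimizers u x = {z}" using invariant_set_pred[OF u x] by blast
  moreover obtain w where "w \<in> invariant_set u" "minimizers u y = {w}" using invariant_set_pred[OF u y] by blast
  ultimately show "(pred_map u x = pred_map u y) = (x = y)"
    using minimizers_forw_unique[OF u, of z x y] by auto
  show "pred_map u x \<in> invariant_set u" using \<open>minimizers u x = {z}\<close> \<open>z \<in> invariant_set u\<close> by simp
next
  fix x assume "x \<in> invariant_set u"
  then obtain x' where x': "x' \<in> invariant_set u" "x \<in> minimizers u x'" using invariant_set_succ[OF u] by blast
  obtain y where "minimizers u x' = {y}" using invariant_set_pred[OF u x'(1)] by blast
  then have "x = pred_map u x'" using x'(2) by simp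
  then show "\<exists>x'\<in>invariant_set u. x = pred_map u x'" using x'(1) by blast
qed

text \<open>Shaped exactly like \<open>orbit\<close>, so that the two coincide once the invariant
  sets and the predecessor maps are identified.\<close>

definition full_orbit :: "(real \<Rightarrow> real) \<Rightarrow> real \<Rightarrow> int \<Rightarrow> real" where
  "full_orbit u x j =
     (if j \<ge> 0 then (inv_into (invariant_set u) (pred_map u) ^^ nat j) x
      else (pred_map u ^^ nat (- j)) x)"

lemma full_orbit_calibrated:
  assumes u: "weak_kam u" and x: "x \<in> invariant_set u"
  shows "calibrated u (full_orbit u x)" "full_orbit u x 0 = x" "full_orbit u x j \<in> invariant_set u"
proof -
  let ?M = "invariant_set u" and ?T = "pred_map u"
  let ?S = "inv_into ?M ?T"
  have T: "?T z \<in> ?M" "?T z \<in> minimizers u z" if z: "z \<in> ?M" for z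
  proof -
    obtain y where y: "y \<in> invariant_set u" "minimizers u z = {y}" using invariant_set_pred[OF u z] by blast
    then show "?T z \<in> ?M" "?T z \<in> minimizers u z" by simp_all
  qed
  have S: "?S z \<in> ?M" "?T (?S z) = z" if "z \<in> ?M" for z
    using pred_map_bij[OF u] that inv_into_into[of z ?T ?M] f_inv_into_f[of z ?T ?M]
    by (auto simp: bij_betw_def)
  have Tn: "(?T ^^ n) x \<in> ?M" and Sn: "(?S ^^ n) x \<in> ?M" for n
    by (induction n) (auto simp: x T S)
  show orb: "full_orbit u x j \<in> ?M" for j using Tn Sn by (simp add: full_orbit_def)
  show "full_orbit u x 0 = x" by (simp add: full_orbit_def)
  have "full_orbit u x j = ?T (full_orbit u x (j + 1))" for j
  proof (cases "0 \<le> j")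
    case True
    then have "nat (j + 1) = Suc (nat j)" by simp
    then show ?thesis using True S(2)[OF Sn] by (simp add: full_orbit_def)
  next
    case False
    then have "nat (- j) = Suc (nat (- (j + 1)))" by simp
    then show ?thesis using False by (cases "j = - 1") (auto simp: full_orbit_def)
  qed
  then show "calibrated u (full_orbit u x)" unfolding calibrated_def using T(2)[OF orb] by metis
qed

section \<open>Order and rotation number of calibrated orbits\<close>

lemma calibrated_shift:
  assumes "weak_kam u" "calibrated u \<xi>"
  shows "calibrated u (\<lambda>j. \<xi> (j + l) + of_int m)"
  unfolding calibrated_def
proof
  fix j
  have "\<xi> (j + l) \<in> minimizers u (\<xi> (j + l + 1))" using assms(2) unfolding calibrated_def by blast
  moreover have "j + l + 1 = j + 1 + l" by simp
  ultimately show "\<xi> (j + l) + of_int m \<in> minimizers u (\<xi> (j + 1 + l) + of_int m)"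
    using minimizers_shift[OF assms(1)] by simp
qed

text \<open>If the order of two orbits changed in one step backward, crossing would give one point
  two different successors. Forward in time, meeting is excluded by uniqueness of predecessors and a
  change of order by the backward statement.\<close>

lemma calibrated_less:
  assumes u: "weak_kam u" and \<xi>: "calibrated u \<xi>" "calibrated u \<eta>" and less: "\<xi> 0 < \<eta> 0"
  shows "\<xi> j < \<eta> j"
proof -
  have m: "\<xi> (i - 1) \<in> minimizers u (\<xi> i)" "\<eta> (i - 1) \<in> minimizers u (\<eta> i)" for i
    using \<xi> unfolding calibrated_def by (metis diff_add_cancel)+
  have bk: "\<xi> (i - 1) < \<eta> (i - 1)" "\<eta> (i - 1) \<noteq> \<xi> (i - 1)" if "\<xi> i < \<eta> i" for i
  proof -
    show "\<xi> (i - 1) < \<eta> (i - 1)"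
    proof (rule ccontr)
      assume "\<not> \<xi> (i - 1) < \<eta> (i - 1)"
      then have "\<xi> (i - 1) \<in> minimizers u (\<eta> i)"
        using minimizers_cross(1)[OF u _ _ m(1)[of i] m(2)[of i]] that by simp
      then show False using minimizers_forw_unique[OF u m(1)[of i]] that by auto
    qed
    then show "\<eta> (i - 1) \<noteq> \<xi> (i - 1)" by simp
  qed
  have bk': "\<eta> (i - 1) < \<xi> (i - 1)" if "\<eta> i < \<xi> i" for i
  proof (rule ccontr)
    assume "\<not> \<eta> (i - 1) < \<xi> (i - 1)"
    then have "\<eta> (i - 1) \<in> minimizers u (\<xi> i)"
      using minimizers_cross(1)[OF u _ _ m(2)[of i] m(1)[of i]] that by simp
    then show False using minimizers_forw_unique[OF u m(2)[of i]] that by auto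
  qed
  have forw: "\<xi> (i + 1) < \<eta> (i + 1)" if "\<xi> i < \<eta> i" for i
  proof (rule linorder_cases[of "\<xi> (i + 1)" "\<eta> (i + 1)"])
    assume eq: "\<xi> (i + 1) = \<eta> (i + 1)"
    have "\<xi> (i + 1) \<in> minimizers u (\<xi> (i + 1 + 1))" using \<xi>(1) unfolding calibrated_def by blast
    then have "\<xi> i = \<eta> i"
      using minimizers_back_unique[OF u m(1)[of "i + 1"]] m(2)[of "i + 1"] eq by simp
    then show ?thesis using that by simp
  next
    assume "\<eta> (i + 1) < \<xi> (i + 1)"
    then show ?thesis using bk'[of "i + 1"] that by simp
  qed
  show ?thesis
  proof (cases "0 \<le> j")
    case True
    then show ?thesis by (induction j rule: int_ge_induct) (use less forw in auto)
  next
    case False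
    then have "j \<le> 0" by simp
    then show ?thesis by (induction j rule: int_le_induct) (use less bk in auto)
  qed
qed

lemma calibrated_eq:
  assumes u: "weak_kam u" and \<xi>: "calibrated u \<xi>" "calibrated u \<eta>" and eq: "\<xi> 0 = \<eta> 0"
  shows "\<xi> j = \<eta> j"
proof -
  have m: "\<xi> (i - 1) \<in> minimizers u (\<xi> i)" "\<eta> (i - 1) \<in> minimizers u (\<eta> i)" for i
    using \<xi> unfolding calibrated_def by (metis diff_add_cancel)+
  have n: "\<xi> i \<in> minimizers u (\<xi> (i + 1))" "\<eta> i \<in> minimizers u (\<eta> (i + 1))" for i
    using \<xi> by (auto simp: calibrated_def)
  show ?thesis
  proof (cases "0 \<le> j")
    case True
    then show ?thesis
    proof (induction j rule: int_ge_induct)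
      case (step i)
      then show ?case using minimizers_forw_unique[OF u n(1)[of i]] n(2)[of i] by simp
    qed (use eq in simp)
  next
    case False
    then have "j \<le> 0" by simp
    then show ?thesis
    proof (induction j rule: int_le_induct)
      case (step i)
      then show ?case using minimizers_back_unique[OF u m(1)[of i]  _ n(1)[of i]] m(2)[of i] by simp
    qed (use eq in simp)
  qed
qed

lemma calibrated_le:
  assumes "weak_kam u" "calibrated u \<xi>" "calibrated u \<eta>" "\<xi> 0 \<le> \<eta> 0"
  shows "\<xi> j \<le> \<eta> j"
  using calibrated_less[OF assms(1-3), of j] calibrated_eq[OF assms(1-3), of j] assms(4) by fastforce

text \<open>Squeezes one orbit between two consecutive integer translates of the other.\<close>

lemma calibrated_near:
  assumes u: "weak_kam u" and \<xi>: "calibrated u \<xi>" "calibrated u \<eta>"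
  shows "\<bar>\<eta> j - \<xi> j - (\<eta> 0 - \<xi> 0)\<bar> \<le> 1"
proof -
  define m where "m = \<lfloor>\<eta> 0 - \<xi> 0\<rfloor>"
  have m: "\<xi> 0 + of_int m \<le> \<eta> 0" "\<eta> 0 \<le> \<xi> 0 + of_int (m + 1)" unfolding m_def by linarith+
  have "\<xi> j + of_int m \<le> \<eta> j" "\<eta> j \<le> \<xi> j + of_int (m + 1)"
    using calibrated_le[OF u calibrated_shift[OF u \<xi>(1), of 0 m] \<xi>(2), of j] m(1)
      calibrated_le[OF u \<xi>(2) calibrated_shift[OF u \<xi>(1), of 0 "m + 1"], of j] m(2) by auto
  then show ?thesis using m by (simp add: abs_le_iff)
qed

text \<open>Comparing an orbit with its own time shifts makes its displacement quasi-additive. The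
  constant 4 is 3 from \<open>quasi_additive_slope\<close> plus 1 from
  \<open>calibrated_near\<close>.\<close>

lemma calibrated_rotation:
  assumes u: "weak_kam u" and \<xi>: "calibrated u \<xi>"
  obtains w where "\<And>\<eta> j. calibrated u \<eta> \<Longrightarrow> \<bar>\<eta> j - \<eta> 0 - of_int j * w\<bar> \<le> 4"
proof -
  have "\<bar>(\<xi> (i + l) - \<xi> 0) - (\<xi> i - \<xi> 0) - (\<xi> l - \<xi> 0)\<bar> \<le> 1" for i l
    using calibrated_near[OF u \<xi> calibrated_shift[OF u \<xi>, of l 0], of i] by simp
  then obtain w where w: "\<And>j. \<bar>\<xi> j - \<xi> 0 - of_int j * w\<bar> \<le> 3"
    using quasi_additive_slope[of "\<lambda>j. \<xi> j - \<xi> 0"] by metis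
  show thesis
  proof (rule that[of w])
    fix \<eta> j assume "calibrated u \<eta>"
    then show "\<bar>\<eta> j - \<eta> 0 - of_int j * w\<bar> \<le> 4" using calibrated_near[OF u \<xi>, of \<eta> j] w[of j] by linarith
  qed
qed

text \<open>If the orbit violated the order of the rotation, comparison with its translate by
  (\<open>q\<close>, \<open>p\<close>) could be iterated, and the accumulated drift would exceed the
  bound 4.\<close>

lemma calibrated_order:
  assumes u: "weak_kam u" and \<xi>: "calibrated u \<xi>"
    and w: "\<And>\<eta> j. calibrated u \<eta> \<Longrightarrow> \<bar>\<eta> j - \<eta> 0 - of_int j * w\<bar> \<le> 4"
    and less: "of_int i * w + of_int m < of_int l * w + of_int n"
  shows "\<xi> i + of_int m < \<xi> l + of_int n"
proof (rule ccontr)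
  assume ge: "\<not> \<xi> i + of_int m < \<xi> l + of_int n"
  define q p where "q = l - i" and "p = n - m"
  define \<eta> where "\<eta> j = \<xi> (j + i)" for j
  have \<eta>: "calibrated u \<eta>" using calibrated_shift[OF u \<xi>, of i 0] by (simp add: \<eta>_def[abs_def])
  have base: "\<eta> q + of_int p \<le> \<eta> 0" using ge by (simp add: \<eta>_def q_def p_def)
  have step: "\<eta> (j + q) + of_int p \<le> \<eta> j" for j
    using calibrated_le[OF u calibrated_shift[OF u \<eta>, of q p] \<eta>, of j] base by simp
  have iter: "\<eta> (int N * q) + real N * of_int p \<le> \<eta> 0" for N
  proof (induction N)
    case (Suc N)
    have "int (Suc N) * q = int N * q + q" by (simp add: algebra_simps)
    then show ?case using Suc step[of "int N * q"] by (simp add: algebra_simps)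
  qed simp
  have "real N * (of_int q * w + of_int p) \<le> 4" for N
    using iter[of N] w[OF \<eta>, of "int N * q"] by (simp add: algebra_simps abs_le_iff)
  moreover have "0 < of_int q * w + of_int p" using less by (simp add: q_def p_def algebra_simps)
  ultimately show False by (meson not_le reals_Archimedean3)
qed

section \<open>Irrational rotation: the semiconjugacy \<open>orbit_sup\<close>\<close>

lemma irrational_dense:
  fixes w :: real
  assumes "w \<notin> \<rat>" "\<alpha> < \<beta>"
  shows "\<exists>j m. N \<le> j \<and> \<alpha> < of_int j * w + of_int m \<and> of_int j * w + of_int m < \<beta>"
    and "\<exists>j m. j \<le> N \<and> \<alpha> < of_int j * w + of_int m \<and> of_int j * w + of_int m < \<beta>"
proof -
  have *: "\<exists>j m. N \<le> j \<and> \<alpha> < of_int j * w + of_int m \<and> of_int j * w + of_int m < \<beta>"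
    if w: "w \<notin> \<rat>" and ab: "\<alpha> < \<beta>" for w \<alpha> \<beta> :: real and N :: int
  proof -
    have e: "0 < (\<beta> - \<alpha>) / 2" using ab by simp
    obtain h j where "0 < j" and hj: "\<bar>of_int j * w - of_int h - ((\<alpha> + \<beta>) / 2 - of_int N * w)\<bar> < (\<beta> - \<alpha>) / 2"
      using sequence_of_fractional_parts_is_dense[OF w e, of "(\<alpha> + \<beta>) / 2 - of_int N * w"] by blast
    have "\<bar>of_int (N + j) * w + of_int (- h) - (\<alpha> + \<beta>) / 2\<bar> < (\<beta> - \<alpha>) / 2"
      using hj by (simp add: algebra_simps)
    then have "\<alpha> < of_int (N + j) * w + of_int (- h)" "of_int (N + j) * w + of_int (- h) < \<beta>"
      by (auto simp: abs_less_iff field_simps)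
    then show ?thesis using \<open>0 < j\<close> by (intro exI[of _ "N + j"] exI[of _ "- h"]) auto
  qed
  show "\<exists>j m. N \<le> j \<and> \<alpha> < of_int j * w + of_int m \<and> of_int j * w + of_int m < \<beta>"
    using *[OF assms] .
  \<comment> \<open>Arbitrarily negative times for \<open>w\<close> are arbitrarily positive times
    for \<open>- w\<close>.\<close>
  have "- w \<notin> \<rat>" using assms(1) by simp
  then obtain j m where "- N \<le> j" "\<alpha> < of_int j * (- w) + of_int m" "of_int j * (- w) + of_int m < \<beta>"
    using *[of "- w" \<alpha> \<beta> "- N"] assms(2) by blast
  then show "\<exists>j m. j \<le> N \<and> \<alpha> < of_int j * w + of_int m \<and> of_int j * w + of_int m < \<beta>"
    by (intro exI[of _ "- j"] exI[of _ m]) auto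
qed

definition orbit_sup :: "(int \<Rightarrow> real) \<Rightarrow> real \<Rightarrow> real \<Rightarrow> real" where
  "orbit_sup \<xi> w \<theta> = Sup {\<xi> j + of_int m | j m. of_int j * w + of_int m < \<theta>}"

text \<open>Since \<open>\<xi> j + m\<close> is ordered like \<open>j w + m\<close>, \<open>orbit_sup\<close> is the left-continuous monotone function
  that semiconjugates the rotation by \<open>w\<close> to the orbit. A gap of the orbit closure is a jump of it.\<close>
context
  fixes \<xi> :: "int \<Rightarrow> real" and w :: real
  assumes order: "\<And>i l m n. of_int i * w + of_int m < of_int l * w + of_int n \<Longrightarrow> \<xi> i + of_int m < \<xi> l + of_int n"
    and near: "\<And>j. \<bar>\<xi> j - \<xi> 0 - of_int j * w\<bar> \<le> 4"
    and irr: "w \<notin> \<rat>"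
begin

lemma orbit_sup_upper:
  assumes "of_int j * w + of_int m < \<theta>"
  shows "\<xi> j + of_int m \<le> orbit_sup \<xi> w \<theta>"
  unfolding orbit_sup_def
proof (rule cSup_upper)
  show "bdd_above {\<xi> j + of_int m | j m. of_int j * w + of_int m < \<theta>}"
  proof (rule bdd_aboveI)
    fix z assume "z \<in> {\<xi> j + of_int m | j m. of_int j * w + of_int m < \<theta>}"
    then obtain j m where "z = \<xi> j + of_int m" "of_int j * w + of_int m < \<theta>" by blast
    then show "z \<le> \<theta> + \<xi> 0 + 4" using near[of j] by linarith
  qed
qed (use assms in blast)

lemma orbit_sup_least:
  assumes "\<And>j m. of_int j * w + of_int m < \<theta> \<Longrightarrow> \<xi> j + of_int m \<le> z"
  shows "orbit_sup \<xi> w \<theta> \<le> z"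
  unfolding orbit_sup_def
proof (rule cSup_least)
  have "of_int 0 * w + of_int (\<lfloor>\<theta>\<rfloor> - 1) < \<theta>" by simp linarith
  then show "{\<xi> j + of_int m | j m. of_int j * w + of_int m < \<theta>} \<noteq> {}" by blast
qed (use assms in blast)

text \<open>One orbit point close to the supremum suffices: by monotonicity all orbit points with
  angle between its angle and \<open>\<theta>\<close> are squeezed.\<close>

lemma orbit_sup_approx:
  assumes "0 < e"
  obtains \<alpha> where "\<alpha> < \<theta>" "\<And>j m. \<alpha> < of_int j * w + of_int m \<Longrightarrow> of_int j * w + of_int m < \<theta> \<Longrightarrow>
    \<bar>\<xi> j + of_int m - orbit_sup \<xi> w \<theta>\<bar> < e"
proof -
  obtain i n where i: "of_int i * w + of_int n < \<theta>" "orbit_sup \<xi> w \<theta> - e < \<xi> i + of_int n"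
  proof (rule ccontr)
    assume "\<not> thesis"
    then have "\<xi> j + of_int m \<le> orbit_sup \<xi> w \<theta> - e" if "of_int j * w + of_int m < \<theta>" for j m
      using that \<open>\<And>n i. of_int i * w + of_int n < \<theta> \<Longrightarrow> orbit_sup \<xi> w \<theta> - e < \<xi> i + of_int n \<Longrightarrow> thesis\<close>
      by fastforce
    then have "orbit_sup \<xi> w \<theta> \<le> orbit_sup \<xi> w \<theta> - e" by (rule orbit_sup_least)
    then show False using assms by simp
  qed
  show thesis
  proof (rule that[OF i(1)])
    fix j m assume "of_int i * w + of_int n < of_int j * w + of_int m" "of_int j * w + of_int m < \<theta>"
    then show "\<bar>\<xi> j + of_int m - orbit_sup \<xi> w \<theta>\<bar> < e"
      using order[of i n j m] orbit_sup_upper[of j m \<theta>] i(2) by linarith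
  qed
qed

lemma orbit_sup_shift: "orbit_sup \<xi> w (\<theta> + of_int n) = orbit_sup \<xi> w \<theta> + of_int n"
proof (rule antisym)
  show "orbit_sup \<xi> w (\<theta> + of_int n) \<le> orbit_sup \<xi> w \<theta> + of_int n"
  proof (rule orbit_sup_least)
    fix j m assume "of_int j * w + of_int m < \<theta> + of_int n"
    then have "of_int j * w + of_int (m - n) < \<theta>" by simp
    from orbit_sup_upper[OF this] show "\<xi> j + of_int m \<le> orbit_sup \<xi> w \<theta> + of_int n" by simp
  qed
  have "orbit_sup \<xi> w \<theta> \<le> orbit_sup \<xi> w (\<theta> + of_int n) - of_int n"
  proof (rule orbit_sup_least)
    fix j m assume "of_int j * w + of_int m < \<theta>"
    then have "of_int j * w + of_int (m + n) < \<theta> + of_int n" by simp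
    from orbit_sup_upper[OF this] show "\<xi> j + of_int m \<le> orbit_sup \<xi> w (\<theta> + of_int n) - of_int n" by simp
  qed
  then show "orbit_sup \<xi> w \<theta> + of_int n \<le> orbit_sup \<xi> w (\<theta> + of_int n)" by simp
qed

text \<open>Jumps at distinct angles add up, by induction on the largest angle. The alternative
  \<open>A = {}\<close> is needed because an empty \<open>A\<close> allows \<open>\<beta>\<close> to
  be negative.\<close>

lemma orbit_sup_jumps:
  assumes "finite A" "A \<subseteq> {0..<\<beta>}"
    and jump: "\<And>t b. t \<in> A \<Longrightarrow> t < b \<Longrightarrow> orbit_sup \<xi> w t + e \<le> orbit_sup \<xi> w b"
  shows "real (card A) * e \<le> orbit_sup \<xi> w \<beta> - orbit_sup \<xi> w 0 \<or> A = {}"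
  using assms
proof (induction arbitrary: \<beta> rule: finite_linorder_max_induct)
  case empty
  then show ?case by simp
next
  case (insert t A)
  have t: "orbit_sup \<xi> w t + e \<le> orbit_sup \<xi> w \<beta>" using insert.prems by auto
  show ?case
  proof (cases "A = {}")
    case True
    have "orbit_sup \<xi> w 0 \<le> orbit_sup \<xi> w t"
    proof (rule orbit_sup_least)
      fix j m assume "of_int j * w + of_int m < 0"
      then have "of_int j * w + of_int m < t" using insert.prems(1) by auto
      then show "\<xi> j + of_int m \<le> orbit_sup \<xi> w t" by (rule orbit_sup_upper)
    qed
    then show ?thesis using t True by simp
  next
    case False
    have "real (card A) * e \<le> orbit_sup \<xi> w t - orbit_sup \<xi> w 0 \<or> A = {}"
    proof (rule insert.IH)
      show "A \<subseteq> {0..<t}" using insert.prems(1) insert.hyps(2) by auto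
    qed (use insert.prems in auto)
    moreover have "t \<notin> A" using insert.hyps(2) by auto
    ultimately show ?thesis using t False insert.hyps(1) by (simp add: algebra_simps)
  qed
qed

text \<open>The points \<open>\<theta> - i w\<close> are distinct modulo 1 and the jumps there sum up to at most 1.\<close>
lemma orbit_sup_small_jump:
  assumes "0 < e" and y: "\<And>i b. \<theta> - real i * w < b \<Longrightarrow> y i \<le> orbit_sup \<xi> w b"
  obtains i where "y i < orbit_sup \<xi> w (\<theta> - real i * w) + e"
proof (rule ccontr)
  assume "\<not> thesis"
  then have big: "orbit_sup \<xi> w (\<theta> - real i * w) + e \<le> y i" for i using that[of i] by linarith
  obtain N :: nat where N: "1 < real N * e" using reals_Archimedean3[OF assms(1)] by blast
  define f where "f i = frac (\<theta> - real i * w)" for i :: nat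
  have inj: "inj f"
  proof (rule injI)
    fix i l assume "f i = f l"
    then have "(real l - real i) * w = of_int (\<lfloor>\<theta> - real i * w\<rfloor> - \<lfloor>\<theta> - real l * w\<rfloor>)"
      by (simp add: f_def frac_def algebra_simps)
    then have "(real l - real i) * w \<in> \<rat>" by simp
    show "i = l"
    proof (rule ccontr)
      assume "i \<noteq> l"
      then have "w = ((real l - real i) * w) / (real l - real i)" by simp
      moreover have "\<dots> \<in> \<rat>" using \<open>(real l - real i) * w \<in> \<rat>\<close> by (intro Rats_divide Rats_diff) auto
      ultimately show False using irr by simp
    qed
  qed
  have "real (card (f ` {..<N})) * e \<le> orbit_sup \<xi> w 1 - orbit_sup \<xi> w 0 \<or> f ` {..<N} = {}"
  proof (rule orbit_sup_jumps)
    show "f ` {..<N} \<subseteq> {0..<1}" by (auto simp: f_def frac_lt_1)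
    fix t b assume "t \<in> f ` {..<N}" "t < b"
    then obtain i where i: "t = f i" by blast
    define n where "n = \<lfloor>\<theta> - real i * w\<rfloor>"
    have eq: "\<theta> - real i * w = t + of_int n" by (simp add: i f_def frac_def n_def)
    have "y i \<le> orbit_sup \<xi> w (b + of_int n)" by (rule y) (use eq \<open>t < b\<close> in simp)
    moreover have "orbit_sup \<xi> w (t + of_int n) + e \<le> y i" using big[of i] eq by simp
    ultimately show "orbit_sup \<xi> w t + e \<le> orbit_sup \<xi> w b" unfolding orbit_sup_shift by simp
  qed simp
  moreover have "card (f ` {..<N}) = N" using inj by (simp add: card_image inj_on_subset)
  moreover have "orbit_sup \<xi> w 1 = orbit_sup \<xi> w 0 + 1" using orbit_sup_shift[of 0 1] by simp
  moreover have "N \<noteq> 0" using N by (cases N) auto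
  ultimately show False using N by auto
qed

end

theorem weak_kam_unique:
  assumes u: "weak_kam u" and v: "weak_kam v" and \<xi>: "calibrated u \<xi>"
    and w: "\<And>\<eta> j. calibrated u \<eta> \<Longrightarrow> \<bar>\<eta> j - \<eta> 0 - of_int j * w\<bar> \<le> 4"
    and irr: "w \<notin> \<rat>"
  shows "\<exists>c. \<forall>x. v x - u x = c"
proof -
  note order = calibrated_order[OF u \<xi> w]
  note near = w[OF \<xi>]
  define g where "g x = v x - u x" for x
  have cg: "isCont g x" for x
    using u v unfolding g_def weak_kam_def by (intro continuous_intros) (auto simp: continuous_on_eq_continuous_at)
  have pg: "g (x + of_int m) = g x" for x m
    by (simp add: g_def weak_kam_periodic[OF u] weak_kam_periodic[OF v])
  define F where "F = orbit_sup \<xi> w"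
  have dec1: "g (\<xi> (j + 1)) \<le> g (\<xi> j)" for j
  proof -
    have "u (\<xi> j) + k (\<xi> j) (\<xi> (j + 1)) = u (\<xi> (j + 1))"
      using \<xi> by (auto simp: calibrated_def minimizers_def)
    moreover have "v (\<xi> (j + 1)) \<le> v (\<xi> j) + k (\<xi> j) (\<xi> (j + 1))" using v by (auto simp: weak_kam_def)
    ultimately show ?thesis by (simp add: g_def)
  qed
  have dec: "g (\<xi> l) \<le> g (\<xi> j)" if "j \<le> l" for j l
    using that by (induction l rule: int_ge_induct) (use dec1 order_trans in blast)+
  \<comment> \<open>\<open>F \<theta>\<close> is a limit of orbit points modulo 1 both along indices
    above \<open>j\<close> and along indices below \<open>j\<close>, so the monotone sequence
    \<open>g (\<xi> j)\<close> is squeezed to \<open>g (F \<theta>)\<close>. Periodicity of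
    \<open>g\<close> removes the integers \<open>m\<close>.\<close>
  have const: "g (\<xi> j) = g (F \<theta>)" for j \<theta>
  proof -
    have close: "\<exists>\<alpha><\<theta>. \<forall>i m. \<alpha> < of_int i * w + of_int m \<longrightarrow> of_int i * w + of_int m < \<theta> \<longrightarrow>
       \<bar>g (\<xi> i) - g (F \<theta>)\<bar> < e" if e: "0 < e" for e
    proof -
      obtain d where d: "0 < d" "\<And>z. \<bar>z - F \<theta>\<bar> < d \<Longrightarrow> \<bar>g z - g (F \<theta>)\<bar> < e"
        using cg[of "F \<theta>"] e unfolding continuous_at_eps_delta dist_real_def by metis
      obtain \<alpha> where "\<alpha> < \<theta>" "\<And>j m. \<alpha> < of_int j * w + of_int m \<Longrightarrow> of_int j * w + of_int m < \<theta> \<Longrightarrow>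
        \<bar>\<xi> j + of_int m - F \<theta>\<bar> < d"
        using orbit_sup_approx[OF order near irr d(1)] unfolding F_def by blast
      then show ?thesis using d(2) pg by metis
    qed
    show ?thesis
    proof (rule antisym; rule field_le_epsilon)
      fix e :: real assume e: "0 < e"
      obtain \<alpha> where \<alpha>: "\<alpha> < \<theta>" "\<And>i m. \<alpha> < of_int i * w + of_int m \<Longrightarrow> of_int i * w + of_int m < \<theta> \<Longrightarrow>
       \<bar>g (\<xi> i) - g (F \<theta>)\<bar> < e" using close[OF e] by blast
      obtain i m where "i \<le> j" "\<alpha> < of_int i * w + of_int m" "of_int i * w + of_int m < \<theta>"
        using irrational_dense(2)[OF irr \<alpha>(1), of j] by blast
      then show "g (\<xi> j) \<le> g (F \<theta>) + e" using \<alpha>(2)[of i m] dec[of i j] by linarith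
      obtain i m where "j \<le> i" "\<alpha> < of_int i * w + of_int m" "of_int i * w + of_int m < \<theta>"
        using irrational_dense(1)[OF irr \<alpha>(1), of j] by blast
      then show "g (F \<theta>) \<le> g (\<xi> j) + e" using \<alpha>(2)[of i m] dec[of j i] by linarith
    qed
  qed
  define c where "c = g (\<xi> 0)"
  have c: "g (\<xi> j) = c" "g (F \<theta>) = c" for j \<theta>
    unfolding c_def using const[of j 0] const[of 0 0] const[of 0 \<theta>] by simp_all
  have \<xi>v: "calibrated v \<xi>"
    unfolding calibrated_def
  proof
    fix j
    have "u (\<xi> j) + k (\<xi> j) (\<xi> (j + 1)) = u (\<xi> (j + 1))"
      using \<xi> by (auto simp: calibrated_def minimizers_def)
    then show "\<xi> j \<in> minimizers v (\<xi> (j + 1))"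
      using c(1)[of j] c(1)[of "j + 1"] by (simp add: g_def minimizers_def)
  qed
  \<comment> \<open>Stated for a general \<open>h\<close>, since it is applied both to
    \<open>u\<close> and to \<open>v\<close>.\<close>
  have approach: "\<exists>i. \<bar>g (y i) - c\<bar> < e"
    if h: "weak_kam h" "calibrated h \<xi>" and y: "\<And>i. y (Suc i) \<in> minimizers h (y i)" and e: "0 < e"
    for h and y :: "nat \<Rightarrow> real" and e
  proof -
    have single: "\<xi> (j - 1) + of_int m \<in> minimizers h (\<xi> j + of_int m)"
      "z \<in> minimizers h (\<xi> j + of_int m) \<Longrightarrow> z = \<xi> (j - 1) + of_int m" for j m z
    proof -
      have sh: "calibrated h (\<lambda>j. \<xi> j + of_int m)" using calibrated_shift[OF h, of 0 m] by simp
      then have 1: "\<xi> j + of_int m \<in> minimizers h (\<xi> (j + 1) + of_int m)" for j unfolding calibrated_def by blast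
      show 2: "\<xi> (j - 1) + of_int m \<in> minimizers h (\<xi> j + of_int m)" using 1[of "j - 1"] by simp
      show "z = \<xi> (j - 1) + of_int m" if "z \<in> minimizers h (\<xi> j + of_int m)"
        using minimizers_back_unique[OF h(1) that 2 1] .
    qed
    \<comment> \<open>If the backward step reversed the order, crossing would make
      \<open>y (Suc i)\<close> a predecessor of the orbit point, and that predecessor is
      unique.\<close>
    have le1: "\<xi> (j - 1) + of_int m \<le> y (Suc i)" if "\<xi> j + of_int m \<le> y i" for i j m
      using minimizers_cross(2)[OF h(1) that _ single(1) y] single(2)[of "y (Suc i)" j m] by force
    have ge1: "y (Suc i) \<le> \<xi> (j - 1) + of_int m" if "y i \<le> \<xi> j + of_int m" for i j m
      using minimizers_cross(1)[OF h(1) that _ y single(1)] single(2)[of "y (Suc i)" j m] by force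
    have le: "\<xi> (j - int i) + of_int m \<le> y i" if "\<xi> j + of_int m \<le> y 0" for i j m
    proof (induction i)
      case (Suc i)
      then show ?case using le1[of "j - int i" m i] by (simp add: algebra_simps)
    qed (use that in simp)
    have ge: "y i \<le> \<xi> (j - int i) + of_int m" if "y 0 \<le> \<xi> j + of_int m" for i j m
    proof (induction i)
      case (Suc i)
      then show ?case using ge1[of i "j - int i" m] by (simp add: algebra_simps)
    qed (use that in simp)
    \<comment> \<open>\<open>\<theta>\<close> is the angle of \<open>y 0\<close> relative to the
      orbit. Order preservation keeps \<open>y i\<close> between \<open>F (\<theta> - i w)\<close>
      and the right limit of \<open>F\<close> there, that is, inside one jump; small jumps then
      force closeness.\<close>
    define A where "A = {of_int j * w + of_int m | j m. \<xi> j + of_int m \<le> y 0}"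
    define \<theta> where "\<theta> = Sup A"
    have bdd: "bdd_above A"
    proof (rule bdd_aboveI)
      fix z assume "z \<in> A"
      then obtain j m where "z = of_int j * w + of_int m" "\<xi> j + of_int m \<le> y 0" unfolding A_def by blast
      then show "z \<le> y 0 - \<xi> 0 + 4" using near[of j] by linarith
    qed
    have "\<xi> 0 + of_int \<lfloor>y 0 - \<xi> 0\<rfloor> \<le> y 0" by linarith
    then have ne: "A \<noteq> {}" unfolding A_def by blast
    have below: "\<xi> j + of_int m \<le> y 0" if jm: "of_int j * w + of_int m < \<theta>" for j m
    proof -
      obtain z where "z \<in> A" "of_int j * w + of_int m < z"
        using less_cSupD[OF ne jm[unfolded \<theta>_def]] by blast
      then obtain i n where "of_int j * w + of_int m < of_int i * w + of_int n" "\<xi> i + of_int n \<le> y 0"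
        unfolding A_def by blast
      then show ?thesis using order[of j m i n] by linarith
    qed
    have above: "y 0 \<le> \<xi> j + of_int m" if "\<theta> < of_int j * w + of_int m" for j m
    proof (rule ccontr)
      assume "\<not> ?thesis"
      then have "of_int j * w + of_int m \<in> A" unfolding A_def by force
      then have "of_int j * w + of_int m \<le> \<theta>" unfolding \<theta>_def using bdd by (rule cSup_upper)
      then show False using that by simp
    qed
    have lower: "F (\<theta> - real i * w) \<le> y i" for i
      unfolding F_def
    proof (rule orbit_sup_least[OF order near irr])
      fix j m assume "of_int j * w + of_int m < \<theta> - real i * w"
      then have "of_int (j + int i) * w + of_int m < \<theta>" by (simp add: algebra_simps)
      from le[OF below[OF this], of i] show "\<xi> j + of_int m \<le> y i" by simp
    qed
    have upper: "y i \<le> F b" if b: "\<theta> - real i * w < b" for i b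
    proof -
      obtain j m where jm: "\<theta> - real i * w < of_int j * w + of_int m" "of_int j * w + of_int m < b"
        using irrational_dense(1)[OF irr b] by blast
      then have "\<theta> < of_int (j + int i) * w + of_int m" by (simp add: algebra_simps)
      from ge[OF above[OF this], of i] have "y i \<le> \<xi> j + of_int m" by simp
      also have "\<dots> \<le> F b" unfolding F_def by (rule orbit_sup_upper[OF order near irr jm(2)])
      finally show ?thesis .
    qed
    have "uniformly_continuous_on UNIV g"
    proof -
      have "uniformly_continuous_on {-1..2} g"
        using cg by (intro compact_uniformly_continuous continuous_at_imp_continuous_on) auto
      then show ?thesis
        unfolding uniformly_continuous_on_def
      proof (intro allI impI)
        fix e :: real assume "0 < e"
          and U: "\<forall>e>0. \<exists>d>0. \<forall>x\<in>{-1..2}. \<forall>x'\<in>{-1..2}. dist x' x < d \<longrightarrow> dist (g x') (g x) < e"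
        then obtain d where d: "0 < d" "\<And>x x'. x \<in> {-1..2} \<Longrightarrow> x' \<in> {-1..2} \<Longrightarrow> dist x' x < d \<Longrightarrow> dist (g x') (g x) < e"
          by metis
        show "\<exists>d>0. \<forall>x\<in>UNIV. \<forall>x'\<in>UNIV. dist x' x < d \<longrightarrow> dist (g x') (g x) < e"
        proof (intro exI[of _ "min d 1"] conjI ballI impI)
          fix x x' :: real assume xx: "dist x' x < min d 1"
          let ?m = "- \<lfloor>x\<rfloor>"
          have "dist (g (x' + of_int ?m)) (g (x + of_int ?m)) < e"
          proof (rule d(2))
            show "x + of_int ?m \<in> {- 1..2}" by simp linarith
            show "x' + of_int ?m \<in> {- 1..2}" using xx by (simp add: dist_real_def abs_less_iff) linarith
            show "dist (x' + of_int ?m) (x + of_int ?m) < d" using xx by (simp add: dist_real_def)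
          qed
          then show "dist (g x') (g x) < e" unfolding pg .
        qed (use d in auto)
      qed
    qed
    then obtain d where d: "0 < d" "\<And>x x'. \<bar>x' - x\<bar> < d \<Longrightarrow> \<bar>g x' - g x\<bar> < e"
      using e unfolding uniformly_continuous_on_def dist_real_def by (metis UNIV_I)
    obtain i where i: "y i < F (\<theta> - real i * w) + d"
      using orbit_sup_small_jump[OF order near irr d(1), of \<theta> y] upper unfolding F_def by blast
    then have "\<bar>y i - F (\<theta> - real i * w)\<bar> < d" using lower[of i] by linarith
    then have "\<bar>g (y i) - c\<bar> < e" using d(2) c(2) by metis
    then show ?thesis by blast
  qed
  have descent: "\<exists>y :: nat \<Rightarrow> real. y 0 = x \<and> (\<forall>i. y (Suc i) \<in> minimizers h (y i))" if "weak_kam h" for h x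
  proof -
    have "\<forall>z. \<exists>z'. z' \<in> minimizers h z" using that unfolding weak_kam_def by blast
    then obtain P where P: "\<And>z. P z \<in> minimizers h z" by metis
    show ?thesis by (rule exI[of _ "\<lambda>i. (P ^^ i) x"]) (simp add: P)
  qed
  have "g x = c" for x
  proof (rule antisym; rule field_le_epsilon)
    fix e :: real assume e: "0 < e"
    obtain y where y: "y 0 = x" "\<And>i::nat. y (Suc i) \<in> minimizers u (y i)" using descent[OF u] by blast
    \<comment> \<open>Along a chain calibrated for \<open>u\<close>, domination of \<open>v\<close>
      makes \<open>v - u\<close> nondecreasing backward in time. The second half exchanges the two
      functions.\<close>
    have "g x \<le> g (y i)" for i
    proof (induction i)
      case (Suc i)
      have "u (y (Suc i)) + k (y (Suc i)) (y i) = u (y i)" using y(2)[of i] by (simp add: minimizers_def)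
      moreover have "v (y i) \<le> v (y (Suc i)) + k (y (Suc i)) (y i)" using v by (simp add: weak_kam_def)
      ultimately show ?case using Suc by (simp add: g_def)
    qed (simp add: y)
    moreover obtain i where "\<bar>g (y i) - c\<bar> < e" using approach[of u y, OF u \<xi> y(2) e] by blast
    ultimately show "g x \<le> c + e" by (smt (verit))
  next
    fix e :: real assume e: "0 < e"
    obtain y where y: "y 0 = x" "\<And>i::nat. y (Suc i) \<in> minimizers v (y i)" using descent[OF v] by blast
    have "g (y i) \<le> g x" for i
    proof (induction i)
      case (Suc i)
      have "v (y (Suc i)) + k (y (Suc i)) (y i) = v (y i)" using y(2)[of i] by (simp add: minimizers_def)
      moreover have "u (y i) \<le> u (y (Suc i)) + k (y (Suc i)) (y i)" using u by (simp add: weak_kam_def)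
      ultimately show ?case using Suc by (simp add: g_def)
    qed (simp add: y)
    moreover obtain i where "\<bar>g (y i) - c\<bar> < e" using approach[of v y, OF v \<xi>v y(2) e] by blast
    ultimately show "c \<le> g x + e" by (smt (verit))
  qed
  then show ?thesis unfolding g_def by blast
qed

lemma rotation_limit:
  fixes \<eta> :: "int \<Rightarrow> real"
  assumes w: "\<And>j::int. \<bar>\<eta> j - \<eta> 0 - of_int j * w\<bar> \<le> 4"
  shows "((\<lambda>j. (\<eta> j - \<eta> 0) / of_int j) \<longlongrightarrow> w) at_top" "((\<lambda>j. (\<eta> j - \<eta> 0) / of_int j) \<longlongrightarrow> w) at_bot"
proof -
  have bound: "\<bar>(\<eta> j - \<eta> 0) / of_int j - w\<bar> \<le> 4 / \<bar>of_int j\<bar>" if "j \<noteq> 0" for j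
  proof -
    have "(\<eta> j - \<eta> 0) / of_int j - w = (\<eta> j - \<eta> 0 - of_int j * w) / of_int j" using that by (simp add: diff_divide_distrib)
    then show ?thesis using w[of j] by (simp add: divide_right_mono)
  qed
  have small: "dist ((\<eta> j - \<eta> 0) / of_int j) w < e" if "0 < e" "\<bar>j\<bar> > max 1 \<lceil>4 / e\<rceil>" for j e
  proof -
    have "4 / e < \<bar>of_int j\<bar>" using that(2) by linarith
    moreover have j: "j \<noteq> 0" using that(2) by auto
    ultimately have "4 / \<bar>of_int j\<bar> < e"
      using that(1) by (simp add: pos_divide_less_eq mult.commute)
    then show ?thesis using bound[OF j] by (simp add: dist_real_def)
  qed
  show "((\<lambda>j. (\<eta> j - \<eta> 0) / of_int j) \<longlongrightarrow> w) at_top"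
  proof (rule tendstoI)
    fix e :: real assume "0 < e"
    show "\<forall>\<^sub>F j in at_top. dist ((\<eta> j - \<eta> 0) / of_int j) w < e"
    proof (rule eventually_mono[OF eventually_gt_at_top[of "max 1 \<lceil>4 / e\<rceil>"]])
      fix j assume "max 1 \<lceil>4 / e\<rceil> < j"
      then have "\<bar>j\<bar> > max 1 \<lceil>4 / e\<rceil>" by auto
      with \<open>0 < e\<close> show "dist ((\<eta> j - \<eta> 0) / of_int j) w < e" by (rule small)
    qed
  qed
  show "((\<lambda>j. (\<eta> j - \<eta> 0) / of_int j) \<longlongrightarrow> w) at_bot"
  proof (rule tendstoI)
    fix e :: real assume "0 < e"
    show "\<forall>\<^sub>F j in at_bot. dist ((\<eta> j - \<eta> 0) / of_int j) w < e"
    proof (rule eventually_mono[OF eventually_le_at_bot[of "- max 1 \<lceil>4 / e\<rceil> - 1"]])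
      fix j assume "j \<le> - max 1 \<lceil>4 / e\<rceil> - 1"
      then have "\<bar>j\<bar> > max 1 \<lceil>4 / e\<rceil>" by auto
      with \<open>0 < e\<close> show "dist ((\<eta> j - \<eta> 0) / of_int j) w < e" by (rule small)
    qed
  qed
qed

theorem weak_kam_unique_irrational_rotation:
  assumes u: "weak_kam u" and v: "weak_kam v"
    and irr: "(THE w. \<forall>x\<in>invariant_set u.
        ((\<lambda>j. (full_orbit u x j - full_orbit u x 0) / of_int j) \<longlongrightarrow> w) at_top \<and>
        ((\<lambda>j. (full_orbit u x j - full_orbit u x 0) / of_int j) \<longlongrightarrow> w) at_bot) \<notin> \<rat>" (is "(THE w. ?P w) \<notin> _")
  shows "\<exists>c. \<forall>x. v x - u x = c"
proof -
  obtain x where x: "x \<in> invariant_set u" using invariant_set_nonempty[OF u] by blast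
  note \<xi> = full_orbit_calibrated(1)[OF u]
  obtain w where w: "\<And>\<eta> j. calibrated u \<eta> \<Longrightarrow> \<bar>\<eta> j - \<eta> 0 - of_int j * w\<bar> \<le> 4"
    using calibrated_rotation[OF u \<xi>[OF x]] by blast
  have P: "?P w"
  proof (intro ballI conjI)
    fix z assume z: "z \<in> invariant_set u"
    show "((\<lambda>j. (full_orbit u z j - full_orbit u z 0) / of_int j) \<longlongrightarrow> w) at_top"
      "((\<lambda>j. (full_orbit u z j - full_orbit u z 0) / of_int j) \<longlongrightarrow> w) at_bot"
      by (rule rotation_limit; rule w[OF \<xi>[OF z]])+
  qed
  \<comment> \<open>The description picks a unique value because the invariant set contains at least
    one orbit.\<close>
  have "(THE w. ?P w) = w"
  proof (rule the_equality[of ?P, OF P])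
    fix w' assume "?P w'"
    then have "((\<lambda>j. (full_orbit u x j - full_orbit u x 0) / of_int j) \<longlongrightarrow> w') at_top" using x by blast
    moreover have "((\<lambda>j. (full_orbit u x j - full_orbit u x 0) / of_int j) \<longlongrightarrow> w) at_top" using P x by blast
    ultimately show "w' = w" by (intro tendsto_unique[of "at_top :: int filter"]) auto
  qed
  then have "w \<notin> \<rat>" using irr by simp
  then show ?thesis using weak_kam_unique[OF u v \<xi>[OF x] w] by blast
qed

end

section \<open>Discrete action minimizers\<close>

text \<open>Collects the hypotheses in quantitative form: \<open>B\<close> bounds \<open>U\<close>,
  \<open>K\<close> is its Lipschitz constant in the sum norm, \<open>K2\<close> that of the space
  derivative. \<open>H1_lip\<close> stays local, which is enough once momenta are confined to a
  ball.\<close>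

locale hamiltonian =
  fixes H0 H1 :: "real \<Rightarrow> real" and U Ux :: "real \<Rightarrow> real \<Rightarrow> real" and B K K2 :: real
  assumes H0_deriv: "\<And>p. (H0 has_real_derivative H1 p) (at p)"
    and H1_mono: "strict_mono H1"
    and H1_cont: "continuous_on UNIV H1"
    and H1_lip: "\<And>R. 0 < R \<Longrightarrow> \<exists>c\<ge>0. \<forall>p q. \<bar>p\<bar> \<le> R \<longrightarrow> \<bar>q\<bar> \<le> R \<longrightarrow> \<bar>H1 p - H1 q\<bar> \<le> c * \<bar>p - q\<bar>"
    and H0_growth: "\<And>N. N > 0 \<Longrightarrow> \<exists>P>0. \<forall>p. \<bar>p\<bar> > P \<longrightarrow> H0 p > N * \<bar>p\<bar>"
    and U_bound: "\<And>t x. \<bar>U t x\<bar> \<le> B"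
    and U_lip: "\<And>t x t' x'. \<bar>U t x - U t' x'\<bar> \<le> K * (\<bar>t - t'\<bar> + \<bar>x - x'\<bar>)"
    and U_deriv: "\<And>t x. (U t has_real_derivative Ux t x) (at x)"
    and Ux_lip: "\<And>t x x'. \<bar>Ux t x - Ux t x'\<bar> \<le> K2 * \<bar>x - x'\<bar>"
    and U_periodic: "\<And>t x. U t (x + 1) = U t x"
begin

lemma K_nonneg: "0 \<le> K"
  using order_trans[OF abs_ge_zero U_lip[of 0 0 1 0]] by simp

lemma K2_nonneg: "0 \<le> K2"
  using order_trans[OF abs_ge_zero Ux_lip[of 0 0 1]] by simp

lemma B_nonneg: "0 \<le> B"
  using U_bound[of 0 0] by linarith

lemma Ux_bound: "\<bar>Ux t x\<bar> \<le> K"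
proof -
  have "((\<lambda>h. (U t (x + h) - U t x) / h) \<longlongrightarrow> Ux t x) (at 0)"
    using U_deriv[of t x] by (simp add: DERIV_def)
  then have "((\<lambda>h. \<bar>(U t (x + h) - U t x) / h\<bar>) \<longlongrightarrow> \<bar>Ux t x\<bar>) (at 0)" by (rule tendsto_rabs)
  moreover have "\<forall>\<^sub>F h in at 0. \<bar>(U t (x + h) - U t x) / h\<bar> \<le> K"
  proof (rule eventually_at_topological[THEN iffD2], intro exI[of _ UNIV] conjI ballI impI)
    fix h :: real assume "h \<noteq> 0"
    then show "\<bar>(U t (x + h) - U t x) / h\<bar> \<le> K"
      using U_lip[of t "x + h" t x] by (simp add: divide_le_eq)
  qed auto
  ultimately show ?thesis by (rule tendsto_upperbound) simp
qed

section \<open>Convexity of \<open>H0\<close> and the Legendre transform\<close>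

lemma H1_less: "p < q \<Longrightarrow> H1 p < H1 q"
  using H1_mono by (simp add: strict_mono_def)

lemma H1_le: "p \<le> q \<Longrightarrow> H1 p \<le> H1 q"
  using H1_less[of p q] by (cases "p = q") auto

lemma H0_tangent: "H0 p + H1 p * (q - p) \<le> H0 q"
proof (rule linorder_cases[of p q])
  assume "p < q"
  then obtain z where "p < z" "z < q" "H0 q - H0 p = (q - p) * H1 z"
    using MVT2[of p q H0 H1] H0_deriv by blast
  moreover have "(q - p) * H1 p \<le> (q - p) * H1 z"
    using \<open>p < q\<close> H1_le[of p z] \<open>p < z\<close> by (intro mult_left_mono) auto
  ultimately show ?thesis by (simp add: algebra_simps)
next
  assume "q < p"
  then obtain z where "q < z" "z < p" "H0 p - H0 q = (p - q) * H1 z"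
    using MVT2[of q p H0 H1] H0_deriv by blast
  moreover have "(p - q) * H1 z \<le> (p - q) * H1 p"
    using \<open>q < p\<close> H1_le[of z p] \<open>z < p\<close> by (intro mult_left_mono) auto
  ultimately show ?thesis by (simp add: algebra_simps)
qed simp

text \<open>The tangent at \<open>p\<close> evaluated at 0 bounds \<open>H1 p * p\<close> below by
  \<open>H0 p - H0 0\<close>, which superlinear growth pushes above
  \<open>\<bar>v\<bar> * p\<close>. With \<open>H1_below\<close> this makes \<open>H1\<close>
  surjective.\<close>

lemma H1_above: "\<exists>p. v < H1 p"
proof -
  have "0 < \<bar>v\<bar> + 1" by simp
  from H0_growth[OF this] obtain P where P: "P > 0" "\<And>p. \<bar>p\<bar> > P \<Longrightarrow> H0 p > (\<bar>v\<bar> + 1) * \<bar>p\<bar>" by blast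
  define p where "p = max (P + 1) (\<bar>H0 0\<bar> + 1)"
  have p: "0 < p" "P < p" "\<bar>H0 0\<bar> < p" using P(1) by (auto simp: p_def)
  have "H0 p + H1 p * (0 - p) \<le> H0 0" by (rule H0_tangent)
  moreover have "H0 p > (\<bar>v\<bar> + 1) * p" using P(2)[of p] p by simp
  ultimately have "(\<bar>v\<bar> + 1) * p - p < H1 p * p" using p(3) by (simp add: abs_le_iff)
  then have "\<bar>v\<bar> * p < H1 p * p" by (simp add: algebra_simps)
  then show ?thesis using p(1) by (intro exI[of _ p]) (auto simp: mult_less_cancel_right)
qed

lemma H1_below: "\<exists>p. H1 p < v"
proof -
  have "0 < \<bar>v\<bar> + 1" by simp
  from H0_growth[OF this] obtain P where P: "P > 0" "\<And>p. \<bar>p\<bar> > P \<Longrightarrow> H0 p > (\<bar>v\<bar> + 1) * \<bar>p\<bar>" by blast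
  define p where "p = max (P + 1) (\<bar>H0 0\<bar> + 1)"
  have p: "0 < p" "P < p" "\<bar>H0 0\<bar> < p" using P(1) by (auto simp: p_def)
  have "H0 (- p) + H1 (- p) * (0 - - p) \<le> H0 0" by (rule H0_tangent)
  moreover have "H0 (- p) > (\<bar>v\<bar> + 1) * p" using P(2)[of "- p"] p by simp
  ultimately have "H1 (- p) * p < - (\<bar>v\<bar> * p)" using p(3) by (simp add: algebra_simps abs_le_iff)
  then have "H1 (- p) * p < (- \<bar>v\<bar>) * p" by simp
  then have "H1 (- p) < - \<bar>v\<bar>" using p(1) mult_less_cancel_right_pos by blast
  then show ?thesis by (intro exI[of _ "- p"]) auto
qed

text \<open>Turns out to be the derivative of \<open>L0\<close>, see \<open>L0_deriv\<close>; it
  converts velocities into momenta.\<close>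

definition L1 :: "real \<Rightarrow> real" where "L1 = inv H1"

abbreviation L0 :: "real \<Rightarrow> real" where "L0 \<equiv> legendre H0"

lemma H1_L1 [simp]: "H1 (L1 v) = v"
proof -
  obtain p q where pq: "v < H1 p" "H1 q < v" using H1_above H1_below by blast
  then have "q \<le> p" using H1_le[of p q] by linarith
  then have "\<exists>x\<ge>q. x \<le> p \<and> H1 x = v"
    using pq H1_cont by (intro IVT') (auto intro: continuous_on_subset)
  then show ?thesis unfolding L1_def by (metis f_inv_into_f rangeI)
qed

lemma L1_H1 [simp]: "L1 (H1 p) = p"
  using H1_L1[of "H1 p"] H1_less by (metis linorder_neqE order_less_irrefl)

lemma L1_less: "v < w \<Longrightarrow> L1 v < L1 w"
  using H1_le[of "L1 w" "L1 v"] by (metis H1_L1 not_le)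

lemma L1_le: "v \<le> w \<Longrightarrow> L1 v \<le> L1 w"
  using L1_less[of v w] by (cases "v = w") auto

lemma L1_cont: "continuous_on UNIV L1"
  unfolding continuous_on_iff
proof (intro ballI allI impI)
  fix v e :: real assume e: "0 < e"
  let ?p = "L1 v"
  have "H1 (?p - e) < v" "v < H1 (?p + e)" using H1_less[of "?p - e" ?p] H1_less[of ?p "?p + e"] e by auto
  then have d: "0 < min (v - H1 (?p - e)) (H1 (?p + e) - v)" by simp
  show "\<exists>d>0. \<forall>x'\<in>UNIV. dist x' v < d \<longrightarrow> dist (L1 x') (L1 v) < e"
  proof (intro exI conjI ballI impI, rule d)
    fix w assume "dist w v < min (v - H1 (?p - e)) (H1 (?p + e) - v)"
    then have "H1 (?p - e) < w" "w < H1 (?p + e)" by (auto simp: dist_real_def abs_less_iff)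
    then have "?p - e < L1 w" "L1 w < ?p + e" using L1_less L1_H1 by metis+
    then show "dist (L1 w) (L1 v) < e" by (simp add: dist_real_def abs_less_iff)
  qed
qed

lemma L0_eq: "L0 v = L1 v * v - H0 (L1 v)"
  unfolding legendre_def
proof (rule cSup_eq_maximum)
  fix z assume "z \<in> range (\<lambda>p. p * v - H0 p)"
  then obtain p where "z = p * v - H0 p" by blast
  then show "z \<le> L1 v * v - H0 (L1 v)" using H0_tangent[of "L1 v" p] by (simp add: algebra_simps)
qed auto

lemma young: "p * v - H0 p \<le> L0 v"
  unfolding L0_eq using H0_tangent[of "L1 v" p] by (simp add: algebra_simps)

lemma L0_H1: "L0 (H1 p) = p * H1 p - H0 p"
  by (simp add: L0_eq)

lemma L0_tangent: "L0 v + L1 v * (w - v) \<le> L0 w"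
  using young[of "L1 v" w] L0_eq[of v] by (simp add: algebra_simps)

text \<open>The tangent inequalities at \<open>v\<close> and at \<open>v + h\<close> trap the
  difference quotient between \<open>L1 v\<close> and \<open>L1 (v + h)\<close>, so continuity of
  \<open>L1\<close> is enough.\<close>

lemma L0_deriv: "(L0 has_real_derivative L1 v) (at v)"
proof -
  have "((\<lambda>h. (L0 (v + h) - L0 v) / h) \<longlongrightarrow> L1 v) (at 0)"
  proof (rule tendstoI)
    fix e :: real assume e: "0 < e"
    obtain d where d: "0 < d" "\<And>w. \<bar>w - v\<bar> < d \<Longrightarrow> \<bar>L1 w - L1 v\<bar> < e"
      using L1_cont e unfolding continuous_on_iff dist_real_def by (metis UNIV_I)
    show "\<forall>\<^sub>F h in at 0. dist ((L0 (v + h) - L0 v) / h) (L1 v) < e"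
      unfolding eventually_at
    proof (intro exI[of _ d] conjI ballI impI d(1))
      fix h :: real assume h: "h \<noteq> 0 \<and> dist h 0 < d"
      have "L1 v * h \<le> L0 (v + h) - L0 v" "L0 (v + h) - L0 v \<le> L1 (v + h) * h"
        using L0_tangent[of v "v + h"] L0_tangent[of "v + h" v] by auto
      then have "\<bar>L0 (v + h) - L0 v - L1 v * h\<bar> \<le> \<bar>(L1 (v + h) - L1 v) * h\<bar>" by (simp add: algebra_simps)
      then have "\<bar>L0 (v + h) - L0 v - L1 v * h\<bar> / \<bar>h\<bar> \<le> \<bar>L1 (v + h) - L1 v\<bar>"
        using h by (simp add: abs_mult divide_le_eq)
      moreover have "(L0 (v + h) - L0 v) / h - L1 v = (L0 (v + h) - L0 v - L1 v * h) / h"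
        using h by (simp add: field_simps)
      ultimately show "dist ((L0 (v + h) - L0 v) / h) (L1 v) < e"
        using d(2)[of "v + h"] h by (simp add: dist_real_def)
    qed
  qed
  then show ?thesis by (simp add: DERIV_def)
qed

lemma L0_cont: "continuous_on UNIV L0"
  using L0_deriv by (meson DERIV_isCont continuous_at_imp_continuous_on)

definition LB :: "real \<Rightarrow> real" where "LB N = max (H0 N) (H0 (- N))"

lemma L0_superlinear: "N * \<bar>v\<bar> - LB N \<le> L0 v"
  using young[of N v] young[of "- N" v] by (cases "0 \<le> v") (auto simp: LB_def)

text \<open>Both velocities on the left lie between the two on the right and have the same sum, so
  convexity decides. This is the one-step source of the crossing inequality.\<close>

lemma L0_submodular:
  assumes "b \<le> a" "c \<le> d" "0 \<le> n"
  shows "L0 (n * (d - a)) + L0 (n * (c - b)) \<le> L0 (n * (c - a)) + L0 (n * (d - b))"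
proof -
  define p q r where "p = n * (c - a)" and "q = n * (d - c)" and "r = n * (a - b)"
  have nn: "0 \<le> q" "0 \<le> r" using assms by (auto simp: q_def r_def)
  have eqs: "n * (d - a) = p + q" "n * (c - b) = p + r" "n * (d - b) = p + q + r"
    by (auto simp: p_def q_def r_def algebra_simps)
  have 1: "L0 (p + q) + L1 (p + q) * (- q) \<le> L0 p" using L0_tangent[of "p + q" p] by simp
  have 2: "L0 (p + r) + L1 (p + r) * q \<le> L0 (p + q + r)" using L0_tangent[of "p + r" "p + q + r"] by (simp add: add.commute add.left_commute)
  have 3: "L0 (p + r) + L1 (p + r) * (- r) \<le> L0 p" using L0_tangent[of "p + r" p] by simp
  have 4: "L0 (p + q) + L1 (p + q) * r \<le> L0 (p + q + r)" using L0_tangent[of "p + q" "p + q + r"] by (simp add: add.commute add.left_commute)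
  have "L0 (p + q) + L0 (p + r) \<le> L0 p + L0 (p + q + r)"
  \<comment> \<open>Two tangent lines with increments of equal size are added; comparing
    \<open>q\<close> with \<open>r\<close> tells for which pair the monotonicity of
    \<open>L1\<close> has the right sign.\<close>
  proof (cases "q \<le> r")
    case True
    then have "L1 (p + q) * q \<le> L1 (p + r) * q" using nn L1_le by (intro mult_right_mono) auto
    then show ?thesis using 1 2 by (simp add: algebra_simps)
  next
    case False
    then have "L1 (p + r) * r \<le> L1 (p + q) * r" using nn L1_le by (intro mult_right_mono) auto
    then show ?thesis using 3 4 by (simp add: algebra_simps)
  qed
  then show ?thesis unfolding eqs p_def[symmetric] by simp
qed

section \<open>Discrete action and minimal chains\<close>

definition cost :: "nat \<Rightarrow> (nat \<Rightarrow> real) \<Rightarrow> real" where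
  "cost n z = (\<Sum>j<n. (1 / real n) * (L0 (real n * (z (Suc j) - z j)) - U (real j / real n) (z j)))"

definition minchain :: "nat \<Rightarrow> real \<Rightarrow> real \<Rightarrow> (nat \<Rightarrow> real) \<Rightarrow> bool" where
  "minchain n y x z \<longleftrightarrow> z 0 = y \<and> z n = x \<and> (\<forall>z'. z' 0 = y \<longrightarrow> z' n = x \<longrightarrow> cost n z \<le> cost n z')"

text \<open>Linear growth of \<open>L0\<close> with slope 1. The bound is uniform in
  \<open>n\<close>, which makes all discretization errors of order \<open>1 / n\<close>.\<close>

lemma cost_variation:
  assumes "0 < n"
  shows "(\<Sum>j<n. \<bar>z (Suc j) - z j\<bar>) \<le> cost n z + LB 1 + B"
proof -
  have "\<bar>z (Suc j) - z j\<bar> - (LB 1 + B) / real n \<le> (1 / real n) * (L0 (real n * (z (Suc j) - z j)) - U (real j / real n) (z j))" for j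
  proof -
    have "real n * \<bar>z (Suc j) - z j\<bar> - LB 1 \<le> L0 (real n * (z (Suc j) - z j))"
      using L0_superlinear[of 1 "real n * (z (Suc j) - z j)"] by (simp add: abs_mult)
    moreover have "U (real j / real n) (z j) \<le> B" using U_bound[of "real j / real n" "z j"] by linarith
    ultimately have "real n * \<bar>z (Suc j) - z j\<bar> - (LB 1 + B) \<le> L0 (real n * (z (Suc j) - z j)) - U (real j / real n) (z j)" by linarith
    then have "(1 / real n) * (real n * \<bar>z (Suc j) - z j\<bar> - (LB 1 + B)) \<le> (1 / real n) * (L0 (real n * (z (Suc j) - z j)) - U (real j / real n) (z j))"
      by (rule mult_left_mono) simp
    then show ?thesis using assms by (simp add: right_diff_distrib)
  qed
  then have "(\<Sum>j<n. \<bar>z (Suc j) - z j\<bar> - (LB 1 + B) / real n) \<le> cost n z"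
    unfolding cost_def by (rule sum_mono)
  then show ?thesis using assms by (simp add: sum_subtractf)
qed

lemma cost_lower:
  assumes "0 < n"
  shows "q * (z n - z 0) - H0 q - B \<le> cost n z"
proof -
  have "q * (z (Suc j) - z j) - (H0 q + B) / real n \<le> (1 / real n) * (L0 (real n * (z (Suc j) - z j)) - U (real j / real n) (z j))" for j
  proof -
    have "q * (real n * (z (Suc j) - z j)) - (H0 q + B) \<le> L0 (real n * (z (Suc j) - z j)) - U (real j / real n) (z j)"
      using young[of q "real n * (z (Suc j) - z j)"] U_bound[of "real j / real n" "z j"] by linarith
    then have "(1 / real n) * (q * (real n * (z (Suc j) - z j)) - (H0 q + B)) \<le> (1 / real n) * (L0 (real n * (z (Suc j) - z j)) - U (real j / real n) (z j))"
      by (rule mult_left_mono) simp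
    then show ?thesis using assms by (simp add: right_diff_distrib)
  qed
  then have "(\<Sum>j<n. q * (z (Suc j) - z j) - (H0 q + B) / real n) \<le> cost n z"
    unfolding cost_def by (rule sum_mono)
  moreover have "(\<Sum>j<n. q * (z (Suc j) - z j)) = q * (z n - z 0)"
    unfolding sum_distrib_left[symmetric] by (simp add: sum_lessThan_telescope)
  ultimately show ?thesis using assms by (simp add: sum_subtractf)
qed

lemma abs_diff_le_variation: "j \<le> n \<Longrightarrow> \<bar>z j - z 0\<bar> \<le> (\<Sum>i<n. \<bar>z (Suc i) - z i\<bar> :: real)"
proof -
  assume "j \<le> n"
  have "z j - z 0 = (\<Sum>i<j. z (Suc i) - z i)" by (simp add: sum_lessThan_telescope)
  then have "\<bar>z j - z 0\<bar> \<le> (\<Sum>i<j. \<bar>z (Suc i) - z i\<bar>)" using sum_abs by metis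
  also have "\<dots> \<le> (\<Sum>i<n. \<bar>z (Suc i) - z i\<bar>)" using \<open>j \<le> n\<close> by (intro sum_mono2) auto
  finally show ?thesis .
qed

lemma U_cont: "continuous_on UNIV (U t)"
  using U_deriv by (meson DERIV_isCont continuous_at_imp_continuous_on)

lemma cost_cont: "continuous_on UNIV (cost n)"
  unfolding cost_def[abs_def]
  by (intro continuous_intros continuous_on_compose2[OF L0_cont] continuous_on_compose2[OF U_cont]
      continuous_on_product_coordinates) auto

lemma cost_cong: "(\<And>j. j \<le> n \<Longrightarrow> z j = z' j) \<Longrightarrow> cost n z = cost n z'"
  unfolding cost_def by (intro sum.cong) auto

text \<open>Direct method in the product topology on sequences: bounded cost confines the chain to a
  product of compact sets.\<close>

lemma minchain_exists:
  assumes n: "0 < n"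
  shows "\<exists>z. minchain n y x z"
proof -
  define z0 where "z0 = (\<lambda>j::nat. if j = 0 then y else if j = n then x else 0 :: real)"
  define R where "R = \<bar>cost n z0\<bar> + \<bar>LB 1\<bar> + B"
  \<comment> \<open>Coordinates beyond \<open>n\<close> do not enter \<open>cost\<close>; pinning
    them to 0 makes the infinite product compact.\<close>
  define S where "S j = (if j = 0 then {y} else if j = n then {x} else if j < n then cball y R else {0})" for j
  have "compactin (product_topology (\<lambda>i. euclidean) UNIV) (PiE UNIV S)"
    unfolding compactin_PiE by (intro disjI2 ballI) (auto simp: S_def)
  then have cS: "compact (PiE UNIV S)" unfolding euclidean_product_topology by simp
  have inS: "(\<lambda>j. if j \<le> n then z j else 0) \<in> PiE UNIV S"
    if z: "z 0 = y" "z n = x" "cost n z \<le> cost n z0" for z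
  proof -
    have "\<bar>z j - y\<bar> \<le> R" if "j \<le> n" for j
      using abs_diff_le_variation[OF that, of z] cost_variation[OF n, of z] z by (simp add: R_def)
    then show ?thesis using z(1,2) n by (auto simp: S_def PiE_def extensional_def dist_real_def abs_minus_commute)
  qed
  have z0: "z0 0 = y" "z0 n = x" using n by (auto simp: z0_def)
  have "PiE UNIV S \<noteq> {}" using inS[OF z0 order_refl] by blast
  from continuous_attains_inf[OF cS this continuous_on_subset[OF cost_cont subset_UNIV]]
  obtain z where z: "z \<in> PiE UNIV S" "\<And>z'. z' \<in> PiE UNIV S \<Longrightarrow> cost n z \<le> cost n z'" by metis
  have ends: "z 0 = y" "z n = x"
    using PiE_mem[OF z(1), of 0] PiE_mem[OF z(1), of n] n by (auto simp: S_def)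
  have "cost n z \<le> cost n z'" if z': "z' 0 = y" "z' n = x" for z'
  proof (cases "cost n z' \<le> cost n z0")
    case True
    then show ?thesis using z(2)[OF inS[OF z' True]] cost_cong[of n "\<lambda>j. if j \<le> n then z' j else 0" z'] by simp
  next
    case False
    then show ?thesis using z(2)[OF inS[OF z0 order_refl]] cost_cong[of n "\<lambda>j. if j \<le> n then z0 j else 0" z0] by simp
  qed
  then show ?thesis using ends unfolding minchain_def by blast
qed

definition mcost :: "nat \<Rightarrow> real \<Rightarrow> real \<Rightarrow> real" where
  "mcost n y x = cost n (SOME z. minchain n y x z)"

lemma minchain_cost:
  assumes "minchain n y x z"
  shows "cost n z = mcost n y x"
proof -
  define s where "s = (SOME z. minchain n y x z)"
  have "minchain n y x s" unfolding s_def using someI[of "minchain n y x", OF assms] .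
  then have "cost n z \<le> cost n s" "cost n s \<le> cost n z" using assms unfolding minchain_def by blast+
  then show ?thesis unfolding mcost_def s_def[symmetric] by (rule antisym)
qed

lemma mcost_le:
  assumes "0 < n" "z 0 = y" "z n = x"
  shows "mcost n y x \<le> cost n z"
  using minchain_exists[OF assms(1), of y x] minchain_cost assms(2,3) unfolding minchain_def by metis

text \<open>The Euler--Lagrange equations of \<open>cost\<close> are the symplectic Euler scheme of the Hamiltonian flow.\<close>
definition euler :: "nat \<Rightarrow> (nat \<Rightarrow> real) \<Rightarrow> (nat \<Rightarrow> real) \<Rightarrow> bool" where
  "euler n z P \<longleftrightarrow> (\<forall>j<n. P (Suc j) = P j - (1 / real n) * Ux (real j / real n) (z j) \<and>
                          z (Suc j) = z j + (1 / real n) * H1 (P (Suc j)))"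

text \<open>Moves the single interior point with index \<open>i = Suc j\<close>. Only the two
  adjacent terms of the sum depend on it, and their derivatives must cancel.\<close>

lemma minchain_stationary:
  assumes mc: "minchain n y x z" and j: "Suc j < n"
  shows "L1 (real n * (z (Suc (Suc j)) - z (Suc j))) =
     L1 (real n * (z (Suc j) - z j)) - (1 / real n) * Ux (real (Suc j) / real n) (z (Suc j))"
proof -
  define i where "i = Suc j"
  have n: "0 < real n" using j by simp
  define T where "T l s = (1 / real n) * (L0 (real n * ((z(i := s)) (Suc l) - (z(i := s)) l)) - U (real l / real n) ((z(i := s)) l))" for l s
  define D where "D l = (if l = i then - L1 (real n * (z (Suc i) - z i)) - (1 / real n) * Ux (real i / real n) (z i)
      else if l = j then L1 (real n * (z i - z j)) else 0)" for l
  have T: "((\<lambda>s. T l s) has_real_derivative D l) (at (z i))" for l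
  proof -
    consider "l = i" | "l = j" | "l \<noteq> i" "l \<noteq> j" by blast
    then show ?thesis
    proof cases
      case 1
      have "((\<lambda>s. (1 / real n) * (L0 (real n * (z (Suc i) - s)) - U (real i / real n) s)) has_real_derivative
          (1 / real n) * (L1 (real n * (z (Suc i) - z i)) * (real n * (0 - 1)) - Ux (real i / real n) (z i))) (at (z i))"
        by (intro DERIV_cmult DERIV_diff DERIV_chain2[OF L0_deriv] U_deriv DERIV_const DERIV_ident)
      then show ?thesis using 1 n by (simp add: T_def[abs_def] D_def algebra_simps)
    next
      case 2
      have "((\<lambda>s. (1 / real n) * (L0 (real n * (s - z j)) - U (real j / real n) (z j))) has_real_derivative
          (1 / real n) * (L1 (real n * (z i - z j)) * (real n * (1 - 0)) - 0)) (at (z i))"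
        by (intro DERIV_cmult DERIV_diff DERIV_chain2[OF L0_deriv] U_deriv DERIV_const DERIV_ident)
      then show ?thesis using 2 n by (simp add: T_def[abs_def] D_def i_def)
    next
      case 3
      then have "T l = (\<lambda>s. (1 / real n) * (L0 (real n * (z (Suc l) - z l)) - U (real l / real n) (z l)))"
        by (auto simp: T_def i_def)
      then show ?thesis using 3 by (simp add: D_def)
    qed
  qed
  have cT: "cost n (z(i := s)) = (\<Sum>l<n. T l s)" for s by (simp add: cost_def T_def)
  have "((\<lambda>s. \<Sum>l<n. T l s) has_real_derivative (\<Sum>l<n. D l)) (at (z i))"
    by (rule DERIV_sum) (rule T)
  moreover have "(\<Sum>l<n. T l (z i)) \<le> (\<Sum>l<n. T l s)" for s
  proof -
    have "cost n z \<le> cost n (z(i := s))"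
      using mc j unfolding minchain_def by (simp add: i_def)
    moreover have "cost n z = cost n (z(i := z i))" by simp
    ultimately show ?thesis unfolding cT by simp
  qed
  ultimately have "(\<Sum>l<n. D l) = 0" using DERIV_local_min[of "\<lambda>s. \<Sum>l<n. T l s" _ "z i" 1] by simp
  moreover have "(\<Sum>l<n. D l) = (\<Sum>l\<in>{j, i}. D l)"
    by (rule sum.mono_neutral_right) (use j in \<open>auto simp: D_def i_def\<close>)
  moreover have "i \<noteq> j" by (simp add: i_def)
  ultimately have "D j + D i = 0" by simp
  then show ?thesis using \<open>i \<noteq> j\<close> by (simp add: D_def i_def)
qed

lemma minchain_euler:
  assumes mc: "minchain n y x z"
  shows "\<exists>P. euler n z P"
proof -
  \<comment> \<open>No stationarity condition holds at the endpoint 0, so \<open>P 0\<close> is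
    obtained by running the first momentum equation backward.\<close>
  define P where "P j = (case j of 0 \<Rightarrow> L1 (real n * (z (Suc 0) - z 0)) + (1 / real n) * Ux 0 (z 0)
     | Suc i \<Rightarrow> L1 (real n * (z (Suc i) - z i)))" for j
  have "euler n z P"
    unfolding euler_def
  proof (intro allI impI conjI)
    fix j assume j: "j < n"
    show "z (Suc j) = z j + (1 / real n) * H1 (P (Suc j))" using j by (simp add: P_def)
    show "P (Suc j) = P j - (1 / real n) * Ux (real j / real n) (z j)"
    proof (cases j)
      case 0
      then show ?thesis by (simp add: P_def)
    next
      case (Suc i)
      then show ?thesis using minchain_stationary[OF mc, of i] j by (simp add: P_def)
    qed
  qed
  then show ?thesis by blast
qed

section \<open>Momentum bounds and Gronwall's inequality for the scheme\<close>

lemma euler_momentum_oscillation: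
  assumes e: "euler n z P" and n: "0 < n" and ij: "i \<le> j" "j \<le> n"
  shows "\<bar>P j - P i\<bar> \<le> K"
proof -
  have "\<bar>P j - P i\<bar> \<le> real (j - i) * (K / real n)"
    using ij
  proof (induction j rule: dec_induct)
    case (step m)
    have "P (Suc m) = P m - (1 / real n) * Ux (real m / real n) (z m)" using e step by (auto simp: euler_def)
    then have "\<bar>P (Suc m) - P m\<bar> \<le> K / real n"
      using Ux_bound[of "real m / real n" "z m"] by (simp add: divide_right_mono)
    moreover have "\<bar>P m - P i\<bar> \<le> real (m - i) * (K / real n)" using step by simp
    moreover have "real (Suc m - i) = real (m - i) + 1" using step by (simp add: Suc_diff_le)
    ultimately show ?case by (simp only: ring_distribs)
  qed simp
  also have "\<dots> \<le> real n * (K / real n)" using ij K_nonneg by (intro mult_right_mono) auto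
  finally show ?thesis using n by simp
qed

text \<open>Some step is at most as fast as the mean velocity and some step at least as fast, so the
  momenta reach both sides of \<open>L1 (z n - z 0)\<close>; they oscillate by at most
  \<open>K\<close>.\<close>

lemma euler_momentum_bound:
  assumes e: "euler n z P" and n: "0 < n" and i: "i \<le> n"
  shows "\<bar>P i - L1 (z n - z 0)\<bar> \<le> K"
proof -
  have v: "H1 (P (Suc j)) = real n * (z (Suc j) - z j)" if "j < n" for j
    using e that n by (auto simp: euler_def)
  have tele: "(\<Sum>j<n. real n * (z (Suc j) - z j)) = real n * (z n - z 0)"
    unfolding sum_distrib_left[symmetric] by (simp add: sum_lessThan_telescope)
  have osc: "\<bar>P i - P l\<bar> \<le> K" if "l \<le> n" for l
    using euler_momentum_oscillation[OF e n, of i l] euler_momentum_oscillation[OF e n, of l i] that i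
    by (cases "i \<le> l") (auto simp: abs_minus_commute)
  have "\<exists>j<n. real n * (z (Suc j) - z j) \<le> z n - z 0"
  proof (rule ccontr)
    assume "\<not> ?thesis"
    then have "(\<Sum>j<n. z n - z 0) < (\<Sum>j<n. real n * (z (Suc j) - z j))"
      using n by (intro sum_strict_mono) (auto simp: not_le)
    then show False using tele by simp
  qed
  then obtain j where j: "j < n" "H1 (P (Suc j)) \<le> z n - z 0" using v by metis
  have "P (Suc j) \<le> L1 (z n - z 0)" using L1_le[OF j(2)] by simp
  moreover have "\<exists>j<n. z n - z 0 \<le> real n * (z (Suc j) - z j)"
  proof (rule ccontr)
    assume "\<not> ?thesis"
    then have "(\<Sum>j<n. real n * (z (Suc j) - z j)) < (\<Sum>j<n. z n - z 0)"
      using n by (intro sum_strict_mono) (auto simp: not_le)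
    then show False using tele by simp
  qed
  then obtain l where l: "l < n" "z n - z 0 \<le> H1 (P (Suc l))" using v by metis
  have "L1 (z n - z 0) \<le> P (Suc l)" using L1_le[OF l(2)] by simp
  ultimately show ?thesis using osc[of "Suc j"] osc[of "Suc l"] j(1) l(1) by (simp add: abs_le_iff)
qed

lemma power_growth:
  fixes D :: "nat \<Rightarrow> real"
  assumes n: "0 < n" and C: "0 \<le> C" and nn: "0 \<le> D 0" and step: "\<And>j. j < n \<Longrightarrow> D (Suc j) \<le> (1 + C / real n) * D j"
  shows "D n \<le> exp C * D 0"
proof -
  have "D j \<le> (1 + C / real n) ^ j * D 0" if "j \<le> n" for j
    using that
  proof (induction j)
    case (Suc j)
    have "D (Suc j) \<le> (1 + C / real n) * D j" using step Suc by simp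
    also have "\<dots> \<le> (1 + C / real n) * ((1 + C / real n) ^ j * D 0)"
      using Suc C by (intro mult_left_mono) auto
    finally show ?case by (simp add: mult.assoc)
  qed simp
  then have "D n \<le> (1 + C / real n) ^ n * D 0" by simp
  also have "\<dots> \<le> exp C * D 0"
  proof (rule mult_right_mono[OF _ nn])
    have "- real n \<le> C" using C of_nat_0_le_iff[of n] by linarith
    then show "(1 + C / real n) ^ n \<le> exp C" using n by (intro exp_ge_one_plus_x_over_n_power_n)
  qed
  finally show ?thesis .
qed

text \<open>One step changes the distance by a factor of at most \<open>1 + C / n\<close> in either
  direction: forward, momentum is updated before position, backward in the opposite order. The mixed
  term of order \<open>1 / n^2\<close> is absorbed by the summand \<open>c * K2\<close> of the
  exponent.\<close>

lemma euler_gronwall: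
  assumes e: "euler n z P" "euler n z' P'" and n: "0 < n" and c: "0 \<le> c"
    and bd: "\<And>i. i \<le> n \<Longrightarrow> \<bar>P i\<bar> \<le> R" "\<And>i. i \<le> n \<Longrightarrow> \<bar>P' i\<bar> \<le> R"
    and lip: "\<And>p q. \<bar>p\<bar> \<le> R \<Longrightarrow> \<bar>q\<bar> \<le> R \<Longrightarrow> \<bar>H1 p - H1 q\<bar> \<le> c * \<bar>p - q\<bar>"
  defines "D \<equiv> \<lambda>j. \<bar>z j - z' j\<bar> + \<bar>P j - P' j\<bar>"
  shows "D n \<le> exp (c + K2 + c * K2) * D 0" "D 0 \<le> exp (c + K2 + c * K2) * D n"
proof -
  define C h where "C = c + K2 + c * K2" and "h = 1 / real n"
  have h: "0 \<le> h" "h \<le> 1" using n by (auto simp: h_def)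
  have C: "0 \<le> C" using c K2_nonneg by (simp add: C_def)
  have h2: "h * h * (c * K2) \<le> h * (c * K2)"
    using h c K2_nonneg mult_right_mono[of "h * h" h "c * K2"] mult_left_le[of h h] by (simp add: mult.assoc)
  have hC: "h * c \<le> h * C" "h * K2 \<le> h * C" "h * K2 + h * (c * K2) \<le> h * C" "h * c + h * (c * K2) \<le> h * C"
    using h(1) c K2_nonneg by (auto simp: C_def distrib_left[symmetric] intro!: mult_left_mono)
  have P: "P (Suc j) = P j - h * Ux (real j / real n) (z j)" "P' (Suc j) = P' j - h * Ux (real j / real n) (z' j)"
    and Z: "z (Suc j) = z j + h * H1 (P (Suc j))" "z' (Suc j) = z' j + h * H1 (P' (Suc j))" if "j < n" for j
    using e that by (auto simp: euler_def h_def)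
  have hU: "\<bar>h * Ux (real j / real n) (z j) - h * Ux (real j / real n) (z' j)\<bar> \<le> h * K2 * \<bar>z j - z' j\<bar>" for j
  proof -
    have "\<bar>h * Ux (real j / real n) (z j) - h * Ux (real j / real n) (z' j)\<bar> = h * \<bar>Ux (real j / real n) (z j) - Ux (real j / real n) (z' j)\<bar>"
      using h by (simp add: right_diff_distrib[symmetric] abs_mult)
    also have "\<dots> \<le> h * (K2 * \<bar>z j - z' j\<bar>)" using h Ux_lip by (intro mult_left_mono)
    finally show ?thesis by simp
  qed
  have hH: "\<bar>h * H1 (P j) - h * H1 (P' j)\<bar> \<le> h * c * \<bar>P j - P' j\<bar>" if "j \<le> n" for j
  proof -
    have "\<bar>h * H1 (P j) - h * H1 (P' j)\<bar> = h * \<bar>H1 (P j) - H1 (P' j)\<bar>"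
      using h by (simp add: right_diff_distrib[symmetric] abs_mult)
    also have "\<dots> \<le> h * (c * \<bar>P j - P' j\<bar>)" using h lip bd that by (intro mult_left_mono) auto
    finally show ?thesis by simp
  qed
  have forw: "D (Suc j) \<le> (1 + C / real n) * D j" if j: "j < n" for j
  proof -
    have p: "\<bar>P (Suc j) - P' (Suc j)\<bar> \<le> \<bar>P j - P' j\<bar> + h * K2 * \<bar>z j - z' j\<bar>"
      using hU[of j] unfolding P[OF j] by linarith
    have "\<bar>z (Suc j) - z' (Suc j)\<bar> \<le> \<bar>z j - z' j\<bar> + h * c * \<bar>P (Suc j) - P' (Suc j)\<bar>"
      using hH[of "Suc j"] j unfolding Z[OF j] by linarith
    also have "h * c * \<bar>P (Suc j) - P' (Suc j)\<bar> \<le> h * c * (\<bar>P j - P' j\<bar> + h * K2 * \<bar>z j - z' j\<bar>)"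
      using p h c by (intro mult_left_mono) auto
    also have "\<dots> = h * c * \<bar>P j - P' j\<bar> + (h * h * (c * K2)) * \<bar>z j - z' j\<bar>" by (simp add: algebra_simps)
    also have "(h * h * (c * K2)) * \<bar>z j - z' j\<bar> \<le> (h * (c * K2)) * \<bar>z j - z' j\<bar>"
      by (rule mult_right_mono[OF h2]) simp
    finally have "D (Suc j) \<le> \<bar>z j - z' j\<bar> * (1 + h * K2 + h * (c * K2)) + \<bar>P j - P' j\<bar> * (1 + h * c)"
      using p by (simp add: D_def algebra_simps)
    also have "\<dots> \<le> \<bar>z j - z' j\<bar> * (1 + h * C) + \<bar>P j - P' j\<bar> * (1 + h * C)"
      by (rule add_mono; rule mult_left_mono) (use hC in auto)
    finally show ?thesis by (simp add: D_def h_def algebra_simps)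
  qed
  have backw: "D j \<le> (1 + C / real n) * D (Suc j)" if j: "j < n" for j
  proof -
    have z: "\<bar>z j - z' j\<bar> \<le> \<bar>z (Suc j) - z' (Suc j)\<bar> + h * c * \<bar>P (Suc j) - P' (Suc j)\<bar>"
      using hH[of "Suc j"] j Z[OF j] by linarith
    have "\<bar>P j - P' j\<bar> \<le> \<bar>P (Suc j) - P' (Suc j)\<bar> + h * K2 * \<bar>z j - z' j\<bar>"
      using hU[of j] P[OF j] by linarith
    also have "h * K2 * \<bar>z j - z' j\<bar> \<le> h * K2 * (\<bar>z (Suc j) - z' (Suc j)\<bar> + h * c * \<bar>P (Suc j) - P' (Suc j)\<bar>)"
      using z h K2_nonneg by (intro mult_left_mono) auto
    also have "\<dots> = h * K2 * \<bar>z (Suc j) - z' (Suc j)\<bar> + (h * h * (c * K2)) * \<bar>P (Suc j) - P' (Suc j)\<bar>"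
      by (simp add: algebra_simps)
    also have "(h * h * (c * K2)) * \<bar>P (Suc j) - P' (Suc j)\<bar> \<le> (h * (c * K2)) * \<bar>P (Suc j) - P' (Suc j)\<bar>"
      by (rule mult_right_mono[OF h2]) simp
    finally have "D j \<le> \<bar>z (Suc j) - z' (Suc j)\<bar> * (1 + h * K2) + \<bar>P (Suc j) - P' (Suc j)\<bar> * (1 + h * c + h * (c * K2))"
      using z by (simp add: D_def algebra_simps)
    also have "\<dots> \<le> \<bar>z (Suc j) - z' (Suc j)\<bar> * (1 + h * C) + \<bar>P (Suc j) - P' (Suc j)\<bar> * (1 + h * C)"
      by (rule add_mono; rule mult_left_mono) (use hC in auto)
    finally show ?thesis by (simp add: D_def h_def algebra_simps)
  qed
  have nn: "0 \<le> D j" for j by (simp add: D_def)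
  show "D n \<le> exp (c + K2 + c * K2) * D 0"
    using power_growth[where D = D, OF n C nn forw] by (simp add: C_def)
  have "(\<lambda>i. D (n - i)) n \<le> exp C * (\<lambda>i. D (n - i)) 0"
  proof (rule power_growth[OF n C])
    fix i assume i: "i < n"
    then have "Suc (n - Suc i) = n - i" by simp
    then show "D (n - Suc i) \<le> (1 + C / real n) * D (n - i)" using backw[of "n - Suc i"] i by simp
  qed (use nn in simp)
  then show "D 0 \<le> exp (c + K2 + c * K2) * D n" by (simp add: C_def)
qed

section \<open>First variation of the minimal cost\<close>

lemma U_second_order: "U t x + Ux t x * \<eta> - K2 * \<eta>\<^sup>2 \<le> U t (x + \<eta>)"
proof (rule linorder_cases[of \<eta> 0])
  assume "\<eta> < 0"
  then obtain z where z: "x + \<eta> < z" "z < x" "U t x - U t (x + \<eta>) = (x - (x + \<eta>)) * Ux t z"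
    using MVT2[of "x + \<eta>" x "U t" "Ux t"] U_deriv by auto
  have "\<bar>Ux t z - Ux t x\<bar> \<le> K2 * \<bar>\<eta>\<bar>"
    using z by (intro order_trans[OF Ux_lip] mult_left_mono K2_nonneg) auto
  then have "\<bar>Ux t z - Ux t x\<bar> * \<bar>\<eta>\<bar> \<le> K2 * \<bar>\<eta>\<bar> * \<bar>\<eta>\<bar>" by (rule mult_right_mono) simp
  then have "\<bar>(Ux t z - Ux t x) * \<eta>\<bar> \<le> K2 * \<eta>\<^sup>2" by (simp add: abs_mult power2_eq_square mult.assoc)
  then show ?thesis using z(3) by (simp add: algebra_simps abs_le_iff)
next
  assume "0 < \<eta>"
  then obtain z where z: "x < z" "z < x + \<eta>" "U t (x + \<eta>) - U t x = (x + \<eta> - x) * Ux t z"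
    using MVT2[of x "x + \<eta>" "U t" "Ux t"] U_deriv by auto
  have "\<bar>Ux t z - Ux t x\<bar> \<le> K2 * \<bar>\<eta>\<bar>"
    using z by (intro order_trans[OF Ux_lip] mult_left_mono K2_nonneg) auto
  then have "\<bar>Ux t z - Ux t x\<bar> * \<bar>\<eta>\<bar> \<le> K2 * \<bar>\<eta>\<bar> * \<bar>\<eta>\<bar>" by (rule mult_right_mono) simp
  then have "\<bar>(Ux t z - Ux t x) * \<eta>\<bar> \<le> K2 * \<eta>\<^sup>2" by (simp add: abs_mult power2_eq_square mult.assoc)
  then show ?thesis using z(3) by (simp add: algebra_simps abs_le_iff)
qed simp

text \<open>Adds a linear interpolation from \<open>\<alpha>\<close> to \<open>\<beta>\<close> to
  the chain. By the Euler scheme the first-order terms telescope to the boundary terms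
  \<open>P n * \<beta> - P 0 * \<alpha>\<close>; \<open>w\<close> controls the nonlinearity of
  \<open>L0\<close> and \<open>K2\<close> that of \<open>U\<close>.\<close>

lemma first_variation:
  assumes e: "euler n z P" and n: "0 < n" and bd: "\<And>i. i \<le> n \<Longrightarrow> \<bar>P i\<bar> \<le> R"
    and w: "\<And>q s. \<bar>q\<bar> \<le> R \<Longrightarrow> \<bar>s\<bar> \<le> \<bar>\<beta> - \<alpha>\<bar> \<Longrightarrow> \<bar>L1 (H1 q + s) - q\<bar> \<le> w"
  shows "cost n (\<lambda>j. z j + (\<alpha> + (\<beta> - \<alpha>) * (real j / real n)))
    \<le> cost n z + P n * \<beta> - P 0 * \<alpha> + w * \<bar>\<beta> - \<alpha>\<bar> + K2 * (\<bar>\<alpha>\<bar> + \<bar>\<beta>\<bar>)\<^sup>2"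
proof -
  define \<eta> where "\<eta> j = \<alpha> + (\<beta> - \<alpha>) * (real j / real n)" for j
  define \<delta> h where "\<delta> = \<beta> - \<alpha>" and "h = 1 / real n"
  have h: "0 \<le> h" "h * real n = 1" using n by (auto simp: h_def)
  have step: "real n * (\<eta> (Suc j) - \<eta> j) = \<delta>" for j using n by (simp add: \<eta>_def \<delta>_def field_simps)
  have step': "\<eta> (Suc j) - \<eta> j = h * \<delta>" for j using n by (simp add: \<eta>_def \<delta>_def h_def field_simps)
  have \<eta>b: "\<bar>\<eta> j\<bar> \<le> \<bar>\<alpha>\<bar> + \<bar>\<beta>\<bar>" if "j \<le> n" for j
  proof -
    define r where "r = real j / real n"
    have r: "0 \<le> r" "r \<le> 1" using that n by (auto simp: r_def)
    have "\<eta> j = (1 - r) * \<alpha> + r * \<beta>" by (simp add: \<eta>_def r_def[symmetric] algebra_simps)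
    then have "\<bar>\<eta> j\<bar> \<le> (1 - r) * \<bar>\<alpha>\<bar> + r * \<bar>\<beta>\<bar>" using r by (metis abs_mult abs_of_nonneg abs_triangle_ineq diff_ge_0_iff_ge)
    also have "\<dots> \<le> 1 * \<bar>\<alpha>\<bar> + 1 * \<bar>\<beta>\<bar>" using r by (intro add_mono mult_right_mono) auto
    finally show ?thesis by simp
  qed
  define T where "T z j = (1 / real n) * (L0 (real n * (z (Suc j) - z j)) - U (real j / real n) (z j))" for z j
  have trm: "T (\<lambda>j. z j + \<eta> j) j \<le> T z j + (P (Suc j) * \<eta> (Suc j) - P j * \<eta> j) + h * (w * \<bar>\<delta>\<bar> + K2 * (\<bar>\<alpha>\<bar> + \<bar>\<beta>\<bar>)\<^sup>2)"
    if j: "j < n" for j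
  proof -
    define v where "v = real n * (z (Suc j) - z j)"
    have P: "P (Suc j) = P j - h * Ux (real j / real n) (z j)" and v: "v = H1 (P (Suc j))"
      using e j n by (auto simp: euler_def h_def v_def)
    have "real n * ((z (Suc j) + \<eta> (Suc j)) - (z j + \<eta> j)) = v + \<delta>"
      using step[of j] by (simp add: v_def algebra_simps)
    moreover have "L0 (v + \<delta>) \<le> L0 v + P (Suc j) * \<delta> + w * \<bar>\<delta>\<bar>"
    proof -
      have "L0 (v + \<delta>) \<le> L0 v + L1 (v + \<delta>) * \<delta>" using L0_tangent[of "v + \<delta>" v] by simp
      moreover have "(L1 (v + \<delta>) - P (Suc j)) * \<delta> \<le> w * \<bar>\<delta>\<bar>"
      proof -
        have "(L1 (v + \<delta>) - P (Suc j)) * \<delta> \<le> \<bar>L1 (v + \<delta>) - P (Suc j)\<bar> * \<bar>\<delta>\<bar>" by (metis abs_ge_self abs_mult)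
        also have "\<dots> \<le> w * \<bar>\<delta>\<bar>" using w[of "P (Suc j)" \<delta>] bd[of "Suc j"] j by (intro mult_right_mono) (auto simp: v \<delta>_def)
        finally show ?thesis .
      qed
      ultimately show ?thesis by (simp add: algebra_simps)
    qed
    moreover have "U (real j / real n) (z j) + Ux (real j / real n) (z j) * \<eta> j - K2 * (\<bar>\<alpha>\<bar> + \<bar>\<beta>\<bar>)\<^sup>2 \<le> U (real j / real n) (z j + \<eta> j)"
    proof -
      have "(\<eta> j)\<^sup>2 \<le> (\<bar>\<alpha>\<bar> + \<bar>\<beta>\<bar>)\<^sup>2" using \<eta>b[of j] j by (metis abs_ge_zero less_imp_le power2_abs power_mono)
      then have "K2 * (\<eta> j)\<^sup>2 \<le> K2 * (\<bar>\<alpha>\<bar> + \<bar>\<beta>\<bar>)\<^sup>2" using K2_nonneg by (rule mult_left_mono)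
      then show ?thesis using U_second_order[of "real j / real n" "z j" "\<eta> j"] by linarith
    qed
    ultimately have "T (\<lambda>j. z j + \<eta> j) j \<le> h * ((L0 v + P (Suc j) * \<delta> + w * \<bar>\<delta>\<bar>) - (U (real j / real n) (z j) + Ux (real j / real n) (z j) * \<eta> j - K2 * (\<bar>\<alpha>\<bar> + \<bar>\<beta>\<bar>)\<^sup>2))"
      unfolding T_def h_def[symmetric] using h by (intro mult_left_mono) auto
    also have "\<dots> = T z j + (P (Suc j) * (h * \<delta>) - (h * Ux (real j / real n) (z j)) * \<eta> j) + h * (w * \<bar>\<delta>\<bar> + K2 * (\<bar>\<alpha>\<bar> + \<bar>\<beta>\<bar>)\<^sup>2)"
      by (simp add: T_def v_def h_def[symmetric] algebra_simps)
    also have "P (Suc j) * (h * \<delta>) - (h * Ux (real j / real n) (z j)) * \<eta> j = P (Suc j) * \<eta> (Suc j) - P j * \<eta> j"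
    proof -
      have X: "h * Ux (real j / real n) (z j) = P j - P (Suc j)" using P by simp
      show ?thesis unfolding X step'[of j, symmetric] by (simp add: algebra_simps)
    qed
    finally show ?thesis .
  qed
  have "cost n (\<lambda>j. z j + \<eta> j) = (\<Sum>j<n. T (\<lambda>j. z j + \<eta> j) j)" by (simp add: cost_def T_def)
  also have "\<dots> \<le> (\<Sum>j<n. T z j + (P (Suc j) * \<eta> (Suc j) - P j * \<eta> j) + h * (w * \<bar>\<delta>\<bar> + K2 * (\<bar>\<alpha>\<bar> + \<bar>\<beta>\<bar>)\<^sup>2))"
    using trm by (intro sum_mono) auto
  also have "\<dots> = cost n z + (P n * \<eta> n - P 0 * \<eta> 0) + (h * real n) * (w * \<bar>\<delta>\<bar> + K2 * (\<bar>\<alpha>\<bar> + \<bar>\<beta>\<bar>)\<^sup>2)"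
    using sum_lessThan_telescope[of "\<lambda>j. P j * \<eta> j" n] by (simp add: sum.distrib cost_def T_def)
  also have "\<dots> = cost n z + P n * \<beta> - P 0 * \<alpha> + w * \<bar>\<delta>\<bar> + K2 * (\<bar>\<alpha>\<bar> + \<bar>\<beta>\<bar>)\<^sup>2"
    using n h(2) by (simp add: \<eta>_def)
  finally show ?thesis by (simp add: \<eta>_def \<delta>_def)
qed

lemma L1_modulus:
  assumes "0 < e"
  obtains d where "0 < d" "\<And>q s. \<bar>q\<bar> \<le> R \<Longrightarrow> \<bar>s\<bar> \<le> d \<Longrightarrow> \<bar>L1 (H1 q + s) - q\<bar> \<le> e"
proof -
  have "uniformly_continuous_on {H1 (- R) - 1..H1 R + 1} L1"
    by (intro compact_uniformly_continuous continuous_on_subset[OF L1_cont]) auto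
  then obtain d where d: "0 < d" "\<And>v w. v \<in> {H1 (- R) - 1..H1 R + 1} \<Longrightarrow> w \<in> {H1 (- R) - 1..H1 R + 1} \<Longrightarrow> \<bar>w - v\<bar> < d \<Longrightarrow> \<bar>L1 w - L1 v\<bar> < e"
    using assms unfolding uniformly_continuous_on_def dist_real_def by metis
  show thesis
  proof (rule that[of "min 1 (d / 2)"])
    fix q s :: real assume q: "\<bar>q\<bar> \<le> R" and s: "\<bar>s\<bar> \<le> min 1 (d / 2)"
    have "H1 (- R) \<le> H1 q" "H1 q \<le> H1 R" using q by (auto intro!: H1_le)
    then have "\<bar>L1 (H1 q + s) - L1 (H1 q)\<bar> < e" using s d(1) by (intro d(2)) auto
    then show "\<bar>L1 (H1 q + s) - q\<bar> \<le> e" by simp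
  qed (use d(1) in auto)
qed

text \<open>In effect (\<open>- P 0\<close>, \<open>P n\<close>) is a superdifferential of
  \<open>mcost n\<close> at (\<open>y\<close>, \<open>x\<close>), with an error that is uniform in
  \<open>n\<close>.\<close>

lemma mcost_variation:
  assumes mc: "minchain n y x z" and e: "euler n z P" and n: "0 < n" and bd: "\<And>i. i \<le> n \<Longrightarrow> \<bar>P i\<bar> \<le> R"
    and w: "\<And>q s. \<bar>q\<bar> \<le> R \<Longrightarrow> \<bar>s\<bar> \<le> \<bar>\<beta> - \<alpha>\<bar> \<Longrightarrow> \<bar>L1 (H1 q + s) - q\<bar> \<le> w"
  shows "mcost n (y + \<alpha>) (x + \<beta>) \<le> mcost n y x + P n * \<beta> - P 0 * \<alpha> + w * \<bar>\<beta> - \<alpha>\<bar> + K2 * (\<bar>\<alpha>\<bar> + \<bar>\<beta>\<bar>)\<^sup>2"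
proof -
  have "mcost n (y + \<alpha>) (x + \<beta>) \<le> cost n (\<lambda>j. z j + (\<alpha> + (\<beta> - \<alpha>) * (real j / real n)))"
    using mc n by (intro mcost_le) (auto simp: minchain_def)
  also have "\<dots> \<le> cost n z + P n * \<beta> - P 0 * \<alpha> + w * \<bar>\<beta> - \<alpha>\<bar> + K2 * (\<bar>\<alpha>\<bar> + \<bar>\<beta>\<bar>)\<^sup>2"
    by (rule first_variation[OF e n]) (use bd w in auto)
  finally show ?thesis unfolding minchain_cost[OF mc] .
qed

lemma momentum_uniform_bound:
  obtains R where "0 < R" "\<And>n y x z P i. \<bar>x - y\<bar> \<le> D \<Longrightarrow> minchain n y x z \<Longrightarrow> euler n z P \<Longrightarrow> 0 < n \<Longrightarrow> i \<le> n \<Longrightarrow> \<bar>P i\<bar> \<le> R"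
proof (rule that[of "\<bar>L1 (- D)\<bar> + \<bar>L1 D\<bar> + K + 1"])
  show "0 < \<bar>L1 (- D)\<bar> + \<bar>L1 D\<bar> + K + 1" using K_nonneg by linarith
  fix n y x z P i assume a: "\<bar>x - y\<bar> \<le> D" "minchain n y x z" "euler n z P" "0 < n" "i \<le> n"
  then have "\<bar>P i - L1 (x - y)\<bar> \<le> K" using euler_momentum_bound[OF a(3-5)] by (auto simp: minchain_def)
  moreover have "L1 (- D) \<le> L1 (x - y)" "L1 (x - y) \<le> L1 D" using a(1) by (auto intro!: L1_le)
  ultimately show "\<bar>P i\<bar> \<le> \<bar>L1 (- D)\<bar> + \<bar>L1 D\<bar> + K + 1" by linarith
qed

text \<open>Uniformity of \<open>C\<close> in \<open>n\<close> is the point: it lets the limit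
  inherit continuity.\<close>

lemma mcost_local_lipschitz:
  obtains C where "0 \<le> C" "\<And>n y x \<alpha> \<beta>. 0 < n \<Longrightarrow> \<bar>x - y\<bar> \<le> D \<Longrightarrow> \<bar>\<alpha>\<bar> \<le> 1 \<Longrightarrow> \<bar>\<beta>\<bar> \<le> 1 \<Longrightarrow>
     mcost n (y + \<alpha>) (x + \<beta>) \<le> mcost n y x + C * (\<bar>\<alpha>\<bar> + \<bar>\<beta>\<bar>)"
proof -
  obtain R where R: "0 < R" "\<And>n y x z P i. \<bar>x - y\<bar> \<le> D \<Longrightarrow> minchain n y x z \<Longrightarrow> euler n z P \<Longrightarrow> 0 < n \<Longrightarrow> i \<le> n \<Longrightarrow> \<bar>P i\<bar> \<le> R"
    using momentum_uniform_bound[of D] by blast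
  \<comment> \<open>A crude bound in place of a modulus: shifts up to 1 at both ends change the
    velocity by at most 2.\<close>
  define w where "w = \<bar>L1 (H1 (- R) - 2)\<bar> + \<bar>L1 (H1 R + 2)\<bar> + R"
  have w0: "0 \<le> w" using R(1) by (simp add: w_def)
  have w: "\<bar>L1 (H1 q + s) - q\<bar> \<le> w" if "\<bar>q\<bar> \<le> R" "\<bar>s\<bar> \<le> 2" for q s
  proof -
    have "H1 (- R) \<le> H1 q" "H1 q \<le> H1 R" using that by (auto intro!: H1_le)
    then have "L1 (H1 (- R) - 2) \<le> L1 (H1 q + s)" "L1 (H1 q + s) \<le> L1 (H1 R + 2)" using that by (auto intro!: L1_le)
    then show ?thesis using that unfolding w_def by linarith
  qed
  show thesis
  proof (rule that[of "R + w + 2 * K2"])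
    show "0 \<le> R + w + 2 * K2" using R(1) w0 K2_nonneg by simp
    fix n :: nat and y x \<alpha> \<beta> :: real
    assume a: "0 < n" "\<bar>x - y\<bar> \<le> D" "\<bar>\<alpha>\<bar> \<le> 1" "\<bar>\<beta>\<bar> \<le> 1"
    obtain z P where z: "minchain n y x z" "euler n z P" using minchain_exists[OF a(1)] minchain_euler by metis
    have "mcost n (y + \<alpha>) (x + \<beta>) \<le> mcost n y x + P n * \<beta> - P 0 * \<alpha> + w * \<bar>\<beta> - \<alpha>\<bar> + K2 * (\<bar>\<alpha>\<bar> + \<bar>\<beta>\<bar>)\<^sup>2"
      by (rule mcost_variation[OF z a(1) R(2)[OF a(2) z a(1)]]) (use w a in auto)
    moreover have "P n * \<beta> \<le> R * \<bar>\<beta>\<bar>"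
    proof -
      have "P n * \<beta> \<le> \<bar>P n\<bar> * \<bar>\<beta>\<bar>" by (metis abs_ge_self abs_mult)
      also have "\<dots> \<le> R * \<bar>\<beta>\<bar>" using R(2)[OF a(2) z a(1), of n] by (intro mult_right_mono) auto
      finally show ?thesis .
    qed
    moreover have "- P 0 * \<alpha> \<le> R * \<bar>\<alpha>\<bar>"
    proof -
      have "- P 0 * \<alpha> \<le> \<bar>P 0\<bar> * \<bar>\<alpha>\<bar>" by (metis abs_ge_minus_self abs_mult mult_minus_left)
      also have "\<dots> \<le> R * \<bar>\<alpha>\<bar>" using R(2)[OF a(2) z a(1), of 0] by (intro mult_right_mono) auto
      finally show ?thesis .
    qed
    moreover have "w * \<bar>\<beta> - \<alpha>\<bar> \<le> w * (\<bar>\<alpha>\<bar> + \<bar>\<beta>\<bar>)" using w0 by (intro mult_left_mono) auto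
    moreover have "K2 * (\<bar>\<alpha>\<bar> + \<bar>\<beta>\<bar>)\<^sup>2 \<le> K2 * (2 * (\<bar>\<alpha>\<bar> + \<bar>\<beta>\<bar>))"
      unfolding power2_eq_square using a K2_nonneg by (intro mult_left_mono mult_right_mono) auto
    ultimately show "mcost n (y + \<alpha>) (x + \<beta>) \<le> mcost n y x + (R + w + 2 * K2) * (\<bar>\<alpha>\<bar> + \<bar>\<beta>\<bar>)"
      by (simp add: algebra_simps)
  qed
qed

section \<open>Periodicity, crossing and lower bound of the minimal cost\<close>

lemma mcost_shift:
  assumes "0 < n"
  shows "mcost n (y + 1) (x + 1) = mcost n y x"
proof -
  obtain z where z: "minchain n y x z" using minchain_exists[OF assms] by blast
  obtain z' where z': "minchain n (y + 1) (x + 1) z'" using minchain_exists[OF assms] by blast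
  have Um: "U t (s - 1) = U t s" for t s using U_periodic[of t "s - 1"] by simp
  have "mcost n (y + 1) (x + 1) \<le> cost n (\<lambda>j. z j + 1)" using z assms by (intro mcost_le) (auto simp: minchain_def)
  also have "\<dots> = mcost n y x" using minchain_cost[OF z] by (simp add: cost_def U_periodic)
  finally have 1: "mcost n (y + 1) (x + 1) \<le> mcost n y x" .
  have "mcost n y x \<le> cost n (\<lambda>j. z' j - 1)" using z' assms by (intro mcost_le) (auto simp: minchain_def)
  also have "\<dots> = mcost n (y + 1) (x + 1)" using minchain_cost[OF z'] by (simp add: cost_def Um)
  finally show ?thesis using 1 by simp
qed

text \<open>The pointwise maximum and minimum of the two minimal chains join the swapped endpoints.
  Their potential terms are a permutation of the original ones, and \<open>L0_submodular\<close>
  handles the steps on which the chains cross.\<close>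

lemma mcost_cross:
  assumes n: "0 < n" and yx: "y2 \<le> y1" "x1 \<le> x2"
  shows "mcost n y1 x2 + mcost n y2 x1 \<le> mcost n y1 x1 + mcost n y2 x2"
proof -
  obtain z1 where z1: "minchain n y1 x1 z1" using minchain_exists[OF n] by blast
  obtain z2 where z2: "minchain n y2 x2 z2" using minchain_exists[OF n] by blast
  let ?a = "\<lambda>j. max (z1 j) (z2 j)" and ?b = "\<lambda>j. min (z1 j) (z2 j)"
  define T where "T z j = (1 / real n) * (L0 (real n * (z (Suc j) - z j)) - U (real j / real n) (z j))" for z j
  have trm: "T ?a j + T ?b j \<le> T z1 j + T z2 j" for j
  proof -
    have "L0 (real n * (?a (Suc j) - ?a j)) + L0 (real n * (?b (Suc j) - ?b j)) \<le>
        L0 (real n * (z1 (Suc j) - z1 j)) + L0 (real n * (z2 (Suc j) - z2 j))"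
      using L0_submodular[of "z2 j" "z1 j" "z1 (Suc j)" "z2 (Suc j)" "real n"]
        L0_submodular[of "z1 j" "z2 j" "z2 (Suc j)" "z1 (Suc j)" "real n"]
      by (cases "z1 j \<le> z2 j"; cases "z1 (Suc j) \<le> z2 (Suc j)") (auto simp: max_def min_def)
    moreover have "U (real j / real n) (?a j) + U (real j / real n) (?b j) = U (real j / real n) (z1 j) + U (real j / real n) (z2 j)"
      by (auto simp: max_def min_def)
    ultimately have "(L0 (real n * (?a (Suc j) - ?a j)) - U (real j / real n) (?a j)) + (L0 (real n * (?b (Suc j) - ?b j)) - U (real j / real n) (?b j))
      \<le> (L0 (real n * (z1 (Suc j) - z1 j)) - U (real j / real n) (z1 j)) + (L0 (real n * (z2 (Suc j) - z2 j)) - U (real j / real n) (z2 j))" by linarith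
    then show ?thesis unfolding T_def distrib_left[symmetric] by (intro mult_left_mono) auto
  qed
  have "mcost n y1 x2 \<le> cost n ?a" "mcost n y2 x1 \<le> cost n ?b"
    using z1 z2 yx n by (auto intro!: mcost_le simp: minchain_def)
  moreover have "cost n ?a + cost n ?b \<le> cost n z1 + cost n z2"
    using sum_mono[of "{..<n}" "\<lambda>j. T ?a j + T ?b j" "\<lambda>j. T z1 j + T z2 j"] trm
    by (simp add: cost_def T_def sum.distrib)
  ultimately show ?thesis using minchain_cost[OF z1] minchain_cost[OF z2] by linarith
qed

lemma mcost_lower: "0 < n \<Longrightarrow> q * (x - y) - H0 q - B \<le> mcost n y x"
  using minchain_exists[of n y x] minchain_cost cost_lower[of n q] unfolding minchain_def by metis

end

text \<open>\<open>\<Lambda>\<close> is later instantiated by the unit-time minimal action, with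
  \<open>mcost_limit\<close> as the assumption. What follows uses convergence alone.\<close>

locale limit_action = hamiltonian +
  fixes \<Lambda> :: "real \<Rightarrow> real \<Rightarrow> real"
  assumes mcost_lim: "\<And>y x. (\<lambda>n. mcost n y x) \<longlonglongrightarrow> \<Lambda> y x"
begin

section \<open>The limit action is a twist kernel\<close>

lemma \<Lambda>_shift: "\<Lambda> (y + 1) (x + 1) = \<Lambda> y x"
proof (rule LIMSEQ_unique[OF mcost_lim])
  show "(\<lambda>n. mcost n (y + 1) (x + 1)) \<longlonglongrightarrow> \<Lambda> y x"
  proof (rule Lim_transform_eventually[OF mcost_lim])
    show "\<forall>\<^sub>F n in sequentially. mcost n y x = mcost n (y + 1) (x + 1)"
      using eventually_gt_at_top[of 0] by eventually_elim (simp add: mcost_shift)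
  qed
qed

lemma \<Lambda>_cross:
  assumes "y2 \<le> y1" "x1 \<le> x2"
  shows "\<Lambda> y1 x2 + \<Lambda> y2 x1 \<le> \<Lambda> y1 x1 + \<Lambda> y2 x2"
  by (rule LIMSEQ_le[OF tendsto_add[OF mcost_lim mcost_lim] tendsto_add[OF mcost_lim mcost_lim]])
    (use mcost_cross[OF _ assms] in \<open>auto intro!: exI[of _ 1]\<close>)

lemma \<Lambda>_lower: "q * (x - y) - H0 q - B \<le> \<Lambda> y x"
  by (rule LIMSEQ_le_const[OF mcost_lim]) (use mcost_lower in \<open>auto intro!: exI[of _ 1]\<close>)

lemma \<Lambda>_local_lipschitz:
  obtains C where "0 \<le> C" "\<And>y x \<alpha> \<beta>. \<bar>x - y\<bar> \<le> D \<Longrightarrow> \<bar>\<alpha>\<bar> \<le> 1 \<Longrightarrow> \<bar>\<beta>\<bar> \<le> 1 \<Longrightarrow>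
     \<Lambda> (y + \<alpha>) (x + \<beta>) \<le> \<Lambda> y x + C * (\<bar>\<alpha>\<bar> + \<bar>\<beta>\<bar>)"
proof -
  obtain C where C: "0 \<le> C" "\<And>n y x \<alpha> \<beta>. 0 < n \<Longrightarrow> \<bar>x - y\<bar> \<le> D \<Longrightarrow> \<bar>\<alpha>\<bar> \<le> 1 \<Longrightarrow> \<bar>\<beta>\<bar> \<le> 1 \<Longrightarrow>
     mcost n (y + \<alpha>) (x + \<beta>) \<le> mcost n y x + C * (\<bar>\<alpha>\<bar> + \<bar>\<beta>\<bar>)" using mcost_local_lipschitz[of D] by blast
  show thesis
  proof (rule that[OF C(1)])
    fix y x \<alpha> \<beta> :: real assume a: "\<bar>x - y\<bar> \<le> D" "\<bar>\<alpha>\<bar> \<le> 1" "\<bar>\<beta>\<bar> \<le> 1"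
    show "\<Lambda> (y + \<alpha>) (x + \<beta>) \<le> \<Lambda> y x + C * (\<bar>\<alpha>\<bar> + \<bar>\<beta>\<bar>)"
      by (rule LIMSEQ_le[OF mcost_lim tendsto_add[OF mcost_lim tendsto_const]])
        (use C(2)[OF _ a] in \<open>auto intro!: exI[of _ 1]\<close>)
  qed
qed

lemma \<Lambda>_cont: "continuous_on UNIV (\<lambda>(y, x). \<Lambda> y x)"
  unfolding continuous_on_iff
proof (intro ballI allI impI)
  fix z :: "real \<times> real" and e :: real assume e: "0 < e"
  obtain y x where z: "z = (y, x)" by (cases z)
  obtain C where C: "0 \<le> C" "\<And>y' x' \<alpha> \<beta>. \<bar>x' - y'\<bar> \<le> \<bar>x - y\<bar> + 2 \<Longrightarrow> \<bar>\<alpha>\<bar> \<le> 1 \<Longrightarrow> \<bar>\<beta>\<bar> \<le> 1 \<Longrightarrow>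
     \<Lambda> (y' + \<alpha>) (x' + \<beta>) \<le> \<Lambda> y' x' + C * (\<bar>\<alpha>\<bar> + \<bar>\<beta>\<bar>)" using \<Lambda>_local_lipschitz[of "\<bar>x - y\<bar> + 2"] by blast
  define d where "d = min 1 (e / (2 * C + 1))"
  have "0 < d" "d \<le> 1" "d \<le> e / (2 * C + 1)" using e C(1) by (auto simp: d_def)
  then have d: "0 < d" "d \<le> 1" "(2 * C + 1) * d \<le> e" using C(1) by (auto simp: pos_le_divide_eq mult.commute)
  show "\<exists>d>0. \<forall>w\<in>UNIV. dist w z < d \<longrightarrow> dist (case w of (y, x) \<Rightarrow> \<Lambda> y x) (case z of (y, x) \<Rightarrow> \<Lambda> y x) < e"
  proof (intro exI[of _ d] conjI ballI impI d(1))
    fix w :: "real \<times> real" assume w: "dist w z < d"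
    obtain y' x' where w': "w = (y', x')" by (cases w)
    have "dist y' y \<le> dist w z" "dist x' x \<le> dist w z"
      unfolding w' z using dist_fst_le[of "(y', x')" "(y, x)"] dist_snd_le[of "(y', x')" "(y, x)"] by auto
    then have b: "\<bar>y' - y\<bar> < d" "\<bar>x' - x\<bar> < d" using w by (auto simp: dist_real_def)
    have "\<Lambda> (y + (y' - y)) (x + (x' - x)) \<le> \<Lambda> y x + C * (\<bar>y' - y\<bar> + \<bar>x' - x\<bar>)" using b d(2) by (intro C(2)) auto
    moreover have "\<Lambda> (y' + (y - y')) (x' + (x - x')) \<le> \<Lambda> y' x' + C * (\<bar>y - y'\<bar> + \<bar>x - x'\<bar>)" using b d(2) by (intro C(2)) auto
    moreover have "C * (\<bar>y' - y\<bar> + \<bar>x' - x\<bar>) \<le> C * (2 * d)" using b C(1) by (intro mult_left_mono) auto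
    ultimately have "\<bar>\<Lambda> y' x' - \<Lambda> y x\<bar> \<le> C * (2 * d)" by (simp add: abs_le_iff abs_minus_commute)
    also have "\<dots> < e" using d by (simp add: algebra_simps)
    finally show "dist (case w of (y, x) \<Rightarrow> \<Lambda> y x) (case z of (y, x) \<Rightarrow> \<Lambda> y x) < e" by (simp add: w' z dist_real_def)
  qed
qed

text \<open>At an optimal intermediate point the momenta of the incoming and the outgoing minimizers agree
  in the limit, since otherwise moving that point would lower the action.\<close>
lemma momenta_match:
  assumes opt: "\<And>z. \<Lambda> y x + \<Lambda> x x' \<le> \<Lambda> y z + \<Lambda> z x'" and e: "0 < e"
  shows "\<forall>\<^sub>F n in sequentially. \<forall>z P w Q. minchain n y x z \<longrightarrow> euler n z P \<longrightarrow> minchain n x x' w \<longrightarrow> euler n w Q \<longrightarrow> \<bar>P n - Q 0\<bar> \<le> e"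
proof -
  obtain R where R: "0 < R" "\<And>n y' x'' z P i. \<bar>x'' - y'\<bar> \<le> max \<bar>x - y\<bar> \<bar>x' - x\<bar> \<Longrightarrow> minchain n y' x'' z \<Longrightarrow> euler n z P \<Longrightarrow> 0 < n \<Longrightarrow> i \<le> n \<Longrightarrow> \<bar>P i\<bar> \<le> R"
    using momentum_uniform_bound[of "max \<bar>x - y\<bar> \<bar>x' - x\<bar>"] by blast
  obtain d0 where d0: "0 < d0" "\<And>q s. \<bar>q\<bar> \<le> R \<Longrightarrow> \<bar>s\<bar> \<le> d0 \<Longrightarrow> \<bar>L1 (H1 q + s) - q\<bar> \<le> e / 6"
    using L1_modulus[of "e / 6" R] e by auto
  \<comment> \<open>The error budget is \<open>e / 6\<close> for convergence of the costs,
    \<open>e / 3\<close> for the two moduli of \<open>L1\<close>, and \<open>e / 2\<close> for the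
    two quadratic terms, which is why \<open>K2 * d \<le> e / 4\<close> is wanted.\<close>
  define d where "d = min d0 (e / (4 * (K2 + 1)))"
  have d: "0 < d" "d \<le> d0" "K2 * d \<le> e / 4"
  proof -
    show "0 < d" "d \<le> d0" using d0 e K2_nonneg by (auto simp: d_def)
    have "K2 * d \<le> K2 * (e / (4 * (K2 + 1)))" using K2_nonneg by (intro mult_left_mono) (auto simp: d_def)
    also have "\<dots> \<le> e / 4" using K2_nonneg e by (simp add: field_simps)
    finally show "K2 * d \<le> e / 4" .
  qed
  \<comment> \<open>The change of the two-step cost when the midpoint moves by
    \<open>\<delta>\<close>. Its limit is nonnegative by optimality; testing with both signs of
    \<open>\<delta>\<close> bounds the momentum jump from both sides.\<close>
  define G where "G n \<delta> = mcost n y (x + \<delta>) + mcost n (x + \<delta>) x' - (mcost n y x + mcost n x x')" for n \<delta>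
  have ev: "\<forall>\<^sub>F n in sequentially. - (e / 6 * d) < G n \<delta>" for \<delta>
  proof -
    have "(\<lambda>n. G n \<delta>) \<longlonglongrightarrow> \<Lambda> y (x + \<delta>) + \<Lambda> (x + \<delta>) x' - (\<Lambda> y x + \<Lambda> x x')"
      unfolding G_def by (intro tendsto_intros mcost_lim)
    moreover have "- (e / 6 * d) < \<Lambda> y (x + \<delta>) + \<Lambda> (x + \<delta>) x' - (\<Lambda> y x + \<Lambda> x x')"
      using opt[of "x + \<delta>"] mult_pos_pos[OF e d(1)] by simp
    ultimately show ?thesis by (rule order_tendstoD(1))
  qed
  show ?thesis
    using ev[of d] ev[of "- d"] eventually_gt_at_top[of 0]
  proof eventually_elim
    case (elim n)
    show ?case
    proof (intro allI impI)
      fix z P w Q assume a: "minchain n y x z" "euler n z P" "minchain n x x' w" "euler n w Q"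
      have bP: "\<bar>P i\<bar> \<le> R" if "i \<le> n" for i by (rule R(2)[OF _ a(1,2) elim(3) that]) simp
      have bQ: "\<bar>Q i\<bar> \<le> R" if "i \<le> n" for i by (rule R(2)[OF _ a(3,4) elim(3) that]) simp
      have G: "G n \<delta> \<le> (P n - Q 0) * \<delta> + (e / 3 * d + 2 * (K2 * d) * d)" if \<delta>: "\<bar>\<delta>\<bar> = d" for \<delta>
      proof -
        have "mcost n (y + 0) (x + \<delta>) \<le> mcost n y x + P n * \<delta> - P 0 * 0 + e / 6 * \<bar>\<delta> - 0\<bar> + K2 * (\<bar>0\<bar> + \<bar>\<delta>\<bar>)\<^sup>2"
          by (rule mcost_variation[OF a(1,2) elim(3) bP]) (use d0(2) d(2) \<delta> in auto)
        moreover have "mcost n (x + \<delta>) (x' + 0) \<le> mcost n x x' + Q n * 0 - Q 0 * \<delta> + e / 6 * \<bar>0 - \<delta>\<bar> + K2 * (\<bar>\<delta>\<bar> + \<bar>0\<bar>)\<^sup>2"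
          by (rule mcost_variation[OF a(3,4) elim(3) bQ]) (use d0(2) d(2) \<delta> in auto)
        ultimately show ?thesis using \<delta> by (simp add: G_def algebra_simps power2_eq_square)
      qed
      have k: "K2 * d * d \<le> e / 4 * d" using d by (intro mult_right_mono) auto
      have G1: "G n d \<le> (P n - Q 0) * d + (e / 3 * d + 2 * (K2 * d) * d)" by (rule G) (use d in simp)
      have G2: "G n (- d) \<le> (P n - Q 0) * (- d) + (e / 3 * d + 2 * (K2 * d) * d)" by (rule G) (use d in simp)
      have "- (P n - Q 0) * d \<le> e * d" using G1 elim(1) k by (simp add: algebra_simps)
      moreover have "(P n - Q 0) * d \<le> e * d" using G2 elim(2) k by (simp add: algebra_simps)
      ultimately have "- (P n - Q 0) \<le> e" "P n - Q 0 \<le> e" using d(1) by (simp_all only: mult_le_cancel_right_pos)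
      then show "\<bar>P n - Q 0\<bar> \<le> e" by linarith
    qed
  qed
qed

text \<open>Both incoming chains end at \<open>x\<close> with momenta within \<open>e\<close> of the
  initial momentum of one outgoing chain, so within \<open>2 * e\<close> of each other. Backward
  Gronwall then bounds \<open>\<bar>y1 - y2\<bar>\<close> by a fixed multiple of
  \<open>e\<close>.\<close>

lemma \<Lambda>_back:
  assumes opt1: "\<And>z. \<Lambda> y1 x + \<Lambda> x x' \<le> \<Lambda> y1 z + \<Lambda> z x'" and opt2: "\<And>z. \<Lambda> y2 x + \<Lambda> x x' \<le> \<Lambda> y2 z + \<Lambda> z x'"
  shows "y1 = y2"
proof -
  obtain R where R: "0 < R" "\<And>n y' x'' z P i. \<bar>x'' - y'\<bar> \<le> max \<bar>x - y1\<bar> \<bar>x - y2\<bar> \<Longrightarrow> minchain n y' x'' z \<Longrightarrow> euler n z P \<Longrightarrow> 0 < n \<Longrightarrow> i \<le> n \<Longrightarrow> \<bar>P i\<bar> \<le> R"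
    using momentum_uniform_bound[of "max \<bar>x - y1\<bar> \<bar>x - y2\<bar>"] by blast
  obtain c where c: "0 \<le> c" "\<And>p q. \<bar>p\<bar> \<le> R \<Longrightarrow> \<bar>q\<bar> \<le> R \<Longrightarrow> \<bar>H1 p - H1 q\<bar> \<le> c * \<bar>p - q\<bar>"
    using H1_lip[OF R(1)] by blast
  have "\<bar>y1 - y2\<bar> \<le> exp (c + K2 + c * K2) * (2 * e)" if e: "0 < e" for e
  proof -
    obtain n where n: "0 < n"
      "\<And>z P w Q. minchain n y1 x z \<Longrightarrow> euler n z P \<Longrightarrow> minchain n x x' w \<Longrightarrow> euler n w Q \<Longrightarrow> \<bar>P n - Q 0\<bar> \<le> e"
      "\<And>z P w Q. minchain n y2 x z \<Longrightarrow> euler n z P \<Longrightarrow> minchain n x x' w \<Longrightarrow> euler n w Q \<Longrightarrow> \<bar>P n - Q 0\<bar> \<le> e"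
      using eventually_happens[OF eventually_conj[OF eventually_gt_at_top[of 0]
          eventually_conj[OF momenta_match[OF opt1 e] momenta_match[OF opt2 e]]]] by auto
    obtain z1 P1 where 1: "minchain n y1 x z1" "euler n z1 P1" using minchain_exists[OF n(1)] minchain_euler by metis
    obtain z2 P2 where 2: "minchain n y2 x z2" "euler n z2 P2" using minchain_exists[OF n(1)] minchain_euler by metis
    obtain w Q where w: "minchain n x x' w" "euler n w Q" using minchain_exists[OF n(1)] minchain_euler by metis
    have "\<bar>P1 i\<bar> \<le> R" "\<bar>P2 i\<bar> \<le> R" if "i \<le> n" for i
      using R(2)[OF _ 1 n(1) that] R(2)[OF _ 2 n(1) that] by auto
    from euler_gronwall(2)[OF 1(2) 2(2) n(1) c(1) this c(2)]
    have "\<bar>y1 - y2\<bar> + \<bar>P1 0 - P2 0\<bar> \<le> exp (c + K2 + c * K2) * \<bar>P1 n - P2 n\<bar>" using 1(1) 2(1) by (simp add: minchain_def)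
    also have "\<dots> \<le> exp (c + K2 + c * K2) * (2 * e)"
      using n(2)[OF 1 w] n(3)[OF 2 w] by (intro mult_left_mono) (auto simp: abs_le_iff)
    finally show ?thesis by linarith
  qed
  note bd = this
  show ?thesis
  proof (rule ccontr)
    assume "y1 \<noteq> y2"
    define E where "E = exp (c + K2 + c * K2)"
    have "0 < E" by (simp add: E_def)
    then have "0 < \<bar>y1 - y2\<bar> / (4 * E)" using \<open>y1 \<noteq> y2\<close> by simp
    from bd[OF this] have "\<bar>y1 - y2\<bar> \<le> E * (2 * (\<bar>y1 - y2\<bar> / (4 * E)))" unfolding E_def .
    also have "\<dots> = \<bar>y1 - y2\<bar> / 2" using \<open>0 < E\<close> by simp
    finally show False using \<open>y1 \<noteq> y2\<close> by simp
  qed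
qed

text \<open>Time-reversed counterpart of \<open>\<Lambda>_back\<close>: one incoming chain, two
  outgoing ones, forward Gronwall.\<close>

lemma \<Lambda>_forw:
  assumes opt1: "\<And>z. \<Lambda> y x + \<Lambda> x x1 \<le> \<Lambda> y z + \<Lambda> z x1" and opt2: "\<And>z. \<Lambda> y x + \<Lambda> x x2 \<le> \<Lambda> y z + \<Lambda> z x2"
  shows "x1 = x2"
proof -
  obtain R where R: "0 < R" "\<And>n y' x'' z P i. \<bar>x'' - y'\<bar> \<le> max \<bar>x1 - x\<bar> \<bar>x2 - x\<bar> \<Longrightarrow> minchain n y' x'' z \<Longrightarrow> euler n z P \<Longrightarrow> 0 < n \<Longrightarrow> i \<le> n \<Longrightarrow> \<bar>P i\<bar> \<le> R"
    using momentum_uniform_bound[of "max \<bar>x1 - x\<bar> \<bar>x2 - x\<bar>"] by blast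
  obtain c where c: "0 \<le> c" "\<And>p q. \<bar>p\<bar> \<le> R \<Longrightarrow> \<bar>q\<bar> \<le> R \<Longrightarrow> \<bar>H1 p - H1 q\<bar> \<le> c * \<bar>p - q\<bar>"
    using H1_lip[OF R(1)] by blast
  have "\<bar>x1 - x2\<bar> \<le> exp (c + K2 + c * K2) * (2 * e)" if e: "0 < e" for e
  proof -
    obtain n where n: "0 < n"
      "\<And>z P w Q. minchain n y x z \<Longrightarrow> euler n z P \<Longrightarrow> minchain n x x1 w \<Longrightarrow> euler n w Q \<Longrightarrow> \<bar>P n - Q 0\<bar> \<le> e"
      "\<And>z P w Q. minchain n y x z \<Longrightarrow> euler n z P \<Longrightarrow> minchain n x x2 w \<Longrightarrow> euler n w Q \<Longrightarrow> \<bar>P n - Q 0\<bar> \<le> e"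
      using eventually_happens[OF eventually_conj[OF eventually_gt_at_top[of 0]
          eventually_conj[OF momenta_match[OF opt1 e] momenta_match[OF opt2 e]]]] by auto
    obtain z1 P1 where 1: "minchain n x x1 z1" "euler n z1 P1" using minchain_exists[OF n(1)] minchain_euler by metis
    obtain z2 P2 where 2: "minchain n x x2 z2" "euler n z2 P2" using minchain_exists[OF n(1)] minchain_euler by metis
    obtain w Q where w: "minchain n y x w" "euler n w Q" using minchain_exists[OF n(1)] minchain_euler by metis
    have "\<bar>P1 i\<bar> \<le> R" "\<bar>P2 i\<bar> \<le> R" if "i \<le> n" for i
      using R(2)[OF _ 1 n(1) that] R(2)[OF _ 2 n(1) that] by auto
    from euler_gronwall(1)[OF 1(2) 2(2) n(1) c(1) this c(2)]
    have "\<bar>x1 - x2\<bar> + \<bar>P1 n - P2 n\<bar> \<le> exp (c + K2 + c * K2) * \<bar>P1 0 - P2 0\<bar>" using 1(1) 2(1) by (simp add: minchain_def)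
    also have "\<dots> \<le> exp (c + K2 + c * K2) * (2 * e)"
      using n(2)[OF w 1] n(3)[OF w 2] by (intro mult_left_mono) (auto simp: abs_le_iff)
    finally show ?thesis by linarith
  qed
  note bd = this
  show ?thesis
  proof (rule ccontr)
    assume "x1 \<noteq> x2"
    define E where "E = exp (c + K2 + c * K2)"
    have "0 < E" by (simp add: E_def)
    then have "0 < \<bar>x1 - x2\<bar> / (4 * E)" using \<open>x1 \<noteq> x2\<close> by simp
    from bd[OF this] have "\<bar>x1 - x2\<bar> \<le> E * (2 * (\<bar>x1 - x2\<bar> / (4 * E)))" unfolding E_def .
    also have "\<dots> = \<bar>x1 - x2\<bar> / 2" using \<open>0 < E\<close> by simp
    finally show False using \<open>x1 \<noteq> x2\<close> by simp
  qed
qed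

lemma twist_kernel_action: "twist_kernel (\<lambda>y x. \<Lambda> y x + a * (y - x) + b)"
proof
  fix y x :: real
  show "\<Lambda> (y + 1) (x + 1) + a * (y + 1 - (x + 1)) + b = \<Lambda> y x + a * (y - x) + b" by (simp add: \<Lambda>_shift)
next
  have "continuous_on UNIV (\<lambda>z. (case z of (y, x) \<Rightarrow> \<Lambda> y x) + a * (fst z - snd z) + b)"
    by (intro continuous_intros \<Lambda>_cont)
  then show "continuous_on UNIV (\<lambda>(y, x). \<Lambda> y x + a * (y - x) + b)" by (simp add: case_prod_beta)
next
  show "\<exists>B'. \<forall>y x. \<bar>x - y\<bar> - B' \<le> \<Lambda> y x + a * (y - x) + b"
  proof (intro exI allI)
    fix y x
    \<comment> \<open>The slopes \<open>a + 1\<close> and \<open>a - 1\<close> in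
      \<open>\<Lambda>_lower\<close> leave slope 1 on either side after the term
      \<open>a * (y - x)\<close> is added.\<close>
    show "\<bar>x - y\<bar> - (\<bar>H0 (a + 1)\<bar> + \<bar>H0 (a - 1)\<bar> + B - b) \<le> \<Lambda> y x + a * (y - x) + b"
      using \<Lambda>_lower[of "a + 1" x y] \<Lambda>_lower[of "a - 1" x y] by (cases "y \<le> x") (auto simp: algebra_simps)
  qed
next
  fix y1 y2 x1 x2 :: real assume "y2 \<le> y1" "x1 \<le> x2"
  from \<Lambda>_cross[OF this]
  show "\<Lambda> y1 x2 + a * (y1 - x2) + b + (\<Lambda> y2 x1 + a * (y2 - x1) + b) \<le> \<Lambda> y1 x1 + a * (y1 - x1) + b + (\<Lambda> y2 x2 + a * (y2 - x2) + b)"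
    by (simp add: algebra_simps)
next
  fix y1 y2 x x' :: real
  assume "\<And>z. \<Lambda> y1 x + a * (y1 - x) + b + (\<Lambda> x x' + a * (x - x') + b) \<le> \<Lambda> y1 z + a * (y1 - z) + b + (\<Lambda> z x' + a * (z - x') + b)"
    "\<And>z. \<Lambda> y2 x + a * (y2 - x) + b + (\<Lambda> x x' + a * (x - x') + b) \<le> \<Lambda> y2 z + a * (y2 - z) + b + (\<Lambda> z x' + a * (z - x') + b)"
  then show "y1 = y2" by (intro \<Lambda>_back[of y1 x x' y2]) (simp_all add: algebra_simps)
next
  fix y x x1 x2 :: real
  assume "\<And>z. \<Lambda> y x + a * (y - x) + b + (\<Lambda> x x1 + a * (x - x1) + b) \<le> \<Lambda> y z + a * (y - z) + b + (\<Lambda> z x1 + a * (z - x1) + b)"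
    "\<And>z. \<Lambda> y x + a * (y - x) + b + (\<Lambda> x x2 + a * (x - x2) + b) \<le> \<Lambda> y z + a * (y - z) + b + (\<Lambda> z x2 + a * (z - x2) + b)"
  then show "x1 = x2" by (intro \<Lambda>_forw[of y x x1 x2]) (simp_all add: algebra_simps)
qed

end

section \<open>Viscosity solutions and the Lax--Oleinik formula\<close>

lemma max_square_deriv: "((\<lambda>x::real. (max 0 x)\<^sup>2) has_real_derivative 2 * max 0 x) (at x)"
proof -
  consider "0 < x" | "x < 0" | "x = 0" by linarith
  then show ?thesis
  proof cases
    case 1
    have "((\<lambda>x::real. x\<^sup>2) has_real_derivative 2 * max 0 x) (at x)"
      using 1 by (auto intro!: derivative_eq_intros)
    then show ?thesis
      by (rule has_field_derivative_transform_within_open[of _ _ _ "{0<..}"]) (use 1 in auto)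
  next
    case 2
    have "((\<lambda>x::real. 0) has_real_derivative 2 * max 0 x) (at x)"
      using 2 by (auto intro!: derivative_eq_intros)
    then show ?thesis
      by (rule has_field_derivative_transform_within_open[of _ _ _ "{..<0}"]) (use 2 in auto)
  next
    case 3
    have "((\<lambda>h::real. (max 0 h)\<^sup>2 / h) \<longlongrightarrow> 0) (at 0)"
    proof (rule Lim_null_comparison)
      show "\<forall>\<^sub>F h in at (0::real). norm ((max 0 h)\<^sup>2 / h) \<le> \<bar>h\<bar>"
        by (rule always_eventually) (auto simp: max_def power2_eq_square)
    qed (auto intro!: tendsto_eq_intros)
    then show ?thesis using 3 by (simp add: DERIV_def)
  qed
qed

lemma C1_on_plane_partials:
  fixes \<phi> A B' :: "real \<times> real \<Rightarrow> real"
  assumes d: "\<And>z. (\<phi> has_derivative (\<lambda>w. A z * fst w + B' z * snd w)) (at z)"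
    and c: "continuous_on UNIV A" "continuous_on UNIV B'"
  shows "C1_on_plane \<phi>" "partial_t \<phi> z = A z" "partial_x \<phi> z = B' z"
proof -
  let ?f = "\<lambda>z. A z *\<^sub>R Blinfun fst + B' z *\<^sub>R Blinfun snd"
  have app: "blinfun_apply (?f z) = (\<lambda>w. A z * fst w + B' z * snd w)" for z
    by (rule ext) (simp add: blinfun.add_left blinfun.scaleR_left bounded_linear_Blinfun_apply bounded_linear_fst bounded_linear_snd)
  show "C1_on_plane \<phi>"
    unfolding C1_on_plane_def
    by (rule exI[of _ ?f]) (auto simp: app d intro!: continuous_intros c)
  obtain t x where z: "z = (t, x)" by (cases z)
  have "((\<lambda>\<tau>. (\<tau>, x)) has_derivative (\<lambda>h. (h, 0))) (at t)" by (auto intro!: derivative_eq_intros)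
  from has_derivative_compose[OF this d[of "(t, x)"]]
  have "((\<lambda>\<tau>. \<phi> (\<tau>, x)) has_real_derivative A (t, x)) (at t)"
    unfolding has_field_derivative_def by (rule has_derivative_eq_rhs) (auto simp: fun_eq_iff)
  then show "partial_t \<phi> z = A z" unfolding partial_t_def z by (simp add: DERIV_imp_deriv)
  have "((\<lambda>\<tau>. (t, \<tau>)) has_derivative (\<lambda>h. (0, h))) (at x)" by (auto intro!: derivative_eq_intros)
  from has_derivative_compose[OF this d[of "(t, x)"]]
  have "((\<lambda>\<tau>. \<phi> (t, \<tau>)) has_real_derivative B' (t, x)) (at x)"
    unfolding has_field_derivative_def by (rule has_derivative_eq_rhs) (auto simp: fun_eq_iff)
  then show "partial_x \<phi> z = B' z" unfolding partial_x_def z by (simp add: DERIV_imp_deriv)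
qed

text \<open>One family serves all tests: a linear term in time, a quadratic well around the moving
  point \<open>\<alpha> + \<beta> * t\<close>, a quadratic well around the time
  \<open>\<tau>\<close>, and a one-sided penalty beyond the time \<open>b\<close>, squared to be of
  class C1.\<close>

definition barrier :: "real \<Rightarrow> real \<Rightarrow> real \<Rightarrow> real \<Rightarrow> real \<Rightarrow> real \<Rightarrow> real \<Rightarrow> real \<Rightarrow> real \<times> real \<Rightarrow> real" where
  "barrier C k \<alpha> \<beta> l \<tau> M b z =
     C * fst z + k * (snd z - \<alpha> - \<beta> * fst z)\<^sup>2 + l * (fst z - \<tau>)\<^sup>2 + M * (max 0 (fst z - b))\<^sup>2"

definition barrier_t :: "real \<Rightarrow> real \<Rightarrow> real \<Rightarrow> real \<Rightarrow> real \<Rightarrow> real \<Rightarrow> real \<Rightarrow> real \<Rightarrow> real \<times> real \<Rightarrow> real" where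
  "barrier_t C k \<alpha> \<beta> l \<tau> M b z =
     C - 2 * k * \<beta> * (snd z - \<alpha> - \<beta> * fst z) + 2 * l * (fst z - \<tau>) + 2 * M * max 0 (fst z - b)"

definition barrier_x :: "real \<Rightarrow> real \<Rightarrow> real \<Rightarrow> real \<times> real \<Rightarrow> real" where
  "barrier_x k \<alpha> \<beta> z = 2 * k * (snd z - \<alpha> - \<beta> * fst z)"

lemma barrier_deriv:
  "(barrier C k \<alpha> \<beta> l \<tau> M b has_derivative
     (\<lambda>w. barrier_t C k \<alpha> \<beta> l \<tau> M b z * fst w + barrier_x k \<alpha> \<beta> z * snd w)) (at z)"
proof -
  have m: "((\<lambda>z. (max 0 (fst z - b))\<^sup>2) has_derivative (\<lambda>w. fst w * (2 * max 0 (fst z - b)))) (at z)"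
    by (rule DERIV_compose_FDERIV[OF max_square_deriv]) (auto intro!: derivative_eq_intros)
  show ?thesis
    unfolding barrier_def[abs_def]
    by (rule derivative_eq_intros m | rule refl)+
      (auto simp: barrier_t_def barrier_x_def algebra_simps fun_eq_iff)
qed

lemma barrier_C1:
  "C1_on_plane (barrier C k \<alpha> \<beta> l \<tau> M b)"
  "partial_t (barrier C k \<alpha> \<beta> l \<tau> M b) z = barrier_t C k \<alpha> \<beta> l \<tau> M b z"
  "partial_x (barrier C k \<alpha> \<beta> l \<tau> M b) z = barrier_x k \<alpha> \<beta> z"
proof -
  have c: "continuous_on UNIV (barrier_t C k \<alpha> \<beta> l \<tau> M b)" "continuous_on UNIV (barrier_x k \<alpha> \<beta>)"
    unfolding barrier_t_def[abs_def] barrier_x_def[abs_def] by (intro continuous_intros)+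
  show "C1_on_plane (barrier C k \<alpha> \<beta> l \<tau> M b)"
    "partial_t (barrier C k \<alpha> \<beta> l \<tau> M b) z = barrier_t C k \<alpha> \<beta> l \<tau> M b z"
    "partial_x (barrier C k \<alpha> \<beta> l \<tau> M b) z = barrier_x k \<alpha> \<beta> z"
    using C1_on_plane_partials[OF barrier_deriv c] by auto
qed

text \<open>Steps shorter than \<open>\<rho>\<close> are chained from \<open>y\<close> to
  \<open>x\<close>, which turns a uniform modulus of continuity into an affine bound with slope
  \<open>e / \<rho>\<close>.\<close>

lemma chained_modulus:
  fixes f :: "real \<Rightarrow> real"
  assumes "0 < \<rho>" "0 \<le> e" and f: "\<And>x y. \<bar>x - y\<bar> < \<rho> \<Longrightarrow> f x \<le> f y + e"
  shows "f x \<le> f y + 2 * e + (e / \<rho>) * \<bar>x - y\<bar>"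
proof -
  define n where "n = nat \<lfloor>\<bar>x - y\<bar> / \<rho>\<rfloor> + 1"
  define h where "h = (x - y) / real n"
  have n: "\<bar>x - y\<bar> / \<rho> < real n" "real n \<le> \<bar>x - y\<bar> / \<rho> + 1" "0 < n"
    using assms(1) unfolding n_def by (simp_all, linarith+)
  have h: "\<bar>h\<bar> < \<rho>" using n assms(1) by (simp add: h_def abs_div pos_divide_less_eq mult.commute)
  have "f (y + real i * h) \<le> f y + real i * e" for i
  proof (induction i)
    case (Suc i)
    have "f (y + real (Suc i) * h) \<le> f (y + real i * h) + e" using h by (intro f) (simp add: algebra_simps)
    then show ?case using Suc by (simp add: algebra_simps)
  qed simp
  from this[of n] have "f x \<le> f y + real n * e" using n(3) by (simp add: h_def)
  also have "real n * e \<le> (\<bar>x - y\<bar> / \<rho> + 1) * e" using n(2) assms(2) by (rule mult_right_mono)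
  finally show ?thesis using assms(2) by (simp add: algebra_simps)
qed

context hamiltonian
begin

section \<open>Domination of viscosity solutions by segment costs\<close>

abbreviation V :: "real \<times> real \<Rightarrow> real" where "V \<equiv> \<lambda>(t, x). U t x"

text \<open>The cost of a segment freezes \<open>U\<close> at the initial point; the last term compensates the variation
  of \<open>U\<close>, so that long segments do not undercut their subdivisions.\<close>
definition seg :: "real \<Rightarrow> real \<Rightarrow> real \<Rightarrow> real \<Rightarrow> real" where
  "seg t x r v = r * (L0 v - U t x + 2 * K * r * (1 + \<bar>v\<bar>))"

text \<open>If \<open>S\<close> grew faster than the cost along the segment, then \<open>S\<close>
  minus a linear function of time, penalized away from the line, would have an interior local
  maximum. There the equation, combined with Young's inequality for the velocity \<open>v\<close>,
  contradicts the assumed growth.\<close>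

lemma subsolution_segment:
  assumes vs: "viscosity_solution H0 V S" and r: "0 < r"
  shows "S (t + r, y + r * v) \<le> S (t, y) + seg t y r v"
proof -
  have cont: "continuous_on UNIV S" using vs by (simp add: viscosity_solution_def)
  \<comment> \<open>The factor 2 in \<open>seg\<close> comes from the time window of length
    \<open>2 * r\<close> used below: it leaves room for a maximum beyond time
    \<open>t + r\<close>.\<close>
  define A where "A = L0 v - U t y + 2 * K * r * (1 + \<bar>v\<bar>)"
  have "S (t + r, y + r * v) - S (t, y) \<le> r * A + e" if e: "0 < e" for e
  proof (rule ccontr)
    assume neg: "\<not> ?thesis"
    define \<epsilon> where "\<epsilon> = e / (2 * r)"
    have \<epsilon>: "0 < \<epsilon>" using e r by (simp add: \<epsilon>_def)
    define C where "C = A + \<epsilon>"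
    define \<gamma> where "\<gamma> = S (t + r, y + r * v) - S (t, y) - r * C"
    have "r * C = r * A + e / 2" using r by (simp add: C_def \<epsilon>_def algebra_simps)
    then have \<gamma>: "0 < \<gamma>" using neg e by (simp add: \<gamma>_def)
    define \<xi> where "\<xi> \<sigma> = y + (\<sigma> - t) * v" for \<sigma>
    define G where "G p = S (fst p, \<xi> (fst p) + snd p)" for p
    have cG: "continuous_on UNIV G"
      unfolding G_def[abs_def] \<xi>_def by (intro continuous_on_compose2[OF cont] continuous_intros) auto
    define Q where "Q = {t..t + 2 * r} \<times> {-1..1::real}"
    have cQ: "compact Q" unfolding Q_def by (intro compact_Times) auto
    have "compact (G ` Q)" by (rule compact_continuous_image[OF continuous_on_subset[OF cG] cQ]) simp
    then obtain Bd where Bd: "\<And>p. p \<in> Q \<Longrightarrow> \<bar>G p\<bar> \<le> Bd"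
      unfolding compact_eq_bounded_closed bounded_iff by force
    have "isCont (\<lambda>d. S (t, y + d)) 0"
    proof -
      have "continuous_on UNIV (\<lambda>d. S (t, y + d))" by (intro continuous_on_compose2[OF cont] continuous_intros) auto
      then show ?thesis by (simp add: continuous_on_eq_continuous_at)
    qed
    then obtain \<rho>0 where \<rho>0: "0 < \<rho>0" "\<And>d. \<bar>d\<bar> < \<rho>0 \<Longrightarrow> \<bar>S (t, y + d) - S (t, y)\<bar> < \<gamma>"
      using \<gamma> unfolding continuous_at_eps_delta dist_real_def by auto
    define \<rho> where "\<rho> = Min {\<rho>0, 1, \<epsilon> / (2 * (K + 1))}"
    have \<rho>: "0 < \<rho>" "\<rho> \<le> \<rho>0" "\<rho> \<le> 1" "\<rho> \<le> \<epsilon> / (2 * (K + 1))" using \<rho>0(1) \<epsilon> K_nonneg by (auto simp: \<rho>_def)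
    have K\<rho>: "K * \<rho> < \<epsilon>"
    proof -
      have "K * \<rho> \<le> (K + 1) * \<rho>" using \<rho> by simp
      also have "\<dots> \<le> \<epsilon> / 2" using \<rho>(4) K_nonneg by (simp add: field_simps)
      finally show ?thesis using \<epsilon> by simp
    qed
    \<comment> \<open>\<open>E\<close> bounds what a maximum point can gain over the end of the
      segment: two values of \<open>G\<close> and a time term. Since
      \<open>k * \<rho>\<^sup>2\<close> and \<open>M * r\<^sup>2\<close> exceed \<open>E\<close>,
      the maximum avoids the lateral sides and the final time.\<close>
    define E where "E = 2 * Bd + \<bar>C\<bar> * r"
    define k where "k = E / \<rho>\<^sup>2 + 1"
    define M where "M = E / r\<^sup>2 + 1"
    have Bd0: "0 \<le> Bd" using Bd[of "(t, 0)"] r by (auto simp: Q_def)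
    have E0: "0 \<le> E" using r Bd0 by (simp add: E_def)
    have k: "0 < k" "k * \<rho>\<^sup>2 = E + \<rho>\<^sup>2" using E0 \<rho> by (auto simp: k_def field_simps add_nonneg_pos)
    have M: "0 < M" "M * r\<^sup>2 = E + r\<^sup>2" using E0 r by (auto simp: M_def field_simps add_nonneg_pos)
    define F where "F p = G p - (C * (fst p - t) + k * (snd p)\<^sup>2 + M * (max 0 (fst p - (t + r)))\<^sup>2)" for p
    have "continuous_on Q F" unfolding F_def[abs_def]
      by (intro continuous_intros continuous_on_subset[OF cG]) auto
    moreover have "Q \<noteq> {}" using r by (auto simp: Q_def)
    ultimately obtain p where p: "p \<in> Q" and pmax: "\<And>p'. p' \<in> Q \<Longrightarrow> F p' \<le> F p"
      using continuous_attains_sup[OF cQ] by metis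
    obtain \<sigma> d where pd: "p = (\<sigma>, d)" by (cases p)
    have \<sigma>: "t \<le> \<sigma>" "\<sigma> \<le> t + 2 * r" "\<bar>d\<bar> \<le> 1" using p by (auto simp: pd Q_def)
    have top: "F (t + r, 0) = S (t + r, y + r * v) - C * r" by (simp add: F_def G_def \<xi>_def)
    have inQ: "(t + r, 0) \<in> Q" using r by (auto simp: Q_def)
    have ge: "S (t + r, y + r * v) - C * r \<le> F (\<sigma>, d)" using pmax[OF inQ] by (simp add: top pd)
    have pen: "k * d\<^sup>2 + M * (max 0 (\<sigma> - (t + r)))\<^sup>2 \<le> E"
    proof -
      have "\<bar>G (\<sigma>, d)\<bar> \<le> Bd" "\<bar>S (t + r, y + r * v)\<bar> \<le> Bd"
        using Bd[OF p] Bd[OF inQ] by (auto simp: pd G_def \<xi>_def)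
      moreover have "C * r - C * (\<sigma> - t) \<le> \<bar>C\<bar> * r"
      proof -
        have "C * r - C * (\<sigma> - t) = C * (r - (\<sigma> - t))" by (simp add: algebra_simps)
        also have "\<dots> \<le> \<bar>C\<bar> * \<bar>r - (\<sigma> - t)\<bar>" by (metis abs_ge_self abs_mult)
        also have "\<dots> \<le> \<bar>C\<bar> * r" using \<sigma> by (intro mult_left_mono) auto
        finally show ?thesis .
      qed
      ultimately show ?thesis using ge unfolding F_def E_def by simp
    qed
    have d: "\<bar>d\<bar> < \<rho>"
    proof (rule ccontr)
      assume "\<not> \<bar>d\<bar> < \<rho>"
      then have "\<rho>\<^sup>2 \<le> d\<^sup>2" using \<rho>(1) by (metis abs_of_pos abs_le_square_iff not_less)
      then have "k * \<rho>\<^sup>2 \<le> k * d\<^sup>2" using k(1) by simp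
      moreover have "0 \<le> M * (max 0 (\<sigma> - (t + r)))\<^sup>2" using M(1) by simp
      moreover have "0 < \<rho>\<^sup>2" using \<rho>(1) by simp
      ultimately show False using pen k(2) by linarith
    qed
    have \<sigma>2: "\<sigma> < t + 2 * r"
    proof (rule ccontr)
      assume "\<not> \<sigma> < t + 2 * r"
      then have "\<sigma> = t + 2 * r" using \<sigma> by simp
      then have "M * (max 0 (\<sigma> - (t + r)))\<^sup>2 = M * r\<^sup>2" using r by simp
      moreover have "0 \<le> k * d\<^sup>2" "0 < r\<^sup>2" using k(1) r by auto
      ultimately show False using pen M(2) by linarith
    qed
    \<comment> \<open>The initial time is excluded because \<open>F\<close> there stays below
      \<open>S (t, y) + \<gamma>\<close>, which is exactly its value at the end of the
      segment.\<close>
    have \<sigma>1: "t < \<sigma>"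
    proof (rule ccontr)
      assume "\<not> t < \<sigma>"
      then have "\<sigma> = t" using \<sigma> by simp
      then have "F (\<sigma>, d) = S (t, y + d) - k * d\<^sup>2" using r by (simp add: F_def G_def \<xi>_def)
      moreover have "0 \<le> k * d\<^sup>2" using k(1) by simp
      moreover have "\<bar>S (t, y + d) - S (t, y)\<bar> < \<gamma>" using d \<rho>(2) by (intro \<rho>0(2)) simp
      ultimately show False using ge by (simp add: \<gamma>_def mult.commute)
    qed
    define \<phi> where "\<phi> = barrier C k (y - t * v) v 0 0 M (t + r)"
    define z where "z = (\<sigma>, \<xi> \<sigma> + d)"
    have SF: "S w - \<phi> w = F (fst w, snd w - \<xi> (fst w)) - C * t" for w
      by (simp add: F_def G_def \<phi>_def barrier_def \<xi>_def algebra_simps)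
    have "\<forall>\<^sub>F w in nhds z. S w - \<phi> w \<le> S z - \<phi> z"
      unfolding eventually_nhds
    proof (intro exI conjI ballI)
      let ?O = "{w :: real \<times> real. t < fst w \<and> fst w < t + 2 * r \<and> -1 < snd w - \<xi> (fst w) \<and> snd w - \<xi> (fst w) < 1}"
      show "open ?O" unfolding \<xi>_def by (intro open_Collect_conj open_Collect_less continuous_intros)
      show "z \<in> ?O" using \<sigma>1 \<sigma>2 d \<rho>(3) by (auto simp: z_def)
      fix w assume "w \<in> ?O"
      then have "(fst w, snd w - \<xi> (fst w)) \<in> Q" by (auto simp: Q_def)
      from pmax[OF this] show "S w - \<phi> w \<le> S z - \<phi> z" unfolding SF by (simp add: z_def pd)
    qed
    then have "partial_t \<phi> z + H0 (partial_x \<phi> z) + V z \<le> 0"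
      using vs barrier_C1(1) unfolding viscosity_solution_def \<phi>_def by blast
    then have le: "barrier_t C k (y - t * v) v 0 0 M (t + r) z + H0 (barrier_x k (y - t * v) v z) + U \<sigma> (\<xi> \<sigma> + d) \<le> 0"
      unfolding \<phi>_def barrier_C1 by (simp add: z_def)
    define q where "q = 2 * k * d"
    have "snd z - (y - t * v) - v * fst z = d" by (simp add: z_def \<xi>_def algebra_simps)
    then have eqs: "barrier_x k (y - t * v) v z = q"
      "barrier_t C k (y - t * v) v 0 0 M (t + r) z = C - q * v + 2 * M * max 0 (\<sigma> - (t + r))"
      by (simp_all add: barrier_x_def barrier_t_def q_def z_def)
    have "0 \<le> 2 * M * max 0 (\<sigma> - (t + r))" using M(1) by simp
    then have "C \<le> q * v - H0 q - U \<sigma> (\<xi> \<sigma> + d)" using le[unfolded eqs] by linarith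
    also have "\<dots> \<le> L0 v - U \<sigma> (\<xi> \<sigma> + d)" using young[of q v] by simp
    also have "\<dots> \<le> L0 v - U t y + (2 * K * r * (1 + \<bar>v\<bar>) + K * \<rho>)"
    proof -
      have "\<bar>U \<sigma> (\<xi> \<sigma> + d) - U t y\<bar> \<le> K * (\<bar>\<sigma> - t\<bar> + \<bar>\<xi> \<sigma> + d - y\<bar>)" by (rule U_lip)
      also have "\<dots> \<le> K * (2 * r + (2 * r * \<bar>v\<bar> + \<rho>))"
      proof (intro mult_left_mono[OF _ K_nonneg] add_mono)
        show "\<bar>\<sigma> - t\<bar> \<le> 2 * r" using \<sigma> by simp
        have "\<bar>\<xi> \<sigma> + d - y\<bar> \<le> \<bar>(\<sigma> - t) * v\<bar> + \<bar>d\<bar>" by (simp add: \<xi>_def)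
        also have "\<bar>(\<sigma> - t) * v\<bar> \<le> 2 * r * \<bar>v\<bar>" unfolding abs_mult using \<sigma> by (intro mult_right_mono) auto
        finally show "\<bar>\<xi> \<sigma> + d - y\<bar> \<le> 2 * r * \<bar>v\<bar> + \<rho>" using d by simp
      qed
      finally have "\<bar>U \<sigma> (\<xi> \<sigma> + d) - U t y\<bar> \<le> 2 * K * r * (1 + \<bar>v\<bar>) + K * \<rho>" by (simp add: algebra_simps)
      then show ?thesis by linarith
    qed
    finally have "C \<le> A + K * \<rho>" by (simp add: A_def)
    then show False using K\<rho> by (simp add: C_def)
  qed
  then have "S (t + r, y + r * v) - S (t, y) \<le> r * A" by (rule field_le_epsilon)
  then show ?thesis by (simp add: seg_def A_def)
qed

inductive reach :: "(real \<Rightarrow> real \<Rightarrow> bool) \<Rightarrow> real \<Rightarrow> real \<Rightarrow> real \<Rightarrow> bool" for Q where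
  reach_init: "Q y c \<Longrightarrow> reach Q 0 y c"
| reach_step: "reach Q t x c \<Longrightarrow> 0 < r \<Longrightarrow> reach Q (t + r) (x + r * v) (c + seg t x r v)"

lemma reach_nonneg: "reach Q t x c \<Longrightarrow> 0 \<le> t"
  by (induction rule: reach.induct) auto

lemma seg_ge:
  assumes "0 \<le> r"
  shows "N * \<bar>r * v\<bar> - (LB N + B) * r \<le> seg t x r v"
proof -
  have "N * \<bar>v\<bar> - (LB N + B) \<le> L0 v - U t x + 2 * K * r * (1 + \<bar>v\<bar>)"
    using L0_superlinear[of N v] U_bound[of t x] K_nonneg assms
    by (smt (verit) abs_ge_zero mult_nonneg_nonneg)
  from mult_left_mono[OF this assms] show ?thesis
    using assms by (simp add: seg_def abs_mult algebra_simps)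
qed

text \<open>Allows a segment to be cut at an intermediate time: the correction term of
  \<open>seg\<close> grows with the length, so the whole costs at least the first part plus a linear
  bound for the rest.\<close>

lemma seg_diff_ge:
  assumes "0 \<le> r1" "0 \<le> r2"
  shows "seg t x r1 v + N * \<bar>r2 * v\<bar> - (LB N + B) * r2 \<le> seg t x (r1 + r2) v"
proof -
  have "N * \<bar>v\<bar> - (LB N + B) \<le> L0 v - U t x" using L0_superlinear[of N v] U_bound[of t x] by linarith
  from mult_left_mono[OF this assms(2)] have "N * \<bar>r2 * v\<bar> - (LB N + B) * r2 \<le> r2 * (L0 v - U t x)"
    using assms by (simp add: abs_mult algebra_simps)
  moreover have "r1 * (2 * K * r1 * (1 + \<bar>v\<bar>)) \<le> (r1 + r2) * (2 * K * (r1 + r2) * (1 + \<bar>v\<bar>))"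
    using assms K_nonneg by (intro mult_mono) auto
  ultimately show ?thesis by (simp add: seg_def distrib_right distrib_left)
qed

section \<open>The polygonal value function\<close>

context
  fixes S :: "real \<times> real \<Rightarrow> real" and a :: real
  assumes S_cont: "continuous_on UNIV S"
    and S_shift: "\<And>t x. S (t, x + 1) = S (t, x) + a"
    and S_seg: "\<And>t x r v. 0 < r \<Longrightarrow> S (t + r, x + r * v) \<le> S (t, x) + seg t x r v"
begin

definition lax :: "real \<times> real \<Rightarrow> real" where
  "lax z = Inf {c. reach (\<lambda>y c. c = S (0, y)) (fst z) (snd z) c}"

lemma reach_ge: "reach (\<lambda>y c. c = S (0, y)) t x c \<Longrightarrow> S (t, x) \<le> c"
proof (induction rule: reach.induct)
  case (reach_step t x c r v)
  then show ?case using S_seg[of r t x v] by simp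
qed simp

lemma reach_ex: "0 \<le> t \<Longrightarrow> \<exists>c. reach (\<lambda>y c. c = S (0, y)) t x c"
  using reach_init[of "\<lambda>y c. c = S (0, y)" x] reach_step[of "\<lambda>y c. c = S (0, y)" 0 x _ t 0]
  by (cases "t = 0") force+

lemma reach_bdd: "bdd_below {c. reach (\<lambda>y c. c = S (0, y)) t x c}"
  using reach_ge by (intro bdd_belowI[of _ "S (t, x)"]) auto

lemma lax_le: "reach (\<lambda>y c. c = S (0, y)) t x c \<Longrightarrow> lax (t, x) \<le> c"
  unfolding lax_def by (rule cInf_lower) (auto intro: reach_bdd)

lemma lax_ge:
  assumes "0 \<le> t" "\<And>c. reach (\<lambda>y c. c = S (0, y)) t x c \<Longrightarrow> b \<le> c"
  shows "b \<le> lax (t, x)"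
  unfolding lax_def by (rule cInf_greatest) (use reach_ex[OF assms(1)] assms(2) in auto)

lemma lax_init: "lax (0, x) = S (0, x)"
proof (rule antisym)
  show "lax (0, x) \<le> S (0, x)" by (intro lax_le reach_init) simp
  show "S (0, x) \<le> lax (0, x)" by (intro lax_ge reach_ge) auto
qed

lemma lax_seg:
  assumes "0 \<le> t" "0 < r"
  shows "lax (t + r, x + r * v) \<le> lax (t, x) + seg t x r v"
proof -
  have "lax (t + r, x + r * v) - seg t x r v \<le> lax (t, x)"
  proof (rule lax_ge[OF assms(1)])
    fix c assume "reach (\<lambda>y c. c = S (0, y)) t x c"
    from lax_le[OF reach_step[OF this assms(2), of v]]
    show "lax (t + r, x + r * v) - seg t x r v \<le> c" by simp
  qed
  then show ?thesis by simp
qed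

text \<open>Translates the whole polygon by \<open>\<delta>\<close>: velocities are unchanged and
  \<open>U\<close> changes at rate at most \<open>K * \<bar>\<delta>\<bar>\<close>.\<close>

lemma reach_translate:
  assumes \<delta>: "\<And>y. S (0, y + \<delta>) \<le> S (0, y) + m"
  shows "reach (\<lambda>y c. c = S (0, y)) t x c \<Longrightarrow> \<exists>c'\<le>c + m + K * \<bar>\<delta>\<bar> * t. reach (\<lambda>y c. c = S (0, y)) t (x + \<delta>) c'"
proof (induction rule: reach.induct)
  case (reach_init y c)
  then show ?case using \<delta>[of y] reach.reach_init[of "\<lambda>y c. c = S (0, y)" "y + \<delta>"] by auto
next
  case (reach_step t x c r v)
  then obtain c' where c': "c' \<le> c + m + K * \<bar>\<delta>\<bar> * t" "reach (\<lambda>y c. c = S (0, y)) t (x + \<delta>) c'" by blast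
  have "- U t (x + \<delta>) \<le> - U t x + K * \<bar>\<delta>\<bar>" using U_lip[of t "x + \<delta>" t x] by simp
  from mult_left_mono[OF this less_imp_le[OF reach_step(2)]]
  have "seg t (x + \<delta>) r v \<le> seg t x r v + K * \<bar>\<delta>\<bar> * r" by (simp add: seg_def algebra_simps)
  moreover have "reach (\<lambda>y c. c = S (0, y)) (t + r) (x + r * v + \<delta>) (c' + seg t (x + \<delta>) r v)"
    using reach.reach_step[OF c'(2) reach_step(2), of v] by (simp add: algebra_simps)
  ultimately show ?case using c'(1) by (intro exI conjI) (auto simp: algebra_simps)
qed

lemma lax_translate:
  assumes "\<And>y. S (0, y + \<delta>) \<le> S (0, y) + m" "0 \<le> t"
  shows "lax (t, x + \<delta>) \<le> lax (t, x) + m + K * \<bar>\<delta>\<bar> * t"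
proof -
  have "lax (t, x + \<delta>) - m - K * \<bar>\<delta>\<bar> * t \<le> lax (t, x)"
  proof (rule lax_ge[OF assms(2)])
    fix c assume "reach (\<lambda>y c. c = S (0, y)) t x c"
    from reach_translate[OF assms(1) this] obtain c'
      where "c' \<le> c + m + K * \<bar>\<delta>\<bar> * t" "reach (\<lambda>y c. c = S (0, y)) t (x + \<delta>) c'" by blast
    then show "lax (t, x + \<delta>) - m - K * \<bar>\<delta>\<bar> * t \<le> c" using lax_le by fastforce
  qed
  then show ?thesis by simp
qed

lemma S_shift_down: "S (t, x - 1) = S (t, x) - a"
  using S_shift[of t "x - 1"] by simp

lemma reach_shift: "reach (\<lambda>y c. c = S (0, y)) t x c \<Longrightarrow>
   reach (\<lambda>y c. c = S (0, y)) t (x + 1) (c + a) \<and> reach (\<lambda>y c. c = S (0, y)) t (x - 1) (c - a)"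
proof (induction rule: reach.induct)
  case (reach_init y c)
  then show ?case using S_shift S_shift_down by (auto intro!: reach.reach_init)
next
  case (reach_step t x c r v)
  have segs: "seg t (x + 1) r v = seg t x r v" "seg t (x - 1) r v = seg t x r v"
    using U_periodic[of t x] U_periodic[of t "x - 1"] by (simp_all add: seg_def)
  have "reach (\<lambda>y c. c = S (0, y)) (t + r) (x + 1 + r * v) (c + a + seg t (x + 1) r v)"
    "reach (\<lambda>y c. c = S (0, y)) (t + r) (x - 1 + r * v) (c - a + seg t (x - 1) r v)"
    using reach_step by (auto intro: reach.reach_step)
  then show ?case unfolding segs by (simp add: algebra_simps)
qed

lemma lax_shift:
  assumes "0 \<le> t"
  shows "lax (t, x + 1) = lax (t, x) + a"
proof (rule antisym)
  have "lax (t, x + 1) - a \<le> lax (t, x)"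
  proof (rule lax_ge[OF assms])
    fix c assume "reach (\<lambda>y c. c = S (0, y)) t x c"
    then show "lax (t, x + 1) - a \<le> c" using lax_le[of t "x + 1" "c + a"] reach_shift by fastforce
  qed
  then show "lax (t, x + 1) \<le> lax (t, x) + a" by simp
  show "lax (t, x) + a \<le> lax (t, x + 1)"
  proof (rule lax_ge[OF assms])
    fix c assume "reach (\<lambda>y c. c = S (0, y)) t (x + 1) c"
    then show "lax (t, x) + a \<le> c" using lax_le[of t x "c - a"] reach_shift[of t "x + 1" c] by simp
  qed
qed

lemma S_init_modulus:
  assumes "0 < e"
  obtains \<rho> where "0 < \<rho>" "\<And>y \<delta>. \<bar>\<delta>\<bar> < \<rho> \<Longrightarrow> S (0, y + \<delta>) \<le> S (0, y) + e"
proof -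
  have "continuous_on {-1..2} (\<lambda>y. S (0, y))"
    by (intro continuous_on_compose2[OF S_cont] continuous_intros) auto
  then have "uniformly_continuous_on {-1..2} (\<lambda>y. S (0, y))" by (intro compact_uniformly_continuous) auto
  then obtain d where d: "0 < d" "\<And>y y'. y \<in> {-1..2} \<Longrightarrow> y' \<in> {-1..2} \<Longrightarrow> \<bar>y' - y\<bar> < d \<Longrightarrow> \<bar>S (0, y') - S (0, y)\<bar> < e"
    using assms unfolding uniformly_continuous_on_def dist_real_def by metis
  have per: "S (0, x + of_int m) - S (0, y + of_int m) = S (0, x) - S (0, y)" for x y m
  proof -
    have "S (0, x + of_int m) - a * (x + of_int m) = S (0, x) - a * x" for x m
      using periodic_int[of "\<lambda>x. S (0, x) - a * x" x m] S_shift by (simp add: algebra_simps)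
    then show ?thesis by (simp add: algebra_simps)
  qed
  show thesis
  proof (rule that[of "min d 1"])
    fix y \<delta> :: real assume \<delta>: "\<bar>\<delta>\<bar> < min d 1"
    let ?m = "- \<lfloor>y\<rfloor>"
    define w where "w = y + of_int ?m"
    have w: "0 \<le> w" "w < 1" unfolding w_def by linarith+
    have "\<bar>S (0, w + \<delta>) - S (0, w)\<bar> < e"
      using \<delta> w by (intro d(2)) (auto simp: abs_less_iff)
    moreover have "w + \<delta> = y + \<delta> + of_int ?m" by (simp add: w_def)
    ultimately have "\<bar>S (0, y + \<delta> + of_int ?m) - S (0, y + of_int ?m)\<bar> < e" by (simp only: w_def)
    then show "S (0, y + \<delta>) \<le> S (0, y) + e" unfolding per by linarith
  qed (use d in auto)
qed

lemma lax_modulus: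
  assumes "0 < e"
  obtains \<rho> where "0 < \<rho>" "\<And>t x x'. 0 \<le> t \<Longrightarrow> t \<le> 2 \<Longrightarrow> \<bar>x - x'\<bar> < \<rho> \<Longrightarrow> lax (t, x) \<le> lax (t, x') + e"
proof -
  obtain \<rho> where \<rho>: "0 < \<rho>" "\<And>y \<delta>. \<bar>\<delta>\<bar> < \<rho> \<Longrightarrow> S (0, y + \<delta>) \<le> S (0, y) + e / 2"
    using S_init_modulus[of "e / 2"] assms by auto
  define \<rho>' where "\<rho>' = min \<rho> (e / (4 * (K + 1)))"
  show thesis
  proof (rule that[of \<rho>'])
    show "0 < \<rho>'" using \<rho>(1) assms K_nonneg by (simp add: \<rho>'_def)
    fix t x x' :: real assume t: "0 \<le> t" "t \<le> 2" and x: "\<bar>x - x'\<bar> < \<rho>'"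
    have "lax (t, x' + (x - x')) \<le> lax (t, x') + e / 2 + K * \<bar>x - x'\<bar> * t"
      by (rule lax_translate) (use \<rho>(2) x t in \<open>auto simp: \<rho>'_def\<close>)
    moreover have "K * \<bar>x - x'\<bar> * t \<le> e / 2"
    proof -
      have "K * \<bar>x - x'\<bar> * t \<le> (K + 1) * (e / (4 * (K + 1))) * 2"
        using t x K_nonneg assms by (intro mult_mono) (auto simp: \<rho>'_def)
      also have "(K + 1) * (e / (4 * (K + 1))) = e / 4" using K_nonneg by (simp add: divide_simps)
      finally show ?thesis by simp
    qed
    ultimately show "lax (t, x) \<le> lax (t, x') + e" by simp
  qed
qed

text \<open>Cuts the polygon at time \<open>t\<close>. The remaining part costs at least
  \<open>N\<close> times the distance travelled, up to a multiple of the elapsed time, for any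
  chosen \<open>N\<close>.\<close>

lemma reach_intermediate:
  assumes "reach (\<lambda>y c. c = S (0, y)) \<tau> x c" "0 \<le> t" "t \<le> \<tau>" and N: "0 \<le> N"
  shows "\<exists>x'. lax (t, x') + N * \<bar>x - x'\<bar> - (LB N + B) * (\<tau> - t) \<le> c"
  using assms(1-3)
proof (induction rule: reach.induct)
  case (reach_init y c)
  then have "t = 0" by simp
  then show ?case using reach_init(1) lax_init[of y] by (intro exI[of _ y]) simp
next
  case (reach_step t1 x c r v)
  show ?case
  proof (cases "t \<le> t1")
    case True
    then obtain x' where x': "lax (t, x') + N * \<bar>x - x'\<bar> - (LB N + B) * (t1 - t) \<le> c" using reach_step by blast
    have "N * \<bar>x + r * v - x'\<bar> \<le> N * (\<bar>x - x'\<bar> + \<bar>r * v\<bar>)" using N by (intro mult_left_mono) auto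
    moreover have "N * \<bar>r * v\<bar> - (LB N + B) * r \<le> seg t1 x r v" using reach_step(2) by (intro seg_ge) simp
    ultimately show ?thesis using x' by (intro exI[of _ x']) (simp add: algebra_simps)
  next
    case False
    define r1 r2 where "r1 = t - t1" and "r2 = t1 + r - t"
    have r: "0 < r1" "0 \<le> r2" "r = r1 + r2" "t1 + r1 = t" using False reach_step by (auto simp: r1_def r2_def)
    have "lax (t, x + r1 * v) \<le> c + seg t1 x r1 v"
      using lax_le[OF reach.reach_step[OF reach_step(1) r(1), of v]] r(4) by simp
    moreover have "x + r * v - (x + r1 * v) = r2 * v" using r(3) by (simp add: algebra_simps)
    moreover have "t1 + r - t = r2" by (simp add: r2_def)
    moreover have "seg t1 x r1 v + N * \<bar>r2 * v\<bar> - (LB N + B) * r2 \<le> seg t1 x r v"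
      unfolding r(3) using r by (intro seg_diff_ge) auto
    ultimately show ?thesis by (intro exI[of _ "x + r1 * v"]) simp
  qed
qed

text \<open>Later values are bounded above by standing still for the time difference. From below, a
  near-optimal curve is cut at the earlier time, and superlinear cost pays for the distance it
  travels afterwards.\<close>

lemma lax_uniform:
  assumes "0 < e"
  obtains \<rho> where "0 < \<rho>" "\<And>t t' x x'. 0 \<le> t \<Longrightarrow> t \<le> t' \<Longrightarrow> t' \<le> 2 \<Longrightarrow> t' - t < \<rho> \<Longrightarrow> \<bar>x - x'\<bar> < \<rho> \<Longrightarrow>
     \<bar>lax (t, x) - lax (t', x')\<bar> \<le> e"
proof -
  obtain \<rho> where \<rho>: "0 < \<rho>" "\<And>t x x'. 0 \<le> t \<Longrightarrow> t \<le> 2 \<Longrightarrow> \<bar>x - x'\<bar> < \<rho> \<Longrightarrow> lax (t, x) \<le> lax (t, x') + e / 4"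
    using lax_modulus[of "e / 4"] assms by auto
  \<comment> \<open>Matches the slope produced by \<open>chained_modulus\<close>, so that the
    travelled distance cancels.\<close>
  define N where "N = (e / 4) / \<rho>"
  have N: "0 \<le> N" using \<rho>(1) assms by (simp add: N_def)
  define c1 where "c1 = \<bar>L0 0\<bar> + B + 4 * K"
  define c2 where "c2 = \<bar>LB N + B\<bar>"
  have c: "0 \<le> c1" "0 \<le> c2" using B_nonneg K_nonneg by (auto simp: c1_def c2_def)
  define d where "d = Min {\<rho>, 1, e / (4 * (c1 + 1)), e / (4 * (c2 + 1))}"
  have d: "0 < d" "d \<le> \<rho>" "d \<le> 1" "d \<le> e / (4 * (c1 + 1))" "d \<le> e / (4 * (c2 + 1))"
    using \<rho>(1) assms c by (auto simp: d_def)
  have small: "c * r \<le> e / 4" if "0 \<le> c" "0 \<le> r" "r \<le> e / (4 * (c + 1))" for c r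
  proof -
    have "c * r \<le> (c + 1) * (e / (4 * (c + 1)))" using that by (intro mult_mono) auto
    also have "\<dots> = e / 4" using that(1) by (simp add: divide_simps)
    finally show ?thesis .
  qed
  show thesis
  proof (rule that[OF d(1)])
    fix t t' x x' :: real assume t: "0 \<le> t" "t \<le> t'" "t' \<le> 2" "t' - t < d" and x: "\<bar>x - x'\<bar> < d"
    have mod1: "lax (t, x) \<le> lax (t, x') + e / 4" "lax (t, x') \<le> lax (t, x) + e / 4"
      using \<rho>(2)[of t x x'] \<rho>(2)[of t x' x] t x d(2) by (auto simp: abs_minus_commute)
    have up: "lax (t', x') \<le> lax (t, x') + e / 4"
    proof (cases "t = t'")
      case False
      define r where "r = t' - t"
      have r: "0 < r" "r \<le> 1" "t + r = t'" "r \<le> e / (4 * (c1 + 1))" using False t d by (auto simp: r_def)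
      have "L0 0 - U t x' + 2 * K * r * (1 + \<bar>0\<bar>) \<le> c1"
        using U_bound[of t x'] mult_left_le[of r "2 * K"] r K_nonneg by (simp add: c1_def)
      then have "seg t x' r 0 \<le> c1 * r" unfolding seg_def using mult_left_mono[of _ c1 r] r(1) by (simp add: mult.commute)
      moreover have "c1 * r \<le> e / 4" using c r by (intro small) auto
      ultimately show ?thesis using lax_seg[OF t(1) r(1), of x' 0] r(3) by simp
    qed (use assms in simp)
    have down: "lax (t, x') - 3 * e / 4 \<le> lax (t', x')"
    proof (rule lax_ge)
      fix cc assume "reach (\<lambda>y c. c = S (0, y)) t' x' cc"
      then obtain x'' where x'': "lax (t, x'') + N * \<bar>x' - x''\<bar> - (LB N + B) * (t' - t) \<le> cc"
        using reach_intermediate[of t' x' cc t N] t N by auto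
      have "lax (t, x') \<le> lax (t, x'') + 2 * (e / 4) + (e / 4) / \<rho> * \<bar>x' - x''\<bar>"
        by (rule chained_modulus[OF \<rho>(1), of "e / 4" "\<lambda>x. lax (t, x)"]) (use \<rho>(2) t assms in auto)
      moreover have "(LB N + B) * (t' - t) \<le> e / 4"
      proof -
        have "(LB N + B) * (t' - t) \<le> c2 * (t' - t)" using t by (intro mult_right_mono) (auto simp: c2_def)
        also have "\<dots> \<le> e / 4" using c t d by (intro small) auto
        finally show ?thesis .
      qed
      ultimately show "lax (t, x') - 3 * e / 4 \<le> cc" using x'' by (simp add: N_def)
    qed (use t in simp)
    show "\<bar>lax (t, x) - lax (t', x')\<bar> \<le> e" using mod1 up down assms by linarith
  qed
qed

lemma lax_cont: "continuous_on ({0..2} \<times> UNIV) lax"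
  unfolding continuous_on_iff
proof (intro ballI allI impI)
  fix z :: "real \<times> real" and e :: real assume z: "z \<in> {0..2} \<times> UNIV" and e: "0 < e"
  obtain \<rho> where \<rho>: "0 < \<rho>" "\<And>t t' x x'. 0 \<le> t \<Longrightarrow> t \<le> t' \<Longrightarrow> t' \<le> 2 \<Longrightarrow> t' - t < \<rho> \<Longrightarrow> \<bar>x - x'\<bar> < \<rho> \<Longrightarrow>
     \<bar>lax (t, x) - lax (t', x')\<bar> \<le> e / 2" using lax_uniform[of "e / 2"] e by auto
  show "\<exists>d>0. \<forall>w\<in>{0..2} \<times> UNIV. dist w z < d \<longrightarrow> dist (lax w) (lax z) < e"
  proof (intro exI[of _ \<rho>] conjI ballI impI \<rho>(1))
    fix w :: "real \<times> real" assume w: "w \<in> {0..2} \<times> UNIV" "dist w z < \<rho>"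
    obtain t x t' x' where zw: "z = (t, x)" "w = (t', x')" by (cases z, cases w)
    have "\<bar>t' - t\<bar> < \<rho>" "\<bar>x' - x\<bar> < \<rho>"
      using w(2) dist_fst_le[of w z] dist_snd_le[of w z] by (auto simp: zw dist_real_def)
    then have "\<bar>lax (t, x) - lax (t', x')\<bar> \<le> e / 2"
      using \<rho>(2)[of t t' x x'] \<rho>(2)[of t' t x' x] z w(1) by (cases "t \<le> t'") (auto simp: zw abs_minus_commute)
    then show "dist (lax w) (lax z) < e" using e by (simp add: zw dist_real_def abs_minus_commute)
  qed
qed

text \<open>Compares the maximum point with points reached backward along the velocity
  \<open>H1 p\<close>, for which Young's inequality is an equality, and lets the length of the
  segment tend to 0.\<close>

lemma lax_subsolution:
  assumes d: "(\<phi> has_derivative (\<lambda>w. A * fst w + p * snd w)) (at (t, x))" and t: "0 < t"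
    and mx: "\<forall>\<^sub>F w in nhds (t, x). lax w - \<phi> w \<le> lax (t, x) - \<phi> (t, x)"
  shows "A + H0 p + U t x \<le> 0"
proof -
  define v where "v = H1 p"
  define \<psi> where "\<psi> r = \<phi> (t - r, x - r * v)" for r
  have "((\<lambda>r. (t - r, x - r * v)) has_derivative (\<lambda>h. (- h, - (h * v)))) (at 0)"
    by (auto intro!: derivative_eq_intros)
  from has_derivative_compose[OF this, of \<phi> "\<lambda>w. A * fst w + p * snd w"] d
  have "(\<psi> has_real_derivative - (A + p * v)) (at 0)"
    unfolding has_field_derivative_def \<psi>_def by (auto elim!: has_derivative_eq_rhs simp: fun_eq_iff algebra_simps)
  then have "((\<lambda>r. (\<psi> r - \<psi> 0) / r) \<longlongrightarrow> - (A + p * v)) (at 0)" by (simp add: DERIV_def)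
  then have "((\<lambda>r. (\<psi> r - \<psi> 0) / r) \<longlongrightarrow> - (A + p * v)) (at_right 0)" unfolding filterlim_at_split by blast
  from tendsto_minus[OF this] have lim1: "((\<lambda>r. - ((\<psi> r - \<psi> 0) / r)) \<longlongrightarrow> A + p * v) (at_right 0)"
    by (simp only: minus_minus)
  have lim2: "((\<lambda>r. L0 v - U t x + 3 * K * r * (1 + \<bar>v\<bar>)) \<longlongrightarrow> L0 v - U t x + 3 * K * 0 * (1 + \<bar>v\<bar>)) (at_right 0)"
    by (intro tendsto_intros)
  have "((\<lambda>r. (t - r, x - r * v)) \<longlongrightarrow> (t - 0, x - 0 * v)) (at_right 0)" by (intro tendsto_intros)
  then have "filterlim (\<lambda>r. (t - r, x - r * v)) (nhds (t, x)) (at_right 0)" by simp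
  then have ev: "\<forall>\<^sub>F r in at_right 0. lax (t - r, x - r * v) - \<phi> (t - r, x - r * v) \<le> lax (t, x) - \<phi> (t, x)"
    by (rule eventually_compose_filterlim[OF mx])
  have "\<forall>\<^sub>F r in at_right 0. r \<in> {0<..<t}" using t by (intro eventually_at_right_real)
  with ev have "\<forall>\<^sub>F r in at_right 0. - ((\<psi> r - \<psi> 0) / r) \<le> L0 v - U t x + 3 * K * r * (1 + \<bar>v\<bar>)"
  proof eventually_elim
    case (elim r)
    have r: "0 < r" "r < t" using elim(2) by auto
    have "lax (t - r + r, x - r * v + r * v) \<le> lax (t - r, x - r * v) + seg (t - r) (x - r * v) r v"
      using r by (intro lax_seg) auto
    then have "\<psi> 0 - \<psi> r \<le> seg (t - r) (x - r * v) r v" using elim(1) by (simp add: \<psi>_def)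
    also have "\<dots> \<le> r * (L0 v - U t x + 3 * K * r * (1 + \<bar>v\<bar>))"
    proof -
      have "\<bar>U (t - r) (x - r * v) - U t x\<bar> \<le> K * (\<bar>t - r - t\<bar> + \<bar>x - r * v - x\<bar>)" by (rule U_lip)
      also have "\<dots> = K * r * (1 + \<bar>v\<bar>)" using r by (simp add: abs_mult algebra_simps)
      finally have "L0 v - U (t - r) (x - r * v) + 2 * K * r * (1 + \<bar>v\<bar>) \<le> L0 v - U t x + 3 * K * r * (1 + \<bar>v\<bar>)"
        by (simp add: algebra_simps abs_le_iff)
      then show ?thesis unfolding seg_def using r by (intro mult_left_mono) auto
    qed
    finally have "(\<psi> 0 - \<psi> r) / r \<le> L0 v - U t x + 3 * K * r * (1 + \<bar>v\<bar>)" using r(1) by (simp add: pos_divide_le_eq mult.commute)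
    then show ?case by (simp add: minus_divide_left)
  qed
  from tendsto_le[OF trivial_limit_at_right_real lim2 lim1 this] have "A + p * v \<le> L0 v - U t x" by simp
  then show ?thesis using L0_H1[of p] by (simp add: v_def)
qed

end

text \<open>Doubling of variables: the penalty ties the two base points together, so both equations are
  tested with the same momentum and \<open>H0\<close> cancels.\<close>
lemma comparison:
  fixes W S :: "real \<times> real \<Rightarrow> real"
  assumes Wc: "continuous_on ({0..2} \<times> UNIV) W" and Sc: "continuous_on UNIV S"
    and Wsh: "\<And>t x. 0 \<le> t \<Longrightarrow> W (t, x + 1) = W (t, x) + a" and Ssh: "\<And>t x. S (t, x + 1) = S (t, x) + a"
    and init: "\<And>x. W (0, x) \<le> S (0, x)"
    and Wsub: "\<And>C k \<alpha> \<beta> l \<tau> M b t x. 0 < t \<Longrightarrow> t < 2 \<Longrightarrow>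
       \<forall>\<^sub>F w in nhds (t, x). W w - barrier C k \<alpha> \<beta> l \<tau> M b w \<le> W (t, x) - barrier C k \<alpha> \<beta> l \<tau> M b (t, x) \<Longrightarrow>
       barrier_t C k \<alpha> \<beta> l \<tau> M b (t, x) + H0 (barrier_x k \<alpha> \<beta> (t, x)) + U t x \<le> 0"
    and Ssup: "\<And>C k \<alpha> \<beta> l \<tau> M b t x. 0 < t \<Longrightarrow>
       \<forall>\<^sub>F w in nhds (t, x). S w - barrier C k \<alpha> \<beta> l \<tau> M b w \<ge> S (t, x) - barrier C k \<alpha> \<beta> l \<tau> M b (t, x) \<Longrightarrow>
       barrier_t C k \<alpha> \<beta> l \<tau> M b (t, x) + H0 (barrier_x k \<alpha> \<beta> (t, x)) + U t x \<ge> 0"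
    and t1: "0 \<le> t1" "t1 \<le> 1"
  shows "W (t1, x1) \<le> S (t1, x1)"
proof (rule ccontr)
  assume neg: "\<not> ?thesis"
  define \<eta> where "\<eta> = (W (t1, x1) - S (t1, x1)) / 3"
  have \<eta>: "0 < \<eta>" using neg by (simp add: \<eta>_def)
  have Wsh': "W (t, x + of_int m) = W (t, x) + a * of_int m" if "0 \<le> t" for t x m
    using periodic_int[of "\<lambda>x. W (t, x) - a * x" x m] Wsh[OF that] by (simp add: algebra_simps)
  have Ssh': "S (t, x + of_int m) = S (t, x) + a * of_int m" for t x m
    using periodic_int[of "\<lambda>x. S (t, x) - a * x" x m] Ssh by (simp add: algebra_simps)
  \<comment> \<open>A point is ((\<open>t\<close>, \<open>x\<close>), (\<open>s\<close>,
    \<open>e\<close>)) with \<open>e\<close> the spatial offset between the two base points;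
    periodicity confines \<open>x\<close> to a period. Time runs to 2 although only times up to 1
    matter, so that the penalty beyond time 1 keeps the maximum away from the end.\<close>
  define Q where "Q = ({0..2::real} \<times> {0..1::real}) \<times> ({0..2::real} \<times> {-1..1::real})"
  have cQ: "compact Q" unfolding Q_def by (intro compact_Times) auto
  define D where "D q = W (fst q) - S (fst (snd q), snd (fst q) - snd (snd q))" for q :: "(real \<times> real) \<times> (real \<times> real)"
  have cD: "continuous_on Q D"
    unfolding D_def[abs_def] Q_def
    by (intro continuous_intros continuous_on_compose2[OF Wc] continuous_on_compose2[OF Sc]) auto
  have "compact (D ` Q)" by (rule compact_continuous_image[OF cD cQ])
  then obtain Bd where Bd: "\<And>q. q \<in> Q \<Longrightarrow> \<bar>D q\<bar> \<le> Bd"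
    unfolding compact_eq_bounded_closed bounded_iff by force
  have Bd0: "0 \<le> Bd" using Bd[of "((0, 0), (0, 0))"] by (auto simp: Q_def)
  have "uniformly_continuous_on ({0..2} \<times> {-1..2}) S"
    by (intro compact_uniformly_continuous continuous_on_subset[OF Sc] compact_Times) auto
  then obtain r1 where r1: "0 < r1" "\<And>z w. z \<in> {0..2} \<times> {-1..2} \<Longrightarrow> w \<in> {0..2} \<times> {-1..2} \<Longrightarrow> dist z w < r1 \<Longrightarrow> dist (S z) (S w) < \<eta> / 2"
    unfolding uniformly_continuous_on_def using \<eta> by (metis half_gt_zero)
  have "uniformly_continuous_on ({0..2} \<times> {0..1}) W"
    by (intro compact_uniformly_continuous continuous_on_subset[OF Wc] compact_Times) auto
  then obtain r2 where r2: "0 < r2" "\<And>z w. z \<in> {0..2} \<times> {0..1} \<Longrightarrow> w \<in> {0..2} \<times> {0..1} \<Longrightarrow> dist z w < r2 \<Longrightarrow> dist (W z) (W w) < \<eta> / 2"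
    unfolding uniformly_continuous_on_def using \<eta> by (metis half_gt_zero)
  \<comment> \<open>Half of \<open>r1\<close> is used because the distance between the two points
    tested in \<open>S\<close> is at most \<open>\<bar>s\<bar> + \<bar>e\<bar>\<close>.\<close>
  define \<rho> where "\<rho> = Min {r1 / 2, r2, 1 / 2, \<eta> / (4 * (K + 1))}"
  have min: "\<rho> \<le> z" if "z \<in> {r1 / 2, r2, 1 / 2, \<eta> / (4 * (K + 1))}" for z
    unfolding \<rho>_def using that by (intro Min_le) auto
  have \<rho>: "0 < \<rho>" "\<rho> \<le> r1 / 2" "\<rho> \<le> r2" "\<rho> \<le> 1 / 2" "\<rho> \<le> \<eta> / (4 * (K + 1))"
    using r1(1) r2(1) \<eta> K_nonneg by (simp add: \<rho>_def) (rule min; simp)+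
  have K\<rho>: "K * (2 * \<rho>) < \<eta>"
  proof -
    have "K * (2 * \<rho>) \<le> (K + 1) * (2 * (\<eta> / (4 * (K + 1))))" using \<rho> K_nonneg by (intro mult_mono) auto
    also have "\<dots> = \<eta> / 2" using K_nonneg by (simp add: divide_simps)
    finally show ?thesis using \<eta> by simp
  qed
  define k where "k = Bd / \<rho>\<^sup>2 + 1"
  define M where "M = 4 * Bd + 1"
  have k: "0 < k" "k * \<rho>\<^sup>2 = Bd + \<rho>\<^sup>2" using Bd0 \<rho> by (auto simp: k_def field_simps add_nonneg_pos)
  have M: "0 < M" using Bd0 by (simp add: M_def)
  \<comment> \<open>The term \<open>\<eta> * t\<close> makes the subsolution strict and is the
    source of the contradiction. Since \<open>k * \<rho>\<^sup>2\<close> exceeds \<open>Bd\<close>,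
    the offsets \<open>e\<close> and \<open>t - s\<close> are below \<open>\<rho>\<close> at the
    maximum.\<close>
  define \<Psi> where "\<Psi> q = D q - k * ((snd (snd q))\<^sup>2 + (fst (fst q) - fst (snd q))\<^sup>2) - \<eta> * fst (fst q) - M * (max 0 (fst (fst q) - 1))\<^sup>2" for q
  have "continuous_on Q \<Psi>" unfolding \<Psi>_def[abs_def] by (intro continuous_intros cD)
  moreover have "Q \<noteq> {}" by (auto simp: Q_def)
  ultimately obtain q where q: "q \<in> Q" and qmax: "\<And>q'. q' \<in> Q \<Longrightarrow> \<Psi> q' \<le> \<Psi> q"
    using continuous_attains_sup[OF cQ] by metis
  obtain t x s e where qe: "q = ((t, x), (s, e))" by (metis prod.collapse)
  have qb: "0 \<le> t" "t \<le> 2" "0 \<le> x" "x \<le> 1" "0 \<le> s" "s \<le> 2" "\<bar>e\<bar> \<le> 1" using q by (auto simp: qe Q_def)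
  \<comment> \<open>A common integer shift of both base points leaves \<open>D\<close> unchanged, so
    the maximum over one period is global in space and provides genuine local extrema.\<close>
  have gmax: "\<Psi> ((t', x'), (s', e')) \<le> \<Psi> q" if "0 \<le> t'" "t' \<le> 2" "0 \<le> s'" "s' \<le> 2" "\<bar>e'\<bar> \<le> 1" for t' x' s' e'
  proof -
    define m where "m = - \<lfloor>x'\<rfloor>"
    define w where "w = x' + of_int m"
    have "0 \<le> w" "w \<le> 1" unfolding w_def m_def by linarith+
    then have "\<Psi> ((t', w), (s', e')) \<le> \<Psi> q" using that by (intro qmax) (auto simp: Q_def)
    moreover have eqw: "w - e' = x' - e' + of_int m" by (simp add: w_def)
    have "D ((t', w), (s', e')) = D ((t', x'), (s', e'))"
      unfolding D_def fst_conv snd_conv eqw unfolding w_def Ssh' Wsh'[OF that(1)] by simp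
    ultimately show ?thesis by (simp add: \<Psi>_def)
  qed
  have big: "2 * \<eta> \<le> \<Psi> q"
  proof -
    have "\<eta> * t1 \<le> \<eta>" using \<eta> t1 by (simp add: mult_left_le)
    then have "2 * \<eta> \<le> \<Psi> ((t1, x1), (t1, 0))" using t1 by (simp add: \<Psi>_def D_def \<eta>_def)
    then show ?thesis using gmax[of t1 t1 0 x1] t1 by simp
  qed
  have pen: "k * (e\<^sup>2 + (t - s)\<^sup>2) + \<eta> * t + M * (max 0 (t - 1))\<^sup>2 + 2 * \<eta> \<le> D q"
    using big by (simp add: \<Psi>_def qe)
  have nn: "0 \<le> k * (e\<^sup>2 + (t - s)\<^sup>2)" "0 \<le> \<eta> * t" "0 \<le> M * (max 0 (t - 1))\<^sup>2"
    using k(1) \<eta> qb M by auto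
  have Dq: "D q \<le> Bd" using Bd[OF q] by simp
  have sq: "e\<^sup>2 + (t - s)\<^sup>2 < \<rho>\<^sup>2"
  proof -
    have "k * (e\<^sup>2 + (t - s)\<^sup>2) < k * \<rho>\<^sup>2" using pen nn Dq \<eta> k(2) \<rho>(1) by (smt (verit) zero_less_power)
    then show ?thesis using k(1) by simp
  qed
  have "e\<^sup>2 < \<rho>\<^sup>2" "(t - s)\<^sup>2 < \<rho>\<^sup>2" using sq by (smt (verit) zero_le_power2)+
  then have e: "\<bar>e\<bar> < \<rho>" and ts: "\<bar>t - s\<bar> < \<rho>" using \<rho>(1) power2_less_imp_less[of "\<bar>e\<bar>" \<rho>] power2_less_imp_less[of "\<bar>t - s\<bar>" \<rho>] by simp_all
  have t2: "t < 3 / 2"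
  proof (rule ccontr)
    assume "\<not> t < 3 / 2"
    then have "(1 / 2)\<^sup>2 \<le> (max 0 (t - 1))\<^sup>2" by (intro power_mono) auto
    from mult_left_mono[OF this less_imp_le[OF M]] have "M * (1 / 4) \<le> M * (max 0 (t - 1))\<^sup>2"
      by (simp add: power_divide)
    moreover have "M * (1 / 4) = Bd + 1 / 4" by (simp add: M_def)
    ultimately show False using pen nn Dq \<eta> by linarith
  qed
  have s2: "s < 2" using t2 ts \<rho>(4) by linarith
  have Sclose: "S (0, x) - S (s, x - e) < \<eta> / 2" if "s < \<rho>"
  proof -
    have "dist (0, x) (s, x - e) \<le> \<bar>s\<bar> + \<bar>e\<bar>"
      unfolding dist_prod_def by (rule order_trans[OF sqrt_sum_squares_le_sum_abs]) (auto simp: dist_real_def)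
    then have "dist (S (0, x)) (S (s, x - e)) < \<eta> / 2" using that e \<rho>(2,4) qb by (intro r1(2)) auto
    then show ?thesis unfolding dist_real_def by linarith
  qed
  have t0: "0 < t"
  proof (rule ccontr)
    assume "\<not> 0 < t"
    then have "t = 0" using qb by simp
    then have "D q \<le> S (0, x) - S (s, x - e)" using init[of x] by (simp add: D_def qe)
    moreover have "s < \<rho>" using ts \<open>t = 0\<close> by linarith
    ultimately show False using Sclose pen nn \<eta> by linarith
  qed
  have s0: "0 < s"
  proof (rule ccontr)
    assume "\<not> 0 < s"
    then have "s = 0" using qb by simp
    have "dist (t, x) (0, x) = \<bar>t\<bar>" by (simp add: dist_prod_def dist_real_def)
    then have "dist (W (t, x)) (W (0, x)) < \<eta> / 2" using ts \<open>s = 0\<close> \<rho>(3) qb by (intro r2(2)) auto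
    then have "D q \<le> S (0, x) + \<eta> / 2 - S (s, x - e)" 
      using init[of x] unfolding D_def qe dist_real_def fst_conv snd_conv by linarith
    moreover have "s < \<rho>" using \<rho>(1) \<open>s = 0\<close> by linarith
    ultimately show False using Sclose pen nn \<eta> by linarith
  qed
  define y where "y = x - e"
  have "\<forall>\<^sub>F w in nhds (t, x). W w - barrier \<eta> k y 0 k s M 1 w \<le> W (t, x) - barrier \<eta> k y 0 k s M 1 (t, x)"
    unfolding eventually_nhds
  proof (intro exI conjI ballI)
    let ?O = "{w :: real \<times> real. 0 < fst w \<and> fst w < 2 \<and> -1 < snd w - y \<and> snd w - y < 1}"
    show "open ?O" by (intro open_Collect_conj open_Collect_less continuous_intros)
    show "(t, x) \<in> ?O" using t0 t2 e \<rho>(4) by (auto simp: y_def)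
    fix w assume w: "w \<in> ?O"
    have "\<Psi> ((fst w, snd w), (s, snd w - y)) \<le> \<Psi> q" using w qb by (intro gmax) auto
    then show "W w - barrier \<eta> k y 0 k s M 1 w \<le> W (t, x) - barrier \<eta> k y 0 k s M 1 (t, x)"
      by (simp add: \<Psi>_def D_def qe barrier_def y_def algebra_simps)
  qed
  then have sub: "barrier_t \<eta> k y 0 k s M 1 (t, x) + H0 (barrier_x k y 0 (t, x)) + U t x \<le> 0"
    using t0 t2 by (intro Wsub) auto
  have "\<forall>\<^sub>F w in nhds (s, y). S w - barrier 0 (- k) x 0 (- k) t 0 0 w \<ge> S (s, y) - barrier 0 (- k) x 0 (- k) t 0 0 (s, y)"
    unfolding eventually_nhds
  proof (intro exI conjI ballI)
    let ?O = "{w :: real \<times> real. 0 < fst w \<and> fst w < 2 \<and> -1 < x - snd w \<and> x - snd w < 1}"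
    show "open ?O" by (intro open_Collect_conj open_Collect_less continuous_intros)
    show "(s, y) \<in> ?O" using s0 s2 e \<rho>(4) by (auto simp: y_def)
    fix w assume w: "w \<in> ?O"
    have "\<Psi> ((t, x), (fst w, x - snd w)) \<le> \<Psi> q" using w qb by (intro gmax) auto
    then show "S w - barrier 0 (- k) x 0 (- k) t 0 0 w \<ge> S (s, y) - barrier 0 (- k) x 0 (- k) t 0 0 (s, y)"
      by (simp add: \<Psi>_def D_def qe barrier_def y_def algebra_simps power2_commute)
  qed
  then have sup: "barrier_t 0 (- k) x 0 (- k) t 0 0 (s, y) + H0 (barrier_x (- k) x 0 (s, y)) + U s y \<ge> 0"
    using s0 by (intro Ssup) auto
  \<comment> \<open>Both tests have the same momentum and the same term
    \<open>2 * k * (t - s)\<close>; subtracting leaves \<open>\<eta>\<close> bounded by a difference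
    of \<open>U\<close> at points closer than \<open>2 * \<rho>\<close>.\<close>
  have "barrier_x (- k) x 0 (s, y) = barrier_x k y 0 (t, x)" by (simp add: barrier_x_def algebra_simps)
  moreover have "barrier_t 0 (- k) x 0 (- k) t 0 0 (s, y) = 2 * k * (t - s)" by (simp add: barrier_t_def algebra_simps)
  moreover have "barrier_t \<eta> k y 0 k s M 1 (t, x) = \<eta> + 2 * k * (t - s) + 2 * M * max 0 (t - 1)" by (simp add: barrier_t_def)
  moreover have "0 \<le> 2 * M * max 0 (t - 1)" using M by simp
  ultimately have "\<eta> \<le> U s y - U t x" using sub sup by simp
  also have "\<dots> \<le> K * (\<bar>s - t\<bar> + \<bar>y - x\<bar>)" using U_lip[of s y t x] by linarith
  also have "\<dots> \<le> K * (2 * \<rho>)" using ts e by (intro mult_left_mono K_nonneg) (auto simp: y_def abs_minus_commute)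
  finally show False using K\<rho> by simp
qed

text \<open>Comparison gives \<open>lax S \<le> S\<close>, hence polygons of nearly optimal cost.
  The minimum over starting points is attained only later, by coercivity of the action.\<close>

theorem lax_oleinik:
  assumes vs: "viscosity_solution H0 V S" and sh: "\<And>t x. S (t, x + 1) = S (t, x) + a"
    and t: "0 \<le> t" "t \<le> 1" and e: "0 < e"
  obtains c where "reach (\<lambda>y c. c = S (0, y)) t x c" "c < S (t, x) + e"
proof -
  have cont: "continuous_on UNIV S" using vs by (simp add: viscosity_solution_def)
  note sg = subsolution_segment[OF vs]
  have "lax S (t, x) \<le> S (t, x)"
  proof (rule comparison[where W = "lax S" and a = a, OF lax_cont[OF cont sh sg] cont lax_shift[OF cont sh sg] sh _ _ _ t])
    show "lax S (0, x) \<le> S (0, x)" for x using lax_init[OF cont sh sg] by simp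
  next
    fix C k \<alpha> \<beta> l \<tau> M b t x :: real
    assume "0 < t" "\<forall>\<^sub>F w in nhds (t, x). lax S w - barrier C k \<alpha> \<beta> l \<tau> M b w \<le> lax S (t, x) - barrier C k \<alpha> \<beta> l \<tau> M b (t, x)"
    then show "barrier_t C k \<alpha> \<beta> l \<tau> M b (t, x) + H0 (barrier_x k \<alpha> \<beta> (t, x)) + U t x \<le> 0"
      by (intro lax_subsolution[OF cont sh sg barrier_deriv])
  next
    fix C k \<alpha> \<beta> l \<tau> M b t x :: real
    assume "\<forall>\<^sub>F w in nhds (t, x). S w - barrier C k \<alpha> \<beta> l \<tau> M b w \<ge> S (t, x) - barrier C k \<alpha> \<beta> l \<tau> M b (t, x)"
    then have "partial_t (barrier C k \<alpha> \<beta> l \<tau> M b) (t, x) + H0 (partial_x (barrier C k \<alpha> \<beta> l \<tau> M b) (t, x)) + V (t, x) \<ge> 0"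
      using vs barrier_C1(1) unfolding viscosity_solution_def by blast
    then show "barrier_t C k \<alpha> \<beta> l \<tau> M b (t, x) + H0 (barrier_x k \<alpha> \<beta> (t, x)) + U t x \<ge> 0"
      unfolding barrier_C1 by simp
  qed
  then have "\<not> S (t, x) + e \<le> lax S (t, x)" using e by simp
  then show thesis using lax_ge[OF cont sh sg t(1), of x "S (t, x) + e"] that by fastforce
qed

text \<open>Subtracting a constant preserves the subsolution test, so \<open>comparison\<close>
  applies to \<open>S' - c\<close>. Exchanging the roles gives equality up to the constant.\<close>

lemma viscosity_unique:
  assumes vs: "viscosity_solution H0 V S" and vs': "viscosity_solution H0 V S'"
    and sh: "\<And>t x. S (t, x + 1) = S (t, x) + a" and sh': "\<And>t x. S' (t, x + 1) = S' (t, x) + a"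
    and init: "\<And>x. S' (0, x) = S (0, x) + c" and t: "0 \<le> t" "t \<le> 1"
  shows "S' (t, x) \<le> S (t, x) + c"
proof -
  have cont: "continuous_on UNIV S" "continuous_on UNIV S'" using vs vs' by (simp_all add: viscosity_solution_def)
  have "(\<lambda>z. S' z - c) (t, x) \<le> S (t, x)"
  proof (rule comparison[where W = "\<lambda>z. S' z - c" and a = a])
    show "continuous_on ({0..2} \<times> UNIV) (\<lambda>z. S' z - c)"
      by (intro continuous_intros continuous_on_subset[OF cont(2)]) auto
  next
    fix C k \<alpha> \<beta> l \<tau> M b t x :: real
    assume "\<forall>\<^sub>F w in nhds (t, x). S' w - c - barrier C k \<alpha> \<beta> l \<tau> M b w \<le> S' (t, x) - c - barrier C k \<alpha> \<beta> l \<tau> M b (t, x)"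
    then have "\<forall>\<^sub>F w in nhds (t, x). S' w - barrier C k \<alpha> \<beta> l \<tau> M b w \<le> S' (t, x) - barrier C k \<alpha> \<beta> l \<tau> M b (t, x)"
      by (rule eventually_mono) simp
    then have "partial_t (barrier C k \<alpha> \<beta> l \<tau> M b) (t, x) + H0 (partial_x (barrier C k \<alpha> \<beta> l \<tau> M b) (t, x)) + V (t, x) \<le> 0"
      using vs' barrier_C1(1) unfolding viscosity_solution_def by blast
    then show "barrier_t C k \<alpha> \<beta> l \<tau> M b (t, x) + H0 (barrier_x k \<alpha> \<beta> (t, x)) + U t x \<le> 0"
      unfolding barrier_C1 by simp
  next
    fix C k \<alpha> \<beta> l \<tau> M b t x :: real
    assume "\<forall>\<^sub>F w in nhds (t, x). S w - barrier C k \<alpha> \<beta> l \<tau> M b w \<ge> S (t, x) - barrier C k \<alpha> \<beta> l \<tau> M b (t, x)"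
    then have "partial_t (barrier C k \<alpha> \<beta> l \<tau> M b) (t, x) + H0 (partial_x (barrier C k \<alpha> \<beta> l \<tau> M b) (t, x)) + V (t, x) \<ge> 0"
      using vs barrier_C1(1) unfolding viscosity_solution_def by blast
    then show "barrier_t C k \<alpha> \<beta> l \<tau> M b (t, x) + H0 (barrier_x k \<alpha> \<beta> (t, x)) + U t x \<ge> 0"
      unfolding barrier_C1 by simp
  qed (use cont sh sh' init t in auto)
  then show ?thesis by simp
qed

end

section \<open>The minimal action and the main theorem\<close>

lemma lipschitz_imp_abs_continuous_on:
  assumes C: "0 \<le> C" and lip: "\<And>u v. u \<in> {a..b} \<Longrightarrow> v \<in> {a..b} \<Longrightarrow> \<bar>f u - f v\<bar> \<le> C * \<bar>u - v\<bar>"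
  shows "abs_continuous_on a b f"
  unfolding abs_continuous_on_def
proof (intro allI impI)
  fix \<epsilon> :: real assume \<epsilon>: "0 < \<epsilon>"
  show "\<exists>\<delta>>0. \<forall>D. finite D \<longrightarrow> (\<forall>(u, v)\<in>D. a \<le> u \<and> u \<le> v \<and> v \<le> b) \<longrightarrow>
          disjoint_family_on (\<lambda>(u, v). {u<..<v}) D \<longrightarrow> (\<Sum>(u, v)\<in>D. v - u) < \<delta> \<longrightarrow> (\<Sum>(u, v)\<in>D. \<bar>f v - f u\<bar>) < \<epsilon>"
  proof (intro exI[of _ "\<epsilon> / (C + 1)"] conjI allI impI)
    show "0 < \<epsilon> / (C + 1)" using \<epsilon> C by simp
    fix D assume D: "\<forall>(u, v)\<in>D. a \<le> u \<and> u \<le> v \<and> v \<le> b" and l: "(\<Sum>(u, v)\<in>D. v - u) < \<epsilon> / (C + 1)"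
    have "(\<Sum>(u, v)\<in>D. \<bar>f v - f u\<bar>) \<le> (\<Sum>(u, v)\<in>D. (C + 1) * (v - u))"
    proof (rule sum_mono, clarify)
      fix u v assume "(u, v) \<in> D"
      then have uv: "a \<le> u" "u \<le> v" "v \<le> b" using D by auto
      then have "\<bar>f v - f u\<bar> \<le> C * (v - u)" using lip[of v u] by simp
      also have "\<dots> \<le> (C + 1) * (v - u)" using uv by (intro mult_right_mono) auto
      finally show "\<bar>f v - f u\<bar> \<le> (C + 1) * (v - u)" .
    qed
    also have "\<dots> = (C + 1) * (\<Sum>(u, v)\<in>D. v - u)" by (simp add: sum_distrib_left case_prod_beta)
    also have "\<dots> < \<epsilon>" using l C by (simp add: pos_less_divide_eq mult.commute)
    finally show "(\<Sum>(u, v)\<in>D. \<bar>f v - f u\<bar>) < \<epsilon>" .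
  qed
qed

lemma sum_integral_pieces:
  fixes f :: "real \<Rightarrow> real"
  assumes f: "f integrable_on {0..1}" and n: "0 < n" and m: "m \<le> n"
  shows "(\<Sum>j<m. integral {real j / real n..real (Suc j) / real n} f) = integral {0..real m / real n} f"
  using m
proof (induction m)
  case (Suc m)
  have "f integrable_on {0..real (Suc m) / real n}"
    by (rule integrable_on_subinterval[OF f]) (use Suc.prems n in auto)
  then have "integral {0..real m / real n} f + integral {real m / real n..real (Suc m) / real n} f = integral {0..real (Suc m) / real n} f"
    by (intro Henstock_Kurzweil_Integration.integral_combine) (use n in \<open>auto simp: divide_right_mono\<close>)
  then show ?case using Suc by simp
qed simp

context hamiltonian
begin

section \<open>Between polygonal chains and admissible curves\<close>

lemma V_cont: "continuous_on UNIV V"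
proof -
  \<comment> \<open>Each coordinate distance is at most the Euclidean one, so the sum-norm constant
    doubles; halving \<open>U\<close> compensates for this.\<close>
  have "(K + 1)-lipschitz_on UNIV (\<lambda>z :: real \<times> real. U (fst z) (snd z) / 2)"
  proof (rule lipschitz_onI)
    fix z w :: "real \<times> real"
    have "\<bar>U (fst z) (snd z) - U (fst w) (snd w)\<bar> \<le> K * (dist z w + dist z w)"
      by (rule order_trans[OF U_lip mult_left_mono[OF add_mono K_nonneg]])
        (use dist_fst_le[of z w] dist_snd_le[of z w] in \<open>auto simp: dist_real_def\<close>)
    also have "\<dots> \<le> 2 * ((K + 1) * dist z w)" by (simp add: algebra_simps)
    finally show "dist (U (fst z) (snd z) / 2) (U (fst w) (snd w) / 2) \<le> (K + 1) * dist z w"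
      by (simp add: dist_real_def diff_divide_distrib[symmetric])
  qed (use K_nonneg in simp)
  then have "continuous_on UNIV (\<lambda>z :: real \<times> real. 2 * (U (fst z) (snd z) / 2))"
    by (intro continuous_intros lipschitz_on_continuous_on)
  then show ?thesis by (simp add: case_prod_beta)
qed

text \<open>Realizes a formal polygon as a Lipschitz curve. The correction term of
  \<open>seg\<close> dominates the variation of \<open>U\<close> along a segment, and the values at
  the junction times form a null set.\<close>

lemma reach_curve:
  "reach Q t x c \<Longrightarrow> \<exists>\<xi> c0 C. Q (\<xi> 0) c0 \<and> \<xi> t = x \<and> 0 \<le> C \<and>
     (\<forall>u\<in>{0..t}. \<forall>v\<in>{0..t}. \<bar>\<xi> u - \<xi> v\<bar> \<le> C * \<bar>u - v\<bar>) \<and>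
     lagrangian H0 V \<xi> absolutely_integrable_on {0..t} \<and> c0 + integral {0..t} (lagrangian H0 V \<xi>) \<le> c"
proof (induction rule: reach.induct)
  case (reach_init y c)
  have "lagrangian H0 V (\<lambda>_. y) absolutely_integrable_on {0..0}"
    by (rule absolutely_integrable_spike[where f = "\<lambda>_. 0 :: real" and S = "{0}"])
      (auto intro: absolutely_integrable_continuous_real)
  then show ?case using reach_init by (intro exI[of _ "\<lambda>_. y"] exI[of _ c] exI[of _ 0]) auto
next
  case (reach_step t x c r v)
  then obtain \<xi> c0 C where \<xi>: "Q (\<xi> 0) c0" "\<xi> t = x" "0 \<le> C"
     "\<And>u v. u \<in> {0..t} \<Longrightarrow> v \<in> {0..t} \<Longrightarrow> \<bar>\<xi> u - \<xi> v\<bar> \<le> C * \<bar>u - v\<bar>"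
     "lagrangian H0 V \<xi> absolutely_integrable_on {0..t}" "c0 + integral {0..t} (lagrangian H0 V \<xi>) \<le> c"
    by blast
  have t: "0 \<le> t" using reach_nonneg[OF reach_step(1)] .
  have r: "0 < r" by fact
  define \<eta> where "\<eta> \<tau> = (if \<tau> \<le> t then \<xi> \<tau> else x + (\<tau> - t) * v)" for \<tau>
  define g where "g \<tau> = L0 v - U \<tau> (x + (\<tau> - t) * v)" for \<tau>
  have l1: "lagrangian H0 V \<eta> \<tau> = lagrangian H0 V \<xi> \<tau>" if "\<tau> < t" for \<tau>
  proof -
    have "\<forall>\<^sub>F s in nhds \<tau>. \<eta> s = \<xi> s"
      using eventually_nhds_in_open[of "{..<t}" \<tau>] that by (auto simp: \<eta>_def elim!: eventually_mono)
    then have "deriv \<eta> \<tau> = deriv \<xi> \<tau>" by (intro deriv_cong_ev) auto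
    then show ?thesis using that by (simp add: lagrangian_def \<eta>_def)
  qed
  have l2: "lagrangian H0 V \<eta> \<tau> = g \<tau>" if "t < \<tau>" for \<tau>
  proof -
    have "\<forall>\<^sub>F s in nhds \<tau>. \<eta> s = x + (s - t) * v"
      using eventually_nhds_in_open[of "{t<..}" \<tau>] that by (auto simp: \<eta>_def elim!: eventually_mono)
    then have "deriv \<eta> \<tau> = deriv (\<lambda>s. x + (s - t) * v) \<tau>" by (intro deriv_cong_ev) auto
    also have "\<dots> = v" by (intro DERIV_imp_deriv) (auto intro!: derivative_eq_intros)
    finally show ?thesis using that by (simp add: lagrangian_def \<eta>_def g_def)
  qed
  have neg: "negligible {t}" by simp
  have i1: "lagrangian H0 V \<eta> absolutely_integrable_on {0..t}"
    by (rule absolutely_integrable_spike[OF \<xi>(5) neg]) (use l1 in auto)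
  have e1: "integral {0..t} (lagrangian H0 V \<xi>) = integral {0..t} (lagrangian H0 V \<eta>)"
    by (rule integral_spike[OF neg]) (use l1 in auto)
  have gc: "continuous_on {t..t + r} g"
  proof -
    have "continuous_on UNIV (\<lambda>\<tau>. V (\<tau>, x + (\<tau> - t) * v))"
      by (rule continuous_on_compose2[OF V_cont]) (auto intro!: continuous_intros)
    then have "continuous_on {t..t + r} (\<lambda>\<tau>. V (\<tau>, x + (\<tau> - t) * v))" by (rule continuous_on_subset) simp
    then show ?thesis unfolding g_def by (auto intro!: continuous_intros)
  qed
  have i2: "lagrangian H0 V \<eta> absolutely_integrable_on {t..t + r}"
    by (rule absolutely_integrable_spike[OF absolutely_integrable_continuous_real[OF gc] neg]) (use l2 in auto)
  have e2: "integral {t..t + r} g = integral {t..t + r} (lagrangian H0 V \<eta>)"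
    by (rule integral_spike[OF neg]) (use l2 in auto)
  have un: "{0..t} \<union> {t..t + r} = {0..t + r}" using t r by auto
  have i: "lagrangian H0 V \<eta> absolutely_integrable_on {0..t + r}"
    using set_integrable_Un[OF i1 i2] by (simp add: un)
  have "integral {0..t} (lagrangian H0 V \<eta>) + integral {t..t + r} (lagrangian H0 V \<eta>) = integral {0..t + r} (lagrangian H0 V \<eta>)"
    by (rule Henstock_Kurzweil_Integration.integral_combine) (use t r i set_lebesgue_integral_eq_integral(1) in auto)
  moreover have "integral {t..t + r} g \<le> seg t x r v"
  proof -
    have "integral {t..t + r} g \<le> integral {t..t + r} (\<lambda>_. L0 v - U t x + 2 * K * r * (1 + \<bar>v\<bar>))"
    proof (rule integral_le)
      show "g integrable_on {t..t + r}" using gc by (rule integrable_continuous_interval)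
      fix \<tau> assume \<tau>: "\<tau> \<in> {t..t + r}"
      have "\<bar>U \<tau> (x + (\<tau> - t) * v) - U t x\<bar> \<le> K * (\<bar>\<tau> - t\<bar> + \<bar>x + (\<tau> - t) * v - x\<bar>)" by (rule U_lip)
      also have "\<dots> \<le> K * (r + r * \<bar>v\<bar>)"
        using \<tau> by (intro mult_left_mono add_mono K_nonneg) (auto simp: abs_mult mult_right_mono)
      also have "\<dots> = K * r * (1 + \<bar>v\<bar>)" by (simp add: algebra_simps)
      also have "\<dots> \<le> 2 * (K * r * (1 + \<bar>v\<bar>))" using K_nonneg r by simp
      finally show "g \<tau> \<le> L0 v - U t x + 2 * K * r * (1 + \<bar>v\<bar>)" unfolding g_def by (simp add: abs_le_iff)
    qed (rule integrable_const_ivl)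
    also have "\<dots> = seg t x r v" using r by (simp add: seg_def)
    finally show ?thesis .
  qed
  ultimately have "c0 + integral {0..t + r} (lagrangian H0 V \<eta>) \<le> c + seg t x r v" using \<xi>(6) e1 e2 by linarith
  moreover have "\<bar>\<eta> u - \<eta> w\<bar> \<le> (C + \<bar>v\<bar>) * \<bar>u - w\<bar>" if uw: "u \<in> {0..t + r}" "w \<in> {0..t + r}" for u w
  proof -
    have *: "\<bar>\<eta> u - \<eta> w\<bar> \<le> (C + \<bar>v\<bar>) * \<bar>u - w\<bar>" if "0 \<le> u" "u \<le> w" for u w
    proof -
      consider "w \<le> t" | "t < u" | "u \<le> t" "t < w" by linarith
      then show ?thesis
      proof cases
        case 1
        then have "\<bar>\<eta> u - \<eta> w\<bar> \<le> C * \<bar>u - w\<bar>" using that \<xi>(4)[of u w] by (simp add: \<eta>_def)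
        also have "\<dots> \<le> (C + \<bar>v\<bar>) * \<bar>u - w\<bar>" by (intro mult_right_mono) auto
        finally show ?thesis .
      next
        case 2
        then have "\<eta> u - \<eta> w = (u - w) * v" using that by (simp add: \<eta>_def algebra_simps)
        then have "\<bar>\<eta> u - \<eta> w\<bar> = \<bar>v\<bar> * \<bar>u - w\<bar>" by (simp add: abs_mult mult.commute)
        also have "\<dots> \<le> (C + \<bar>v\<bar>) * \<bar>u - w\<bar>" using \<xi>(3) by (intro mult_right_mono) auto
        finally show ?thesis .
      next
        case 3
        have "\<bar>\<xi> u - \<xi> t\<bar> \<le> C * \<bar>u - t\<bar>" using that 3 t by (intro \<xi>(4)) auto
        moreover have "\<eta> u - \<eta> w = (\<xi> u - \<xi> t) - (w - t) * v" using 3 \<xi>(2) by (simp add: \<eta>_def)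
        moreover have "\<bar>(w - t) * v\<bar> = \<bar>v\<bar> * \<bar>w - t\<bar>" by (simp add: abs_mult mult.commute)
        ultimately have "\<bar>\<eta> u - \<eta> w\<bar> \<le> C * \<bar>u - t\<bar> + \<bar>v\<bar> * \<bar>w - t\<bar>" by linarith
        also have "\<dots> \<le> C * \<bar>u - w\<bar> + \<bar>v\<bar> * \<bar>u - w\<bar>" using 3 \<xi>(3) by (intro add_mono mult_left_mono) auto
        finally show ?thesis by (simp add: algebra_simps)
      qed
    qed
    show ?thesis using *[of u w] *[of w u] uw by (cases "u \<le> w") (auto simp: abs_minus_commute)
  qed
  moreover have "\<eta> 0 = \<xi> 0" "\<eta> (t + r) = x + r * v" using t r by (auto simp: \<eta>_def)
  ultimately show ?case using \<xi>(1,3) i by (intro exI[of _ \<eta>] exI[of _ c0] exI[of _ "C + \<bar>v\<bar>"]) auto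
qed

text \<open>Converts \<open>cost\<close> into segment costs; the correction terms add up to
  \<open>2 * K / n\<close> times one plus the variation of the chain.\<close>

lemma chain_reach:
  assumes Q: "Q (z 0) c0" and n: "0 < n"
  shows "reach Q 1 (z n) (c0 + cost n z + (2 * K / real n) * (1 + (\<Sum>j<n. \<bar>z (Suc j) - z j\<bar>)))"
proof -
  define h where "h = 1 / real n"
  have h: "0 < h" "h * real n = 1" using n by (auto simp: h_def)
  have "reach Q (real m * h) (z m) (c0 + (\<Sum>j<m. seg (real j * h) (z j) h (real n * (z (Suc j) - z j))))" for m
  proof (induction m)
    case 0
    then show ?case using Q by (auto intro: reach_init)
  next
    case (Suc m)
    have "h * (real n * (z (Suc m) - z m)) = z (Suc m) - z m" using h(2) by (simp add: mult.assoc[symmetric])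
    then show ?case using reach_step[OF Suc h(1), of "real n * (z (Suc m) - z m)"] by (simp add: algebra_simps)
  qed
  from this[of n] have "reach Q 1 (z n) (c0 + (\<Sum>j<n. seg (real j * h) (z j) h (real n * (z (Suc j) - z j))))"
    using h(2) by (simp add: mult.commute)
  moreover have "(\<Sum>j<n. seg (real j * h) (z j) h (real n * (z (Suc j) - z j))) = cost n z + (2 * K / real n) * (1 + (\<Sum>j<n. \<bar>z (Suc j) - z j\<bar>))"
  proof -
    have "seg (real j * h) (z j) h (real n * (z (Suc j) - z j)) =
        (1 / real n) * (L0 (real n * (z (Suc j) - z j)) - U (real j / real n) (z j)) + (2 * K * h) * (h + \<bar>z (Suc j) - z j\<bar>)" for j
    proof -
      have "h * \<bar>real n * (z (Suc j) - z j)\<bar> = \<bar>z (Suc j) - z j\<bar>" using h by (simp add: abs_mult mult.assoc[symmetric])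
      then have "h * (1 + \<bar>real n * (z (Suc j) - z j)\<bar>) = h + \<bar>z (Suc j) - z j\<bar>" by (simp add: distrib_left)
      moreover have "seg (real j * h) (z j) h (real n * (z (Suc j) - z j)) =
        h * (L0 (real n * (z (Suc j) - z j)) - U (real j * h) (z j)) + (2 * K * h) * (h * (1 + \<bar>real n * (z (Suc j) - z j)\<bar>))"
        by (simp add: seg_def algebra_simps)
      ultimately show ?thesis by (simp add: h_def)
    qed
    then have "(\<Sum>j<n. seg (real j * h) (z j) h (real n * (z (Suc j) - z j))) = cost n z + (\<Sum>j<n. (2 * K * h) * (h + \<bar>z (Suc j) - z j\<bar>))"
      by (simp only: cost_def sum.distrib)
    also have "(\<Sum>j<n. (2 * K * h) * (h + \<bar>z (Suc j) - z j\<bar>)) = (2 * K * h) * (real n * h + (\<Sum>j<n. \<bar>z (Suc j) - z j\<bar>))"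
      by (simp only: sum_distrib_left[symmetric] sum.distrib) simp
    finally show ?thesis using h(2) by (simp add: h_def mult.commute)
  qed
  ultimately show ?thesis by (simp add: add.assoc)
qed

lemma lagrangian_ge: "\<bar>deriv \<xi> \<tau>\<bar> - (LB 1 + B) \<le> lagrangian H0 V \<xi> \<tau>"
  using L0_superlinear[of 1 "deriv \<xi> \<tau>"] U_bound[of \<tau> "\<xi> \<tau>"] by (simp add: lagrangian_def abs_le_iff)

lemma admissible_integrable:
  assumes "\<xi> \<in> admissible_curves H0 V 0 y 1 x"
  shows "lagrangian H0 V \<xi> integrable_on {0..1}"
    "set_lebesgue_integral lebesgue {0..1} (lagrangian H0 V \<xi>) = integral {0..1} (lagrangian H0 V \<xi>)"
  using assms set_lebesgue_integral_eq_integral[of "{0..1}" "lagrangian H0 V \<xi>"] by (auto simp: admissible_curves_def)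

lemma action_lower:
  assumes "\<xi> \<in> admissible_curves H0 V 0 y 1 x"
  shows "- (LB 1 + B) \<le> integral {0..1} (lagrangian H0 V \<xi>)"
proof -
  have "integral {0..1::real} (\<lambda>_. - (LB 1 + B)) \<le> integral {0..1} (lagrangian H0 V \<xi>)"
  proof (rule integral_le[OF _ admissible_integrable(1)[OF assms]])
    fix \<tau> :: real
    show "- (LB 1 + B) \<le> lagrangian H0 V \<xi> \<tau>" using lagrangian_ge[of \<xi> \<tau>] abs_ge_zero[of "deriv \<xi> \<tau>"] by linarith
  qed (rule integrable_const_ivl)
  then show ?thesis by simp
qed

text \<open>Jensen's inequality on each interval of the partition, in the form of the tangent line of \<open>L0\<close> at
  the mean velocity.\<close>
lemma cost_le_action:
  assumes adm: "\<xi> \<in> admissible_curves H0 V 0 y 1 x" and n: "0 < n"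
  defines "A \<equiv> integral {0..1} (lagrangian H0 V \<xi>)"
  shows "cost n (\<lambda>j. \<xi> (real j / real n)) \<le> A + (K / real n) * (1 + A + LB 1 + B)"
proof -
  have AC: "abs_continuous_on 0 1 \<xi>" using adm by (simp add: admissible_curves_def)
  define g where "g \<tau> = lagrangian H0 V \<xi> \<tau>" for \<tau>
  have gi: "g integrable_on {0..1}" unfolding g_def using admissible_integrable(1)[OF adm] .
  have ftc: "(deriv \<xi> has_integral \<xi> v - \<xi> u) {u..v}" if "0 \<le> u" "u \<le> v" "v \<le> 1" for u v
    using abs_continuous_on_has_integral_deriv[OF abs_continuous_on_subinterval[OF AC that(1,3)] that(2)] .
  have di: "(\<lambda>\<tau>. \<bar>deriv \<xi> \<tau>\<bar>) integrable_on {0..1}"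
  proof -
    have "deriv \<xi> absolutely_integrable_on {0..1}"
    proof (rule absolutely_integrable_integrable_bound)
      show "norm (deriv \<xi> \<tau>) \<le> g \<tau> + (LB 1 + B)" for \<tau> using lagrangian_ge[of \<xi> \<tau>] by (simp add: g_def)
      show "deriv \<xi> integrable_on {0..1}" using ftc[of 0 1] by (auto simp: has_integral_integrable)
      show "(\<lambda>\<tau>. g \<tau> + (LB 1 + B)) integrable_on {0..1}" by (rule integrable_add[OF gi integrable_const_ivl])
    qed
    then show ?thesis by (simp add: absolutely_integrable_on_def)
  qed
  define h where "h = 1 / real n"
  have h: "0 < h" "h * real n = 1" using n by (auto simp: h_def)
  \<comment> \<open>The variation of the curve on a piece. The error from freezing \<open>U\<close>
    at the left end sums to \<open>K / n\<close> times one plus the total variation, and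
    \<open>lagrangian_ge\<close> bounds the latter by the action.\<close>
  define T where "T j = integral {real j / real n..real (Suc j) / real n} (\<lambda>\<tau>. \<bar>deriv \<xi> \<tau>\<bar>)" for j
  have piece: "h * (L0 (real n * (\<xi> (real (Suc j) / real n) - \<xi> (real j / real n))) - U (real j / real n) (\<xi> (real j / real n)))
      \<le> integral {real j / real n..real (Suc j) / real n} g + K * h * (h + T j)" if j: "j < n" for j
  proof -
    define u v where "u = real j / real n" and "v = real (Suc j) / real n"
    have uv: "0 \<le> u" "u \<le> v" "v \<le> 1" "v - u = h" using j n by (auto simp: u_def v_def h_def field_simps)
    have sub: "{u..v} \<subseteq> {0..1}" using uv by auto
    define q where "q = L1 (real n * (\<xi> v - \<xi> u))"
    have Tj: "T j = integral {u..v} (\<lambda>\<tau>. \<bar>deriv \<xi> \<tau>\<bar>)" by (simp add: T_def u_def v_def)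
    have osc: "\<bar>\<xi> \<tau> - \<xi> u\<bar> \<le> T j" if \<tau>: "\<tau> \<in> {u..v}" for \<tau>
    proof -
      have I: "(deriv \<xi> has_integral \<xi> \<tau> - \<xi> u) {u..\<tau>}" using ftc \<tau> uv by auto
      have "\<bar>\<xi> \<tau> - \<xi> u\<bar> = norm (integral {u..\<tau>} (deriv \<xi>))" using I by (simp add: integral_unique)
      also have "\<dots> \<le> integral {u..\<tau>} (\<lambda>\<tau>. \<bar>deriv \<xi> \<tau>\<bar>)"
        by (rule integral_norm_bound_integral) (use I di \<tau> uv in \<open>auto intro: has_integral_integrable integrable_on_subinterval\<close>)
      also have "\<dots> \<le> T j" unfolding Tj
        by (rule integral_subset_le) (use di \<tau> uv in \<open>auto intro: integrable_on_subinterval\<close>)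
      finally show ?thesis .
    qed
    have "((\<lambda>\<tau>. q * deriv \<xi> \<tau> - (H0 q + U u (\<xi> u) + K * (h + T j))) has_integral
        q * (\<xi> v - \<xi> u) - (v - u) * (H0 q + U u (\<xi> u) + K * (h + T j))) {u..v}"
      using has_integral_diff[OF has_integral_mult_right[OF ftc[OF uv(1-3)], of q] has_integral_const_real[of "H0 q + U u (\<xi> u) + K * (h + T j)" u v]] uv(2) by simp
    moreover have "(g has_integral integral {u..v} g) {u..v}"
      using integrable_on_subinterval[OF gi sub] by (rule integrable_integral)
    ultimately have "q * (\<xi> v - \<xi> u) - (v - u) * (H0 q + U u (\<xi> u) + K * (h + T j)) \<le> integral {u..v} g"
    proof (rule has_integral_le)
      fix \<tau> assume \<tau>: "\<tau> \<in> {u..v}"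
      have "\<bar>U \<tau> (\<xi> \<tau>) - U u (\<xi> u)\<bar> \<le> K * (\<bar>\<tau> - u\<bar> + \<bar>\<xi> \<tau> - \<xi> u\<bar>)" by (rule U_lip)
      also have "\<dots> \<le> K * (h + T j)" using osc[OF \<tau>] \<tau> uv by (intro mult_left_mono add_mono K_nonneg) auto
      finally show "q * deriv \<xi> \<tau> - (H0 q + U u (\<xi> u) + K * (h + T j)) \<le> g \<tau>"
        using young[of q "deriv \<xi> \<tau>"] by (simp add: g_def lagrangian_def abs_le_iff)
    qed
    moreover have "h * L0 (real n * (\<xi> v - \<xi> u)) = q * (\<xi> v - \<xi> u) - h * H0 q"
    proof -
      have "L0 (real n * (\<xi> v - \<xi> u)) = q * (real n * (\<xi> v - \<xi> u)) - H0 q" using L0_eq by (simp add: q_def)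
      then have "h * L0 (real n * (\<xi> v - \<xi> u)) = h * (q * (real n * (\<xi> v - \<xi> u)) - H0 q)" by (simp only:)
      also have "\<dots> = (h * real n) * (q * (\<xi> v - \<xi> u)) - h * H0 q" by (simp add: algebra_simps)
      finally show ?thesis using h(2) by simp
    qed
    ultimately show ?thesis unfolding u_def[symmetric] v_def[symmetric] uv(4) by (simp add: algebra_simps)
  qed
  have "cost n (\<lambda>j. \<xi> (real j / real n)) \<le> (\<Sum>j<n. integral {real j / real n..real (Suc j) / real n} g + K * h * (h + T j))"
    unfolding cost_def h_def[symmetric] using piece by (intro sum_mono) auto
  also have "\<dots> = A + K * h * (1 + (\<Sum>j<n. T j))"
    using sum_integral_pieces[OF gi n order_refl] n h by (simp add: sum.distrib sum_distrib_left[symmetric] A_def g_def[abs_def] mult.commute)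
  also have "(\<Sum>j<n. T j) = integral {0..1} (\<lambda>\<tau>. \<bar>deriv \<xi> \<tau>\<bar>)"
    unfolding T_def using sum_integral_pieces[OF di n order_refl] n by simp
  also have "A + K * h * (1 + integral {0..1} (\<lambda>\<tau>. \<bar>deriv \<xi> \<tau>\<bar>)) \<le> A + K * h * (1 + (A + (LB 1 + B)))"
  proof -
    have "integral {0..1} (\<lambda>\<tau>. \<bar>deriv \<xi> \<tau>\<bar>) \<le> integral {0..1} (\<lambda>\<tau>. g \<tau> + (LB 1 + B))"
    proof (rule integral_le[OF di])
      show "(\<lambda>\<tau>. g \<tau> + (LB 1 + B)) integrable_on {0..1}" by (rule integrable_add[OF gi integrable_const_ivl])
      show "\<bar>deriv \<xi> \<tau>\<bar> \<le> g \<tau> + (LB 1 + B)" for \<tau> using lagrangian_ge[of \<xi> \<tau>] by (simp add: g_def)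
    qed
    also have "\<dots> = A + (LB 1 + B)"
      using Henstock_Kurzweil_Integration.integral_add[OF gi integrable_const_ivl[of "LB 1 + B"]] by (simp add: A_def g_def[abs_def])
    finally show ?thesis using K_nonneg h by (intro add_left_mono mult_left_mono) auto
  qed
  finally show ?thesis by (simp add: h_def add.assoc)
qed

section \<open>The minimal action as the limit of the discrete costs\<close>

lemma min_action_le:
  assumes "\<xi> \<in> admissible_curves H0 V 0 y 1 x"
  shows "min_action H0 V 0 y 1 x \<le> integral {0..1} (lagrangian H0 V \<xi>)"
  unfolding min_action_def admissible_integrable(2)[OF assms, symmetric]
proof (rule cINF_lower[OF _ assms])
  show "bdd_below ((\<lambda>\<xi>. set_lebesgue_integral lebesgue {0..1} (lagrangian H0 V \<xi>)) ` admissible_curves H0 V 0 y 1 x)"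
    by (rule bdd_belowI2[of _ "- (LB 1 + B)"]) (use action_lower admissible_integrable(2) in fastforce)
qed

lemma min_action_le_reach:
  assumes "reach Q 1 x c"
  shows "\<exists>y c0. Q y c0 \<and> c0 + min_action H0 V 0 y 1 x \<le> c"
proof -
  obtain \<xi> c0 C where \<xi>: "Q (\<xi> 0) c0" "\<xi> 1 = x" "0 \<le> C"
     "\<And>u v. u \<in> {0..1} \<Longrightarrow> v \<in> {0..1} \<Longrightarrow> \<bar>\<xi> u - \<xi> v\<bar> \<le> C * \<bar>u - v\<bar>"
     "lagrangian H0 V \<xi> absolutely_integrable_on {0..1}" "c0 + integral {0..1} (lagrangian H0 V \<xi>) \<le> c"
    using reach_curve[OF assms] by blast
  have "\<xi> \<in> admissible_curves H0 V 0 (\<xi> 0) 1 x"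
    unfolding admissible_curves_def using \<xi> lipschitz_imp_abs_continuous_on[OF \<xi>(3,4)] by blast
  from min_action_le[OF this] show ?thesis using \<xi> by (intro exI[of _ "\<xi> 0"] exI[of _ c0]) auto
qed

lemma min_action_le_mcost:
  assumes n: "0 < n"
  shows "min_action H0 V 0 y 1 x \<le> mcost n y x + (2 * K / real n) * (1 + mcost n y x + LB 1 + B)"
proof -
  obtain z where z: "minchain n y x z" using minchain_exists[OF n] by blast
  have "reach (\<lambda>y' c. y' = y \<and> c = 0) 1 (z n) (0 + cost n z + (2 * K / real n) * (1 + (\<Sum>j<n. \<bar>z (Suc j) - z j\<bar>)))"
    using z by (intro chain_reach n) (simp add: minchain_def)
  from min_action_le_reach[OF this]
  have "min_action H0 V 0 y 1 x \<le> cost n z + (2 * K / real n) * (1 + (\<Sum>j<n. \<bar>z (Suc j) - z j\<bar>))"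
    using z by (auto simp: minchain_def)
  also have "(2 * K / real n) * (1 + (\<Sum>j<n. \<bar>z (Suc j) - z j\<bar>)) \<le> (2 * K / real n) * (1 + (cost n z + LB 1 + B))"
    using cost_variation[OF n, of z] K_nonneg by (intro mult_left_mono) auto
  finally show ?thesis using minchain_cost[OF z] by (simp add: add.assoc)
qed

lemma admissible_nonempty: "admissible_curves H0 V 0 y 1 x \<noteq> {}"
proof -
  have "reach (\<lambda>y' c. y' = y \<and> c = 0) (0 + 1) (y + 1 * (x - y)) (0 + seg 0 y 1 (x - y))"
    by (intro reach_step reach_init) auto
  from reach_curve[OF this] obtain \<xi> C where \<xi>: "\<xi> 0 = y" "\<xi> 1 = x" "0 \<le> C"
     "\<And>u v. u \<in> {0..1} \<Longrightarrow> v \<in> {0..1} \<Longrightarrow> \<bar>\<xi> u - \<xi> v\<bar> \<le> C * \<bar>u - v\<bar>"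
     "lagrangian H0 V \<xi> absolutely_integrable_on {0..1}" by auto
  then show ?thesis unfolding admissible_curves_def using lipschitz_imp_abs_continuous_on[OF \<xi>(3,4)] by blast
qed

text \<open>From above, a nearly optimal curve is sampled and \<open>cost_le_action\<close> applies.
  From below, a minimal chain is interpolated by a polygon, with an error controlled by its own
  cost.\<close>

lemma mcost_limit: "(\<lambda>n. mcost n y x) \<longlonglongrightarrow> min_action H0 V 0 y 1 x"
proof (rule order_tendstoI)
  let ?M = "min_action H0 V 0 y 1 x"
  fix b assume b: "?M < b"
  have "\<exists>\<xi>\<in>admissible_curves H0 V 0 y 1 x. set_lebesgue_integral lebesgue {0..1} (lagrangian H0 V \<xi>) < b"
    using cInf_lessD[OF _ b[unfolded min_action_def]] admissible_nonempty by fastforce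
  then obtain \<xi> where \<xi>: "\<xi> \<in> admissible_curves H0 V 0 y 1 x" "integral {0..1} (lagrangian H0 V \<xi>) < b"
    using admissible_integrable(2) by force
  define A where "A = integral {0..1} (lagrangian H0 V \<xi>)"
  have "(\<lambda>n. A + (K / real n) * (1 + A + LB 1 + B)) \<longlonglongrightarrow> A + 0 * (1 + A + LB 1 + B)"
    by (intro tendsto_intros lim_const_over_n)
  then have "\<forall>\<^sub>F n in sequentially. A + (K / real n) * (1 + A + LB 1 + B) < b"
    by (rule order_tendstoD(2)) (use \<xi>(2) in \<open>simp add: A_def\<close>)
  with eventually_gt_at_top[of 0] show "\<forall>\<^sub>F n in sequentially. mcost n y x < b"
  proof eventually_elim
    case (elim n)
    have "mcost n y x \<le> cost n (\<lambda>j. \<xi> (real j / real n))"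
      using \<xi>(1) elim(1) by (intro mcost_le) (auto simp: admissible_curves_def)
    then show ?case using cost_le_action[OF \<xi>(1) elim(1)] elim(2) by (simp add: A_def)
  qed
next
  let ?M = "min_action H0 V 0 y 1 x"
  fix b assume b: "b < ?M"
  have "(\<lambda>n. b + (2 * K / real n) * (1 + b + LB 1 + B)) \<longlonglongrightarrow> b + 0 * (1 + b + LB 1 + B)"
    by (intro tendsto_intros lim_const_over_n)
  then have "\<forall>\<^sub>F n in sequentially. b + (2 * K / real n) * (1 + b + LB 1 + B) < ?M"
    by (rule order_tendstoD(2)) (use b in simp)
  with eventually_gt_at_top[of 0] show "\<forall>\<^sub>F n in sequentially. b < mcost n y x"
  proof eventually_elim
    case (elim n)
    show ?case
    proof (rule ccontr)
      assume "\<not> b < mcost n y x"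
      then have "(2 * K / real n) * (1 + mcost n y x + LB 1 + B) \<le> (2 * K / real n) * (1 + b + LB 1 + B)"
        using K_nonneg by (intro mult_left_mono) auto
      then show False using min_action_le_mcost[OF elim(1), of y x] elim(2) \<open>\<not> b < mcost n y x\<close> by linarith
    qed
  qed
qed

lemma limit_action_min_action: "limit_action H0 H1 U Ux B K K2 (\<lambda>y x. min_action H0 V 0 y 1 x)"
  by unfold_locales (rule mcost_limit)

text \<open>Domination by the action comes from domination along minimal chains and
  \<open>mcost_limit\<close>. Periodicity in time identifies the slices at 0 and 1, which turns the
  Lax--Oleinik formula into a fixed point equation.\<close>

theorem weak_kam_of_viscosity:
  assumes sc: "continuous_on UNIV s" and sp: "periodic_1_1 s"
    and vs: "viscosity_solution H0 V (\<lambda>(t, x). a * x - b * t + s (t, x))"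
  shows "twist_kernel.weak_kam (\<lambda>y x. min_action H0 V 0 y 1 x + a * (y - x) + b) (\<lambda>x. s (0, x))"
proof -
  let ?\<Lambda> = "\<lambda>y x. min_action H0 V 0 y 1 x"
  interpret la: limit_action H0 H1 U Ux B K K2 ?\<Lambda> by (rule limit_action_min_action)
  interpret tk: twist_kernel "\<lambda>y x. ?\<Lambda> y x + a * (y - x) + b" by (rule la.twist_kernel_action)
  define S where "S = (\<lambda>(t, x). a * x - b * t + s (t, x))"
  have S_vs: "viscosity_solution H0 V S" using vs by (simp add: S_def)
  have S_cont: "continuous_on UNIV S" using S_vs by (simp add: viscosity_solution_def)
  have sx: "s (t, x + 1) = s (t, x)" for t x using sp by (simp add: periodic_1_1_def)
  then have S_shift: "S (t, x + 1) = S (t, x) + a" for t x by (simp add: S_def distrib_left)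
  have s1: "s (1, x) = s (0, x)" for x using sp unfolding periodic_1_1_def by (metis add_0)
  have dom: "S (1, x) \<le> S (0, y) + ?\<Lambda> y x" for y x
  proof (rule LIMSEQ_le_const)
    have "(\<lambda>n. S (0, y) + mcost n y x + (2 * K / real n) * (1 + (mcost n y x + LB 1 + B))) \<longlonglongrightarrow> S (0, y) + ?\<Lambda> y x + 0 * (1 + (?\<Lambda> y x + LB 1 + B))"
      by (intro tendsto_intros lim_const_over_n mcost_limit)
    then show "(\<lambda>n. S (0, y) + mcost n y x + (2 * K / real n) * (1 + (mcost n y x + LB 1 + B))) \<longlonglongrightarrow> S (0, y) + ?\<Lambda> y x" by simp
    show "\<exists>N. \<forall>n\<ge>N. S (1, x) \<le> S (0, y) + mcost n y x + (2 * K / real n) * (1 + (mcost n y x + LB 1 + B))"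
    proof (intro exI[of _ 1] allI impI)
      fix n :: nat assume "1 \<le> n"
      then have n: "0 < n" by simp
      obtain z where z: "minchain n y x z" using minchain_exists[OF n] by blast
      have "reach (\<lambda>y c. c = S (0, y)) 1 (z n) (S (0, z 0) + cost n z + (2 * K / real n) * (1 + (\<Sum>j<n. \<bar>z (Suc j) - z j\<bar>)))"
        by (intro chain_reach n) simp
      from reach_ge[OF S_cont S_shift subsolution_segment[OF S_vs] this]
      have "S (1, x) \<le> S (0, y) + cost n z + (2 * K / real n) * (1 + (\<Sum>j<n. \<bar>z (Suc j) - z j\<bar>))" using z by (simp add: minchain_def)
      also have "(2 * K / real n) * (1 + (\<Sum>j<n. \<bar>z (Suc j) - z j\<bar>)) \<le> (2 * K / real n) * (1 + (cost n z + LB 1 + B))"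
        using cost_variation[OF n, of z] K_nonneg by (intro mult_left_mono) auto
      finally show "S (1, x) \<le> S (0, y) + mcost n y x + (2 * K / real n) * (1 + (mcost n y x + LB 1 + B))"
        using minchain_cost[OF z] by simp
    qed
  qed
  have approx: "\<exists>y. S (0, y) + ?\<Lambda> y x < S (1, x) + e" if e: "0 < e" for x e
  proof -
    obtain c where c: "reach (\<lambda>y c. c = S (0, y)) 1 x c" "c < S (1, x) + e"
      using lax_oleinik[OF S_vs S_shift _ _ e, of 1 x] by auto
    from min_action_le_reach[OF c(1)] obtain y where "S (0, y) + ?\<Lambda> y x \<le> c" by blast
    then show ?thesis using c(2) by (intro exI[of _ y]) linarith
  qed
  define f where "f x y = s (0, y) + (?\<Lambda> y x + a * (y - x) + b)" for x y
  have f: "f x y = (S (0, y) + ?\<Lambda> y x) - (S (1, x) - s (0, x))" for x y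
    by (simp add: f_def S_def s1 algebra_simps)
  have fc: "continuous_on UNIV (f x)" for x
  proof -
    have "continuous_on UNIV (\<lambda>y. s (0, y))" by (rule continuous_on_compose2[OF sc]) (auto intro!: continuous_intros)
    moreover have "continuous_on UNIV (\<lambda>y. case (y, x) of (y, x) \<Rightarrow> ?\<Lambda> y x + a * (y - x) + b)"
      by (rule continuous_on_compose2[OF tk.k_cont]) (auto intro!: continuous_intros)
    ultimately show ?thesis unfolding f_def[abs_def] by (auto intro!: continuous_on_add)
  qed
  have "compact ((\<lambda>y. s (0, y)) ` {0..1})"
    by (intro compact_continuous_image continuous_on_compose2[OF sc]) (auto intro!: continuous_intros)
  then obtain Cs where Cs: "\<And>y. y \<in> {0..1} \<Longrightarrow> \<bar>s (0, y)\<bar> \<le> Cs"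
    unfolding compact_eq_bounded_closed bounded_iff by force
  have s_bd: "\<bar>s (0, y)\<bar> \<le> Cs" for y
  proof -
    have "s (0, y + of_int (- \<lfloor>y\<rfloor>)) = s (0, y)"
      by (rule periodic_int[of "\<lambda>y. s (0, y)"]) (use sp in \<open>simp add: periodic_1_1_def\<close>)
    moreover have "y + of_int (- \<lfloor>y\<rfloor>) \<in> {0..1}" by simp linarith
    ultimately show ?thesis using Cs by metis
  qed
  obtain Bk where Bk: "\<And>y x. \<bar>x - y\<bar> - Bk \<le> ?\<Lambda> y x + a * (y - x) + b" using tk.k_coercive by blast
  have attained: "\<exists>y. f x y = s (0, x)" for x
  proof -
    \<comment> \<open>Outside this ball coercivity puts \<open>f x y\<close> above
      \<open>f x x\<close>, so the minimum over the ball is global.\<close>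
    define R where "R = \<bar>Bk\<bar> + Cs + \<bar>f x x\<bar>"
    have R: "0 \<le> R" using s_bd[of 0] by (simp add: R_def)
    have "\<exists>y0\<in>cball x R. \<forall>y\<in>cball x R. f x y0 \<le> f x y"
      by (rule continuous_attains_inf) (use R continuous_on_subset[OF fc subset_UNIV] in auto)
    then obtain y0 where y0: "y0 \<in> cball x R" "\<And>y. y \<in> cball x R \<Longrightarrow> f x y0 \<le> f x y" by blast
    have min: "f x y0 \<le> f x y" for y
    proof (cases "y \<in> cball x R")
      case False
      then have "R < \<bar>x - y\<bar>" by (simp add: dist_real_def)
      then have "f x x \<le> f x y" using Bk[of x y] s_bd[of y] unfolding f_def R_def by linarith
      moreover have "f x y0 \<le> f x x" using y0(2)[of x] R by simp
      ultimately show ?thesis by simp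
    qed (use y0 in blast)
    have "f x y0 \<le> s (0, x)"
    proof (rule field_le_epsilon)
      fix e :: real assume "0 < e"
      then obtain y where "S (0, y) + ?\<Lambda> y x < S (1, x) + e" using approx by blast
      then show "f x y0 \<le> s (0, x) + e" using min[of y] f[of x y] by linarith
    qed
    moreover have "s (0, x) \<le> f x y0" using dom[of x y0] f[of x y0] by linarith
    ultimately show ?thesis by (intro exI[of _ y0]) simp
  qed
  show ?thesis
    unfolding tk.weak_kam_def
  proof (intro conjI allI)
    show "continuous_on UNIV (\<lambda>x. s (0, x))" by (rule continuous_on_compose2[OF sc]) (auto intro!: continuous_intros)
    show "s (0, x + 1) = s (0, x)" for x using sp by (simp add: periodic_1_1_def)
    show "s (0, x) \<le> s (0, y) + (?\<Lambda> y x + a * (y - x) + b)" for y x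
      using dom[of x y] f[of x y] by (simp add: f_def)
    show "tk.minimizers (\<lambda>x. s (0, x)) x \<noteq> {}" for x
      using attained[of x] by (auto simp: tk.minimizers_def f_def)
  qed
qed

text \<open>Comparison in both directions settles times in the unit interval, periodicity in time
  the rest.\<close>

lemma viscosity_difference_constant:
  assumes sp: "periodic_1_1 s" and sp': "periodic_1_1 s'"
    and vs: "viscosity_solution H0 V (\<lambda>(t, x). a * x - b * t + s (t, x))"
    and vs': "viscosity_solution H0 V (\<lambda>(t, x). a * x - b * t + s' (t, x))"
    and init: "\<And>x. s' (0, x) - s (0, x) = c"
  shows "s' z - s z = c"
proof -
  define S where "S = (\<lambda>(t, x). a * x - b * t + s (t, x))"
  define S' where "S' = (\<lambda>(t, x). a * x - b * t + s' (t, x))"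
  have sx: "s (t, x + 1) = s (t, x)" "s' (t, x + 1) = s' (t, x)" for t x
    using sp sp' by (simp_all add: periodic_1_1_def)
  then have sh: "S (t, x + 1) = S (t, x) + a" "S' (t, x + 1) = S' (t, x) + a" for t x
    by (simp_all add: S_def S'_def distrib_left)
  have in0: "S' (0, x) = S (0, x) + c" "S (0, x) = S' (0, x) + - c" for x
    using init[of x] by (auto simp: S_def S'_def)
  have *: "s' (t, x) - s (t, x) = c" if "0 \<le> t" "t \<le> 1" for t x
    using viscosity_unique[OF vs[folded S_def] vs'[folded S'_def] sh in0(1) that, of x]
      viscosity_unique[OF vs'[folded S'_def] vs[folded S_def] sh(2,1) in0(2) that, of x]
    by (simp add: S_def S'_def)
  obtain t x where z: "z = (t, x)" by (cases z)
  have "s' (t + of_int (- \<lfloor>t\<rfloor>), x) = s' (t, x)"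
    by (rule periodic_int[of "\<lambda>t. s' (t, x)"]) (use sp' in \<open>simp add: periodic_1_1_def\<close>)
  moreover have "s (t + of_int (- \<lfloor>t\<rfloor>), x) = s (t, x)"
    by (rule periodic_int[of "\<lambda>t. s (t, x)"]) (use sp in \<open>simp add: periodic_1_1_def\<close>)
  moreover have "0 \<le> t + of_int (- \<lfloor>t\<rfloor>)" "t + of_int (- \<lfloor>t\<rfloor>) \<le> 1" by linarith+
  ultimately show ?thesis using *[of "t + of_int (- \<lfloor>t\<rfloor>)" x] by (simp add: z)
qed

end

lemma periodic_C1_potential:
  assumes U_C1: "C1_on_plane U" and U_periodic: "periodic_1_1 U"
  obtains B K where "\<And>z. \<bar>U z\<bar> \<le> B"
    "\<And>t x t' x'. \<bar>U (t, x) - U (t', x')\<bar> \<le> K * (\<bar>t - t'\<bar> + \<bar>x - x'\<bar>)"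
    "\<And>t x. ((\<lambda>x. U (t, x)) has_real_derivative partial_x U (t, x)) (at x)"
proof -
  obtain f' where f': "\<And>z. (U has_derivative blinfun_apply (f' z)) (at z)" and c: "continuous_on UNIV f'"
    using U_C1 unfolding C1_on_plane_def by blast
  have per: "U (t + 1, x) = U (t, x)" "U (t, x + 1) = U (t, x)" for t x using U_periodic by (auto simp: periodic_1_1_def)
  \<comment> \<open>Uniqueness of the derivative makes it periodic as well, so continuity on one
    period bounds it everywhere.\<close>
  have f'_shift: "f' (z + w) = f' z" if w: "\<And>z. U (z + w) = U z" for z w
  proof -
    have "((\<lambda>z. z + w) has_derivative (\<lambda>h. h)) (at z)" by (auto intro!: derivative_eq_intros)
    from has_derivative_compose[OF this f'[of "z + w"]]
    have "(U has_derivative blinfun_apply (f' (z + w))) (at z)" by (simp add: w)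
    from has_derivative_unique[OF this f'[of z]] show ?thesis by (simp add: blinfun_apply_inject)
  qed
  have f'_per: "f' (t + 1, x) = f' (t, x)" "f' (t, x + 1) = f' (t, x)" for t x
    using f'_shift[of "(1, 0)" "(t, x)"] f'_shift[of "(0, 1)" "(t, x)"] per by (auto simp: split_paired_all)
  have bounded: "\<exists>C. \<forall>z. norm (g z) \<le> C"
    if g: "continuous_on UNIV g" "\<And>t x. g (t + 1, x) = g (t, x)" "\<And>t x. g (t, x + 1) = g (t, x)"
    for g :: "real \<times> real \<Rightarrow> 'c::real_normed_vector"
  proof -
    have "compact (g ` ({0..1} \<times> {0..1}))"
      by (intro compact_continuous_image compact_Times continuous_on_subset[OF g(1)]) auto
    from compact_imp_bounded[OF this] obtain C where "\<forall>y\<in>g ` ({0..1} \<times> {0..1}). norm y \<le> C"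
      unfolding bounded_iff by blast
    then have C: "\<And>z. z \<in> {0..1} \<times> {0..1} \<Longrightarrow> norm (g z) \<le> C" by blast
    have "norm (g (t, x)) \<le> C" for t x
    proof -
      define t' x' where "t' = t + of_int (- \<lfloor>t\<rfloor>)" and "x' = x + of_int (- \<lfloor>x\<rfloor>)"
      have "g (t', x') = g (t, x')"
        unfolding t'_def by (rule periodic_int[of "\<lambda>t. g (t, x')"]) (rule g(2))
      moreover have "g (t, x') = g (t, x)"
        unfolding x'_def by (rule periodic_int[of "\<lambda>x. g (t, x)"]) (rule g(3))
      moreover have "0 \<le> t'" "t' \<le> 1" "0 \<le> x'" "x' \<le> 1" unfolding t'_def x'_def by linarith+
      ultimately show ?thesis using C[of "(t', x')"] by simp
    qed
    then show ?thesis by auto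
  qed
  have Uc: "continuous_on UNIV U" using f' by (meson continuous_at_imp_continuous_on has_derivative_continuous)
  obtain B where B: "\<And>z. norm (U z) \<le> B" using bounded[OF Uc] per by blast
  obtain K where K: "\<And>z. norm (f' z) \<le> K" using bounded[OF c] f'_per by blast
  show thesis
  proof (rule that[of B K])
    show "\<bar>U z\<bar> \<le> B" for z using B[of z] by simp
    fix t x t' x' :: real
    have "norm (U (t, x) - U (t', x')) \<le> K * norm ((t, x) - (t', x'))"
      by (rule differentiable_bound[of UNIV U "\<lambda>z. blinfun_apply (f' z)"])
        (use f' K in \<open>auto simp: norm_blinfun.rep_eq[symmetric]\<close>)
    also have "\<dots> \<le> K * (\<bar>t - t'\<bar> + \<bar>x - x'\<bar>)"
    proof (rule mult_left_mono)
      show "norm ((t, x) - (t', x')) \<le> \<bar>t - t'\<bar> + \<bar>x - x'\<bar>"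
        by (simp add: norm_prod_def) (rule order_trans[OF sqrt_sum_squares_le_sum_abs], simp)
      show "0 \<le> K" using K[of 0] norm_ge_zero order_trans by blast
    qed
    finally show "\<bar>U (t, x) - U (t', x')\<bar> \<le> K * (\<bar>t - t'\<bar> + \<bar>x - x'\<bar>)" by simp
    have "((\<lambda>x. (t, x)) has_derivative (\<lambda>h. (0, h))) (at x)" by (auto intro!: derivative_eq_intros)
    from has_derivative_compose[OF this f'[of "(t, x)"]]
    have "((\<lambda>x. U (t, x)) has_derivative (\<lambda>h. blinfun_apply (f' (t, x)) (0, h))) (at x)" .
    then have "(\<lambda>x. U (t, x)) field_differentiable at x"
      using differentiable_def real_differentiable_def field_differentiable_def by blast
    then show "((\<lambda>x. U (t, x)) has_real_derivative partial_x U (t, x)) (at x)"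
      unfolding partial_x_def by (simp add: DERIV_deriv_iff_field_differentiable)
  qed
qed

theorem mainTheorem2:
  fixes H0 :: "real \<Rightarrow> real" and U :: "real \<times> real \<Rightarrow> real"
    and a :: real and s :: "real \<times> real \<Rightarrow> real"
  assumes H0_C1: "H0 C1_differentiable_on UNIV"
    and H0_deriv_mono: "strict_mono (deriv H0)"
    and H0_deriv_lipschitz: "\<And>P. P > 0 \<Longrightarrow> \<exists>K. K-lipschitz_on {-P..P} (deriv H0)"
    and H0_growth: "\<And>N. N > 0 \<Longrightarrow> \<exists>P>0. \<forall>p. \<bar>p\<bar> > P \<longrightarrow> H0 p > N * \<bar>p\<bar>"
    and U_C1: "C1_on_plane U"
    and U_x_lipschitz: "\<exists>K. K-lipschitz_on UNIV (partial_x U)"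
    and U_periodic: "periodic_1_1 U"
    and s_cont: "continuous_on UNIV s"
    and s_periodic: "periodic_1_1 s"
    and s_viscosity: "viscosity_solution H0 U (\<lambda>(t, x). a * x - Hlim H0 U a * t + s (t, x))"
    and irrational: "rotation_number H0 U a s \<notin> \<rat>"
  shows "\<forall>s'. continuous_on UNIV s' \<longrightarrow> periodic_1_1 s' \<longrightarrow>
           viscosity_solution H0 U (\<lambda>(t, x). a * x - Hlim H0 U a * t + s' (t, x)) \<longrightarrow>
           (\<exists>c. \<forall>z. s' z - s z = c)"
proof (intro allI impI)
  fix s' :: "real \<times> real \<Rightarrow> real"
  assume s': "continuous_on UNIV s'" "periodic_1_1 s'"
    "viscosity_solution H0 U (\<lambda>(t, x). a * x - Hlim H0 U a * t + s' (t, x))"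
  obtain D where D: "\<And>p. (H0 has_vector_derivative D p) (at p)" "continuous_on UNIV D"
    using H0_C1 unfolding C1_differentiable_on_def by blast
  have Dd: "deriv H0 = D"
    using D(1) by (auto simp: has_real_derivative_iff_has_vector_derivative[symmetric] intro!: DERIV_imp_deriv)
  obtain B K where BK: "\<And>z. \<bar>U z\<bar> \<le> B"
    "\<And>t x t' x'. \<bar>U (t, x) - U (t', x')\<bar> \<le> K * (\<bar>t - t'\<bar> + \<bar>x - x'\<bar>)"
    "\<And>t x. ((\<lambda>x. U (t, x)) has_real_derivative partial_x U (t, x)) (at x)"
    using periodic_C1_potential[OF U_C1 U_periodic] by blast
  obtain K2 where K2: "K2-lipschitz_on UNIV (partial_x U)" using U_x_lipschitz by blast
  interpret h: hamiltonian H0 "deriv H0" "\<lambda>t x. U (t, x)" "\<lambda>t x. partial_x U (t, x)" B K K2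
  proof
    show "(H0 has_real_derivative deriv H0 p) (at p)" for p
      unfolding Dd using D(1) by (simp add: has_real_derivative_iff_has_vector_derivative)
    show "continuous_on UNIV (deriv H0)" unfolding Dd by (rule D(2))
    show "\<exists>c\<ge>0. \<forall>p q. \<bar>p\<bar> \<le> R \<longrightarrow> \<bar>q\<bar> \<le> R \<longrightarrow> \<bar>deriv H0 p - deriv H0 q\<bar> \<le> c * \<bar>p - q\<bar>" if R: "0 < R" for R
    proof -
      obtain c where c: "c-lipschitz_on {- R..R} (deriv H0)" using H0_deriv_lipschitz[OF R] by blast
      show ?thesis
        using lipschitz_on_nonneg[OF c] lipschitz_onD[OF c]
        by (intro exI[of _ c]) (auto simp: dist_real_def abs_le_iff)
    qed
    show "\<bar>partial_x U (t, x) - partial_x U (t, x')\<bar> \<le> K2 * \<bar>x - x'\<bar>" for t x x'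
      using lipschitz_onD[OF K2, of "(t, x)" "(t, x')"] by (simp add: dist_prod_def dist_real_def)
    show "U (t, x + 1) = U (t, x)" for t x using U_periodic by (simp add: periodic_1_1_def)
  qed (use H0_deriv_mono H0_growth BK in auto)
  have VU: "h.V = U" by auto
  define k where "k y x = min_action H0 U 0 y 1 x + a * (y - x) + Hlim H0 U a" for y x
  interpret tk: twist_kernel k
    using limit_action.twist_kernel_action[OF h.limit_action_min_action] unfolding k_def[abs_def] VU .
  have kLa: "La H0 U a = k" by (intro ext) (simp add: La_def k_def)
  define u where "u x = s (0, x)" for x
  have wk: "tk.weak_kam u" "tk.weak_kam (\<lambda>x. s' (0, x))"
    using h.weak_kam_of_viscosity[OF s_cont s_periodic, unfolded VU, OF s_viscosity]
      h.weak_kam_of_viscosity[OF s'(1,2), unfolded VU, OF s'(3)]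
    unfolding u_def[abs_def] k_def[abs_def] by auto
  \<comment> \<open>From here the dynamical notions of the statement are identified, one after the
    other, with those of the abstract kernel.\<close>
  have Y: "Ya H0 U a s = tk.minimizers u" by (auto simp: Ya_def tk.minimizers_def u_def kLa fun_eq_iff)
  have "Mn H0 U a s n = tk.iterated u n" for n by (induction n) (simp_all add: tk.iterated_simps Y)
  then have M: "Ma H0 U a s = tk.invariant_set u" by (simp add: Ma_def tk.invariant_set_def)
  have "Ya_map H0 U a s = tk.pred_map u" by (simp add: Ya_map_def Y fun_eq_iff)
  then have O: "orbit H0 U a s = tk.full_orbit u" by (intro ext) (simp add: orbit_def tk.full_orbit_def M)
  obtain c where "\<And>x. s' (0, x) - u x = c"
    using tk.weak_kam_unique_irrational_rotation[OF wk] irrational unfolding rotation_number_def M O by blast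
  then show "\<exists>c. \<forall>z. s' z - s z = c"
    using h.viscosity_difference_constant[OF s_periodic s'(2), unfolded VU, OF s_viscosity s'(3)] unfolding u_def by blast
qed

end
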